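(* Let $n\ge1$, $z=x+iy\in\Pi$ and $w=u+iv\in\Pi$. The reproducing kernel $\mathbf{K}(z,w)$ of the image of $P_T$ is given by $\mathbf{K}(z,w)=(K_{jk}(z,w))_{j,k=1,\dots,n}$, where $$K_{nn}(z,w)=G_{2(n-1)}(z,w)=\frac{-1}{\pi[z-\overline w+2(n-1)i]^2},$$ $$K_{jk}(z,w)=-G_{j+k}(z,w)+G_{j+k-2}(z,w),\qquad j,k=1,\dots,n-1,$$ and, for $j=1,\dots,n-1$ and $p=-i(z-\overline w)+j+(n-2)$, $$K_{jn}(z,w)=\frac1\pi J(p)\left(\beta(p)+\frac1{p+1}\right)=\frac{J(p)}{2\pi}\left[H\left(\frac{p+1}2\right)-H\left(\frac p2\right)+\frac2p\right].$$
   Context: $\Pi=\{z=x+iy: y>0\}$ with Lebesgue area measure; $\mathcal{A}^2(\Pi)$ is the Bergman space of holomorphic functions in $L_2(\Pi)$, and $T_a$ denotes the Toeplitz operator on $\mathcal{A}^2(\Pi)$, $T_af=B(af)$, with $B$ the orthogonal projection of $L_2(\Pi)$ onto $\mathcal{A}^2(\Pi)$. For $1\le k\le n-1$ let $a_k(z)=\chi_{[k-1,k)}(\operatorname{Im}z)$, and $a_n(z)=\chi_{[n-1,\infty)}(\operatorname{Im}z)$. $P_T=(\sqrt{T_{a_j}}\sqrt{T_{a_k}})_{j,k=1}^n$ is an orthogonal projection on $(\mathcal{A}^2(\Pi))^n$. The reproducing kernel of the image of $P_T$ is the $n\times n$-matrix-valued integral kernel of $P_T$: $$(P_T\phi)(z)=\int_\Pi\mathbf{K}(z,w)\phi(w)\,du\,dv,\qquad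 \phi\in(\mathcal{A}^2(\Pi))^n,\ w=u+iv,$$ with $\mathbf{K}(z,w)=\frac1{2\pi}\int_0^\infty e^{it(x-u)}\,2t\,\ell_0(2ty)\ell_0(2tv)P_\gamma(t)\,dt$, where $\ell_0(y)=e^{-y/2}$ for $y>0$, $P_\gamma=\left(\sqrt{\gamma^{a_j}}\sqrt{\gamma^{a_k}}\right)_{j,k=1}^n$, $\gamma^{a_k}(t)=e^{-2kt}(e^{2t}-1)$ for $1\le k\le n-1$, $\gamma^{a_n}(t)=e^{-2(n-1)t}$. Functions used: $G_m(z,w)=\dfrac{-1}{\pi[z-\overline w+mi]^2}$ for $m\in\mathbb{Z}$. $J(p)=\int_0^\infty e^{-pt}(1-e^{-2t})^{1/2}dt=\frac{\sqrt\pi}{4}\frac{\Gamma(p/2)}{\Gamma(p/2+3/2)}$, $\operatorname{Re}p>0$. Nielsen's beta function: $\beta(z)=\int_0^\infty\frac{e^{-zt}}{1+e^{-t}}dt=\sum_{m=0}^\infty\frac{(-1)^m}{z+m}$, $\operatorname{Re}z>0$. Harmonic function: $H(z)=\psi(z+1)+\gamma$, with $\psi=\Gamma'/\Gamma$ the digamma function and $\gamma=-\psi(1)$ the Euler–Mascheroni constant. *)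

theory Defs
  imports "HOL-Complex_Analysis.Complex_Analysis"
begin

section \<open>The Bergman space of the upper half-plane\<close>

definition upper_hp :: "complex set" where
  "upper_hp = {z. Im z > 0}"

text \<open>
  Functions on the half-plane are total functions on the complex numbers. Elements of the Bergman
  space are normalised to vanish off the half-plane, so that equality of functions on the
  half-plane is equality in HOL. Area measure is \<^term>\<open>lborel\<close> on the complex plane.
\<close>

definition inner_L2 :: "(complex \<Rightarrow> complex) \<Rightarrow> (complex \<Rightarrow> complex) \<Rightarrow> complex" where
  "inner_L2 f g = set_lebesgue_integral lborel upper_hp (\<lambda>z. f z * cnj (g z))"

definition norm_L2 :: "(complex \<Rightarrow> complex) \<Rightarrow> real" where
  "norm_L2 f = sqrt (set_lebesgue_integral lborel upper_hp (\<lambda>z. (cmod (f z))\<^sup>2))"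

definition bergman_space :: "(complex \<Rightarrow> complex) set" where
  "bergman_space = {f. f holomorphic_on upper_hp \<and>
     set_integrable lborel upper_hp (\<lambda>z. (cmod (f z))\<^sup>2) \<and> (\<forall>z. z \<notin> upper_hp \<longrightarrow> f z = 0)}"

definition bergman_projection :: "(complex \<Rightarrow> complex) \<Rightarrow> (complex \<Rightarrow> complex)" where
  "bergman_projection f = (THE g. g \<in> bergman_space \<and>
     (\<forall>h\<in>bergman_space. inner_L2 (\<lambda>z. f z - g z) h = 0))"


section \<open>Toeplitz operators and square roots of positive operators\<close>

definition toeplitz ::
  "(complex \<Rightarrow> complex) \<Rightarrow> (complex \<Rightarrow> complex) \<Rightarrow> (complex \<Rightarrow> complex)" where
  "toeplitz a = (\<lambda>f\<in>bergman_space. bergman_projection (\<lambda>z. a z * f z))"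

text \<open>
  Operators on the Bergman space are extensional functions, again so that they are determined
  as HOL functions by their values on the space.
\<close>

definition bounded_operator :: "((complex \<Rightarrow> complex) \<Rightarrow> (complex \<Rightarrow> complex)) \<Rightarrow> bool" where
  "bounded_operator S \<longleftrightarrow> S \<in> bergman_space \<rightarrow>\<^sub>E bergman_space \<and>
     (\<forall>f\<in>bergman_space. \<forall>g\<in>bergman_space. S (\<lambda>z. f z + g z) = (\<lambda>z. S f z + S g z)) \<and>
     (\<forall>c. \<forall>f\<in>bergman_space. S (\<lambda>z. c * f z) = (\<lambda>z. c * S f z)) \<and>
     (\<exists>C. \<forall>f\<in>bergman_space. norm_L2 (S f) \<le> C * norm_L2 f)"

definition positive_operator :: "((complex \<Rightarrow> complex) \<Rightarrow> (complex \<Rightarrow> complex)) \<Rightarrow> bool" where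
  "positive_operator S \<longleftrightarrow> bounded_operator S \<and>
     (\<forall>f\<in>bergman_space. inner_L2 (S f) f \<in> \<real> \<and> 0 \<le> Re (inner_L2 (S f) f))"

definition sqrt_operator ::
  "((complex \<Rightarrow> complex) \<Rightarrow> (complex \<Rightarrow> complex)) \<Rightarrow> ((complex \<Rightarrow> complex) \<Rightarrow> (complex \<Rightarrow> complex))" where
  "sqrt_operator T = (THE S. positive_operator S \<and> (\<forall>f\<in>bergman_space. S (S f) = T f))"


section \<open>The projection \<open>P\<^sub>T\<close>\<close>

definition strip_symbol :: "nat \<Rightarrow> nat \<Rightarrow> complex \<Rightarrow> complex" where
  "strip_symbol n k z =
     (if k < n then indicator {real k - 1..<real k} (Im z) else indicator {real n - 1..} (Im z))"

text \<open>Vectors of length \<open>n\<close> are extensional families indexed by \<open>{1..n}\<close>.\<close>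

definition bergman_vec :: "nat \<Rightarrow> (nat \<Rightarrow> complex \<Rightarrow> complex) set" where
  "bergman_vec n = {1..n} \<rightarrow>\<^sub>E bergman_space"

definition inner_vec ::
  "nat \<Rightarrow> (nat \<Rightarrow> complex \<Rightarrow> complex) \<Rightarrow> (nat \<Rightarrow> complex \<Rightarrow> complex) \<Rightarrow> complex" where
  "inner_vec n f g = (\<Sum>j=1..n. inner_L2 (f j) (g j))"

definition P_T :: "nat \<Rightarrow> (nat \<Rightarrow> complex \<Rightarrow> complex) \<Rightarrow> (nat \<Rightarrow> complex \<Rightarrow> complex)" where
  "P_T n \<phi> = (\<lambda>j\<in>{1..n}. \<lambda>z. \<Sum>k=1..n.
     sqrt_operator (toeplitz (strip_symbol n j))
       (sqrt_operator (toeplitz (strip_symbol n k)) (\<phi> k)) z)"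


section \<open>Matrix-valued kernels\<close>

text \<open>
  In \<open>K z w j k\<close> the points are \<open>z\<close>, \<open>w\<close> and the matrix position is row \<open>j\<close>, column \<open>k\<close>.
\<close>

type_synonym matrix_kernel = "complex \<Rightarrow> complex \<Rightarrow> nat \<Rightarrow> nat \<Rightarrow> complex"

definition kernel_column ::
  "nat \<Rightarrow> matrix_kernel \<Rightarrow> complex \<Rightarrow> nat \<Rightarrow> (nat \<Rightarrow> complex \<Rightarrow> complex)" where
  "kernel_column n K w k = (\<lambda>j\<in>{1..n}. \<lambda>z. if z \<in> upper_hp then K z w j k else 0)"

definition is_reproducing_kernel ::
  "nat \<Rightarrow> (nat \<Rightarrow> complex \<Rightarrow> complex) set \<Rightarrow> matrix_kernel \<Rightarrow> bool" where
  "is_reproducing_kernel n M K \<longleftrightarrow> (\<forall>w\<in>upper_hp. \<forall>k\<in>{1..n}.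
     kernel_column n K w k \<in> M \<and> (\<forall>f\<in>M. f k w = inner_vec n f (kernel_column n K w k)))"

text \<open>
  A reproducing kernel is determined only for points of the half-plane and indices in \<open>{1..n}\<close>;
  its values for other arguments are irrelevant.
\<close>

definition reproducing_kernel ::
  "nat \<Rightarrow> (nat \<Rightarrow> complex \<Rightarrow> complex) set \<Rightarrow> matrix_kernel" where
  "reproducing_kernel n M = (SOME K. is_reproducing_kernel n M K)"

definition is_integral_kernel ::
  "nat \<Rightarrow> ((nat \<Rightarrow> complex \<Rightarrow> complex) \<Rightarrow> (nat \<Rightarrow> complex \<Rightarrow> complex)) \<Rightarrow> matrix_kernel \<Rightarrow> bool" where
  "is_integral_kernel n P K \<longleftrightarrow> (\<forall>\<phi>\<in>bergman_vec n. \<forall>z\<in>upper_hp. \<forall>j\<in>{1..n}.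
     set_integrable lborel upper_hp (\<lambda>w. \<Sum>k=1..n. K z w j k * \<phi> k w) \<and>
     P \<phi> j z = set_lebesgue_integral lborel upper_hp (\<lambda>w. \<Sum>k=1..n. K z w j k * \<phi> k w))"

definition K_T :: "nat \<Rightarrow> matrix_kernel" where
  "K_T n = reproducing_kernel n (P_T n ` bergman_vec n)"


section \<open>Special functions\<close>

definition G :: "int \<Rightarrow> complex \<Rightarrow> complex \<Rightarrow> complex" where
  "G m z w = -1 / (of_real pi * (z - cnj w + of_int m * \<i>)\<^sup>2)"

definition J :: "complex \<Rightarrow> complex" where
  "J p = set_lebesgue_integral lborel {0<..}
     (\<lambda>t::real. exp (- p * of_real t) * of_real (sqrt (1 - exp (- 2 * t))))"

definition nielsen_beta :: "complex \<Rightarrow> complex" where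
  "nielsen_beta z = set_lebesgue_integral lborel {0<..}
     (\<lambda>t::real. exp (- z * of_real t) / of_real (1 + exp (- t)))"

definition harmonic_fun :: "complex \<Rightarrow> complex" where
  "harmonic_fun z = Digamma (z + 1) + euler_mascheroni"

end

theory Submission
  imports Defs
begin

text \<open>
  Write \<open>V\<^sub>s f(z) = f(z + i s)\<close> for \<open>s \<ge> 0\<close> and \<open>k\<^sub>w(z) = -1 / (\<pi> (z - cnj w)\<^sup>2)\<close> for the
  Bergman kernel of the half-plane. Under the Fourier-Laplace representation of the Bergman space
  \<open>V\<^sub>s\<close> is multiplication by \<open>e\<^sup>-\<^sup>s\<^sup>t\<close>, and a Toeplitz operator with a symbol depending on \<open>Im z\<close>
  only is multiplication by a function of \<open>t\<close>. For the strips in question these functions are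
  elementary expressions in \<open>e\<^sup>-\<^sup>t\<close>, so the proof takes place in the algebra generated by the
  shifts \<open>V\<^sub>s\<close>.

  The shifts form a semigroup of contractions. They are self-adjoint, because
  \<open>V\<^sub>s f(w) = \<langle>f, k\<^bsub>w+is\<^esub>\<rangle>\<close> and the kernel \<open>k\<^bsub>w+is\<^esub>(z)\<close> is Hermitian in \<open>z\<close> and \<open>w\<close>
  (\<open>bergman_reproducing\<close>, \<open>vshift_selfadjoint\<close>), and they are positive, because
  \<open>V\<^sub>s = V\<^bsub>s/2\<^esub> V\<^bsub>s/2\<^esub>\<close>. Integrating \<open>f cnj h\<close> over \<open>Im z > s\<close> gives
  \<open>\<langle>V\<^sub>s f, V\<^sub>s h\<rangle> = \<langle>V\<^bsub>2s\<^esub> f, h\<rangle>\<close>, so the Toeplitz operator of the strip \<open>k - 1 \<le> Im z < k\<close> is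
  \<open>V\<^bsub>2(k-1)\<^esub> - V\<^bsub>2k\<^esub>\<close>, and that of the half-plane \<open>Im z \<ge> n - 1\<close> is \<open>V\<^bsub>2(n-1)\<^esub>\<close>.

  Let \<open>R = \<Sum> c\<^sub>m V\<^bsub>2m\<^esub>\<close>, where \<open>\<Sum> c\<^sub>m x\<^sup>m = \<surd>(1 - x)\<close>. This series converges absolutely up to
  \<open>x = 1\<close>, \<open>R\<close> is positive since \<open>c\<^sub>m \<le> 0\<close> for \<open>m > 0\<close> and all partial sums of the \<open>c\<^sub>m\<close> are
  nonnegative, and \<open>R\<^sup>2 = 1 - V\<^sub>2\<close>. Hence \<open>S\<^sub>k = V\<^bsub>k-1\<^esub> R\<close> for \<open>k < n\<close>, and
  \<open>S\<^sub>n = V\<^bsub>n-1\<^esub>\<close>, are positive square roots of the Toeplitz operators, and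
  \<open>positive_square_root_unique\<close> shows that they are the only ones. From \<open>\<Sum> S\<^sub>k\<^sup>2 = 1\<close>, a telescoping
  sum, it follows that the matrix \<open>(S\<^sub>j S\<^sub>k)\<close> is an orthogonal projection whose kernel has the
  entries \<open>(S\<^sub>j S\<^sub>k k\<^sub>w)(z)\<close>.

  The products \<open>S\<^sub>j S\<^sub>k = V\<^bsub>j+k-2\<^esub> - V\<^bsub>j+k\<^esub>\<close> and \<open>S\<^sub>n S\<^sub>n = V\<^bsub>2(n-1)\<^esub>\<close> give the functions \<open>G\<close>
  at once, since \<open>V\<^sub>m k\<^sub>w(z) = G\<^sub>m(z, w)\<close>. The entry for \<open>S\<^sub>j S\<^sub>n = V\<^bsub>j+n-2\<^esub> R\<close> is
  \<open>1/\<pi> \<Sum> c\<^sub>m / (p + 2m)\<^sup>2\<close>, which is \<open>-J'(p) / \<pi>\<close> because \<open>J(p) = \<Sum> c\<^sub>m / (p + 2m)\<close>. Up to the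
  factor \<open>1/2\<close>, \<open>J(p)\<close> is Euler's Beta function at \<open>3/2\<close> and \<open>p/2\<close>, so \<open>-J'/J\<close> is half the
  difference of two digamma values, which is Nielsen's beta function up to a rational term
  (\<open>J_beta_product\<close>).
\<close>

section \<open>Area measure in Cartesian coordinates\<close>

lemma borel_measurable_cnj [measurable (raw)]:
  "f \<in> borel_measurable M \<Longrightarrow> (\<lambda>x. cnj (f x)) \<in> borel_measurable M"
  by (rule borel_measurable_continuous_on[where f = cnj]) (auto intro: continuous_intros)

lemma measurable_Complex_pair: "(\<lambda>(x, y). Complex x y) \<in> borel_measurable (lborel \<Otimes>\<^sub>M lborel)"
proof -
  have "(\<lambda>p. complex_of_real (fst p) + \<i> * complex_of_real (snd p)) \<in> borel_measurable (lborel \<Otimes>\<^sub>M lborel)"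
    by measurable
  then show ?thesis by (simp add: case_prod_unfold Complex_eq)
qed

text \<open>
  The box test for Lebesgue measure: both measures give a box the product of its side lengths.
\<close>

lemma lborel_complex_eq:
  "(lborel :: complex measure) = distr (lborel \<Otimes>\<^sub>M lborel) borel (\<lambda>(x, y). Complex x y)"
proof (rule lborel_eqI)
  note [measurable] = measurable_Complex_pair
  fix l u :: complex
  assume le: "\<And>b. b \<in> Basis \<Longrightarrow> l \<bullet> b \<le> u \<bullet> b"
  have "Re l \<le> Re u" "Im l \<le> Im u"
    using le[of 1] le[of \<i>] by (auto simp: Basis_complex_def)
  moreover have "(\<lambda>(x, y). Complex x y) -` box l u = {Re l<..<Re u} \<times> {Im l<..<Im u}"
    by (auto simp: in_box_complex_iff)
  moreover have "(\<Prod>b\<in>Basis. (u - l) \<bullet> b) = (Re u - Re l) * (Im u - Im l)"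
    by (simp add: Basis_complex_def inner_diff_left)
  ultimately show "emeasure (distr (lborel \<Otimes>\<^sub>M lborel) borel (\<lambda>(x, y). Complex x y)) (box l u)
      = ennreal (\<Prod>b\<in>Basis. (u - l) \<bullet> b)"
    by (simp add: emeasure_distr space_pair_measure lborel.emeasure_pair_measure_Times ennreal_mult)
qed simp

lemma nn_integral_complex:
  assumes f: "f \<in> borel_measurable borel"
  shows "(\<integral>\<^sup>+z. f z \<partial>lborel) = (\<integral>\<^sup>+y. \<integral>\<^sup>+x. f (Complex x y) \<partial>lborel \<partial>lborel)"
    and "(\<integral>\<^sup>+z. f z \<partial>lborel) = (\<integral>\<^sup>+x. \<integral>\<^sup>+y. f (Complex x y) \<partial>lborel \<partial>lborel)"
proof -
  note [measurable] = measurable_Complex_pair f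
  have m: "(\<lambda>p. f (case p of (x, y) \<Rightarrow> Complex x y)) \<in> borel_measurable (lborel \<Otimes>\<^sub>M lborel)"
    by measurable
  have eq: "(\<integral>\<^sup>+z. f z \<partial>lborel)
      = (\<integral>\<^sup>+p. f (case p of (x, y) \<Rightarrow> Complex x y) \<partial>(lborel \<Otimes>\<^sub>M lborel))"
    by (subst lborel_complex_eq) (simp add: nn_integral_distr)
  show "(\<integral>\<^sup>+z. f z \<partial>lborel) = (\<integral>\<^sup>+y. \<integral>\<^sup>+x. f (Complex x y) \<partial>lborel \<partial>lborel)"
    using lborel_pair.nn_integral_snd[OF m] eq by simp
  show "(\<integral>\<^sup>+z. f z \<partial>lborel) = (\<integral>\<^sup>+x. \<integral>\<^sup>+y. f (Complex x y) \<partial>lborel \<partial>lborel)"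
    using lborel.nn_integral_fst[OF m] eq by simp
qed

lemma integral_complex:
  fixes f :: "complex \<Rightarrow> complex"
  assumes f: "integrable lborel f"
  shows "integrable lborel (\<lambda>y. \<integral>x. f (Complex x y) \<partial>lborel)"
    and "(\<integral>z. f z \<partial>lborel) = (\<integral>y. \<integral>x. f (Complex x y) \<partial>lborel \<partial>lborel)"
proof -
  note [measurable] = measurable_Complex_pair
  have fm[measurable]: "f \<in> borel_measurable borel" using f by simp
  have i: "integrable (lborel \<Otimes>\<^sub>M lborel) (\<lambda>(x, y). f (Complex x y))"
    using f by (subst (asm) lborel_complex_eq) (simp add: integrable_distr_eq case_prod_unfold)
  have eq: "(\<integral>z. f z \<partial>lborel) = (\<integral>(x, y). f (Complex x y) \<partial>(lborel \<Otimes>\<^sub>M lborel))"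
    by (subst lborel_complex_eq) (simp add: integral_distr case_prod_unfold)
  show "integrable lborel (\<lambda>y. \<integral>x. f (Complex x y) \<partial>lborel)"
    using lborel_pair.integrable_snd[OF i] .
  show "(\<integral>z. f z \<partial>lborel) = (\<integral>y. \<integral>x. f (Complex x y) \<partial>lborel \<partial>lborel)"
    using lborel_pair.integral_snd[OF i] eq by simp
qed

lemma nn_integral_translate:
  fixes a :: complex
  assumes [measurable]: "f \<in> borel_measurable borel"
  shows "(\<integral>\<^sup>+z. f (z + a) \<partial>lborel) = (\<integral>\<^sup>+z. f z \<partial>lborel)"
  by (subst lborel_distr_plus[of a, symmetric]) (simp add: nn_integral_distr add.commute)

lemma integral_translate:
  fixes a :: complex and f :: "complex \<Rightarrow> complex"
  assumes [measurable]: "f \<in> borel_measurable borel"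
  shows "(\<integral>z. f (z + a) \<partial>lborel) = (\<integral>z. f z \<partial>lborel)"
  by (subst lborel_distr_plus[of a, symmetric]) (simp add: integral_distr add.commute)


section \<open>Square-integrable functions on the half-plane\<close>

text \<open>
  The ambient space \<open>L\<^sub>2\<close> of the half-plane, with the same normalisation as the Bergman space:
  functions vanish off the half-plane, so that integrals over the half-plane are integrals over
  the whole plane. The products \<open>a f\<close> to which the projection is applied live here.
\<close>

definition sq_integrable :: "(complex \<Rightarrow> complex) set" where
  "sq_integrable = {f. f \<in> borel_measurable borel \<and> (\<forall>z. z \<notin> upper_hp \<longrightarrow> f z = 0) \<and>
     (\<integral>\<^sup>+z. ennreal ((cmod (f z))\<^sup>2) \<partial>lborel) < \<infinity>}"

lemma open_upper_hp: "open upper_hp"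
  unfolding upper_hp_def by (rule open_halfspace_Im_gt)

lemma upper_hp_measurable [measurable]: "upper_hp \<in> sets borel"
  using open_upper_hp by simp

lemma convex_upper_hp: "convex upper_hp"
  unfolding upper_hp_def by (rule convex_halfspace_Im_gt)

lemma bergman_measurable:
  assumes "f \<in> bergman_space"
  shows "f \<in> borel_measurable borel"
proof -
  have "(\<lambda>z. indicator upper_hp z *\<^sub>R f z) \<in> borel_measurable borel"
    using assms by (intro borel_measurable_continuous_on_indicator)
      (auto simp: bergman_space_def holomorphic_on_imp_continuous_on)
  moreover have "(\<lambda>z. indicator upper_hp z *\<^sub>R f z) = f"
    using assms by (auto simp: bergman_space_def indicator_def)
  ultimately show ?thesis by simp
qed

lemma sq_integrable_measurable [measurable_dest]:
  "f \<in> sq_integrable \<Longrightarrow> f \<in> borel_measurable borel"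
  by (simp add: sq_integrable_def)

lemma sq_integrable_off: "f \<in> sq_integrable \<Longrightarrow> z \<notin> upper_hp \<Longrightarrow> f z = 0"
  by (simp add: sq_integrable_def)

lemma sq_integrable_square:
  assumes "f \<in> sq_integrable"
  shows "integrable lborel (\<lambda>z. (cmod (f z))\<^sup>2)"
  using assms sq_integrable_measurable[OF assms] by (simp add: sq_integrable_def integrable_iff_bounded)

lemma bergman_space_iff:
  "f \<in> bergman_space \<longleftrightarrow> f holomorphic_on upper_hp \<and> f \<in> sq_integrable"
proof -
  have eq: "(\<lambda>z. indicator upper_hp z *\<^sub>R (cmod (f z))\<^sup>2) = (\<lambda>z. (cmod (f z))\<^sup>2)"
    if "\<forall>z. z \<notin> upper_hp \<longrightarrow> f z = 0"
    using that by (auto simp: indicator_def fun_eq_iff)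
  have "f \<in> sq_integrable" if f: "f \<in> bergman_space"
  proof -
    have "integrable lborel (\<lambda>z. (cmod (f z))\<^sup>2)"
      using f eq by (simp add: bergman_space_def set_integrable_def)
    then show ?thesis
      using f bergman_measurable[OF f]
      by (simp add: sq_integrable_def bergman_space_def integrable_iff_bounded)
  qed
  moreover have "f \<in> bergman_space" if "f holomorphic_on upper_hp" "f \<in> sq_integrable"
    using that eq sq_integrable_square[OF that(2)] sq_integrable_off[OF that(2)]
    by (simp add: bergman_space_def set_integrable_def)
  ultimately show ?thesis by (auto simp: bergman_space_def)
qed

lemma bergman_sq_integrable: "f \<in> bergman_space \<Longrightarrow> f \<in> sq_integrable"
  by (simp add: bergman_space_iff)

lemma sq_integrableI:
  assumes "f \<in> borel_measurable borel" "\<And>z. z \<notin> upper_hp \<Longrightarrow> f z = 0"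
    "integrable lborel (\<lambda>z. (cmod (f z))\<^sup>2)"
  shows "f \<in> sq_integrable"
  using assms by (simp add: sq_integrable_def integrable_iff_bounded)

lemma cmod_mult_le_squares: "cmod a * cmod b \<le> ((cmod a)\<^sup>2 + (cmod b)\<^sup>2) / 2"
  using sum_squares_bound[of "cmod a" "cmod b"] by simp

lemma sq_integrable_product:
  assumes f: "f \<in> sq_integrable" and g: "g \<in> sq_integrable"
  shows "integrable lborel (\<lambda>z. f z * cnj (g z))"
proof (rule Bochner_Integration.integrable_bound)
  note [measurable] = sq_integrable_measurable[OF f] sq_integrable_measurable[OF g]
  show "integrable lborel (\<lambda>z. ((cmod (f z))\<^sup>2 + (cmod (g z))\<^sup>2) / 2)"
    using sq_integrable_square[OF f] sq_integrable_square[OF g] by simp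
  show "(\<lambda>z. f z * cnj (g z)) \<in> borel_measurable lborel"
    by measurable
  show "AE z in lborel. norm (f z * cnj (g z)) \<le> norm (((cmod (f z))\<^sup>2 + (cmod (g z))\<^sup>2) / 2)"
  proof (rule AE_I2)
    fix z
    show "norm (f z * cnj (g z)) \<le> norm (((cmod (f z))\<^sup>2 + (cmod (g z))\<^sup>2) / 2)"
      using cmod_mult_le_squares[of "f z" "g z"] by (simp add: norm_mult)
  qed
qed

lemma sq_integrable_add:
  assumes f: "f \<in> sq_integrable" and g: "g \<in> sq_integrable"
  shows "(\<lambda>z. f z + g z) \<in> sq_integrable"
proof (rule sq_integrableI)
  note [measurable] = sq_integrable_measurable[OF f] sq_integrable_measurable[OF g]
  show "(\<lambda>z. f z + g z) \<in> borel_measurable borel" by measurable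
  show "f z + g z = 0" if "z \<notin> upper_hp" for z
    using that f g by (simp add: sq_integrable_off)
  show "integrable lborel (\<lambda>z. (cmod (f z + g z))\<^sup>2)"
  proof (rule Bochner_Integration.integrable_bound)
    show "integrable lborel (\<lambda>z. 2 * (cmod (f z))\<^sup>2 + 2 * (cmod (g z))\<^sup>2)"
      using sq_integrable_square[OF f] sq_integrable_square[OF g] by simp
    have "(cmod (f z + g z))\<^sup>2 \<le> 2 * (cmod (f z))\<^sup>2 + 2 * (cmod (g z))\<^sup>2" for z
    proof -
      have "(cmod (f z + g z))\<^sup>2 \<le> (cmod (f z) + cmod (g z))\<^sup>2"
        by (intro power_mono norm_triangle_ineq) auto
      also have "\<dots> \<le> 2 * (cmod (f z))\<^sup>2 + 2 * (cmod (g z))\<^sup>2"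
        using sum_squares_bound[of "cmod (f z)" "cmod (g z)"] by (simp add: power2_sum)
      finally show ?thesis .
    qed
    then show "AE z in lborel. norm ((cmod (f z + g z))\<^sup>2)
        \<le> norm (2 * (cmod (f z))\<^sup>2 + 2 * (cmod (g z))\<^sup>2)" by simp
  qed measurable
qed

lemma sq_integrable_mult_bounded:
  assumes f: "f \<in> sq_integrable" and [measurable]: "a \<in> borel_measurable borel"
    and "\<And>z. cmod (a z) \<le> B"
  shows "(\<lambda>z. a z * f z) \<in> sq_integrable"
proof (rule sq_integrableI)
  note [measurable] = sq_integrable_measurable[OF f]
  show "(\<lambda>z. a z * f z) \<in> borel_measurable borel" by measurable
  show "a z * f z = 0" if "z \<notin> upper_hp" for z
    using that f by (simp add: sq_integrable_off)
  show "integrable lborel (\<lambda>z. (cmod (a z * f z))\<^sup>2)"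
  proof (rule Bochner_Integration.integrable_bound)
    show "integrable lborel (\<lambda>z. B\<^sup>2 * (cmod (f z))\<^sup>2)"
      using sq_integrable_square[OF f] by simp
    show "AE z in lborel. norm ((cmod (a z * f z))\<^sup>2) \<le> norm (B\<^sup>2 * (cmod (f z))\<^sup>2)"
      using assms(3) by (auto simp: norm_mult power_mult_distrib intro!: mult_right_mono power_mono)
  qed measurable
qed

lemma sq_integrable_scale: "f \<in> sq_integrable \<Longrightarrow> (\<lambda>z. c * f z) \<in> sq_integrable"
  by (rule sq_integrable_mult_bounded[where B = "cmod c"]) auto

lemma sq_integrable_diff:
  assumes "f \<in> sq_integrable" "g \<in> sq_integrable"
  shows "(\<lambda>z. f z - g z) \<in> sq_integrable"
  using sq_integrable_add[OF assms(1) sq_integrable_scale[OF assms(2), of "-1"]] by simp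

lemma bergman_add: "f \<in> bergman_space \<Longrightarrow> g \<in> bergman_space \<Longrightarrow> (\<lambda>z. f z + g z) \<in> bergman_space"
  by (auto simp: bergman_space_iff intro: sq_integrable_add holomorphic_intros)

lemma bergman_scale: "f \<in> bergman_space \<Longrightarrow> (\<lambda>z. c * f z) \<in> bergman_space"
  by (auto simp: bergman_space_iff intro: sq_integrable_scale holomorphic_intros)

lemma bergman_diff: "f \<in> bergman_space \<Longrightarrow> g \<in> bergman_space \<Longrightarrow> (\<lambda>z. f z - g z) \<in> bergman_space"
  by (auto simp: bergman_space_iff intro: sq_integrable_diff holomorphic_intros)

lemma bergman_zero: "(\<lambda>z. 0) \<in> bergman_space"
  by (auto simp: bergman_space_iff sq_integrable_def)

lemma bergman_sum:
  "finite A \<Longrightarrow> (\<And>k. k \<in> A \<Longrightarrow> f k \<in> bergman_space) \<Longrightarrow> (\<lambda>z. \<Sum>k\<in>A. f k z) \<in> bergman_space"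
  by (induction A rule: finite_induct) (auto intro: bergman_add bergman_zero)

lemma inner_L2_lborel:
  assumes "f \<in> sq_integrable"
  shows "inner_L2 f g = (\<integral>z. f z * cnj (g z) \<partial>lborel)"
  unfolding inner_L2_def set_lebesgue_integral_def
  using sq_integrable_off[OF assms]
  by (intro Bochner_Integration.integral_cong) (auto simp: indicator_def)

lemma inner_L2_add_left:
  assumes "f \<in> sq_integrable" "g \<in> sq_integrable" "h \<in> sq_integrable"
  shows "inner_L2 (\<lambda>z. f z + g z) h = inner_L2 f h + inner_L2 g h"
  using sq_integrable_product[OF assms(1,3)] sq_integrable_product[OF assms(2,3)]
  by (simp add: inner_L2_lborel sq_integrable_add assms distrib_right)

lemma inner_L2_diff_left:
  assumes "f \<in> sq_integrable" "g \<in> sq_integrable" "h \<in> sq_integrable"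
  shows "inner_L2 (\<lambda>z. f z - g z) h = inner_L2 f h - inner_L2 g h"
  using sq_integrable_product[OF assms(1,3)] sq_integrable_product[OF assms(2,3)]
  by (simp add: inner_L2_lborel sq_integrable_diff assms left_diff_distrib)

lemma inner_L2_scale_left:
  assumes "f \<in> sq_integrable"
  shows "inner_L2 (\<lambda>z. c * f z) h = c * inner_L2 f h"
  using assms by (simp add: inner_L2_lborel sq_integrable_scale mult.assoc)

lemma inner_L2_cnj: "inner_L2 f g = cnj (inner_L2 g f)"
  unfolding inner_L2_def set_lebesgue_integral_def
  by (simp add: mult.commute flip: Bochner_Integration.integral_cnj)

lemma inner_L2_add_right:
  assumes "f \<in> sq_integrable" "g \<in> sq_integrable" "h \<in> sq_integrable"
  shows "inner_L2 h (\<lambda>z. f z + g z) = inner_L2 h f + inner_L2 h g"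
  using inner_L2_add_left[OF assms] by (metis inner_L2_cnj complex_cnj_add)

lemma inner_L2_diff_right:
  assumes "f \<in> sq_integrable" "g \<in> sq_integrable" "h \<in> sq_integrable"
  shows "inner_L2 h (\<lambda>z. f z - g z) = inner_L2 h f - inner_L2 h g"
  using inner_L2_diff_left[OF assms] by (metis inner_L2_cnj complex_cnj_diff)

lemma inner_L2_scale_right:
  assumes "f \<in> sq_integrable"
  shows "inner_L2 h (\<lambda>z. c * f z) = cnj c * inner_L2 h f"
  using inner_L2_scale_left[OF assms] by (metis inner_L2_cnj complex_cnj_mult)

lemma inner_L2_zero_left [simp]: "inner_L2 (\<lambda>z. 0) g = 0"
  by (simp add: inner_L2_def set_lebesgue_integral_def)

lemma inner_L2_sum_left:
  assumes "finite A" "\<And>k. k \<in> A \<Longrightarrow> f k \<in> sq_integrable" "h \<in> sq_integrable"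
  shows "inner_L2 (\<lambda>z. \<Sum>k\<in>A. f k z) h = (\<Sum>k\<in>A. inner_L2 (f k) h)
    \<and> (\<lambda>z. \<Sum>k\<in>A. f k z) \<in> sq_integrable"
  using assms
  by (induction A rule: finite_induct)
    (auto simp: inner_L2_add_left sq_integrable_add bergman_zero bergman_sq_integrable)

lemma inner_L2_self: "inner_L2 f f = of_real ((norm_L2 f)\<^sup>2)"
proof -
  have "0 \<le> (\<integral>z. indicator upper_hp z *\<^sub>R (cmod (f z))\<^sup>2 \<partial>lborel)"
    by (intro integral_nonneg_AE) auto
  moreover have "inner_L2 f f = (\<integral>z. complex_of_real (indicator upper_hp z *\<^sub>R (cmod (f z))\<^sup>2) \<partial>lborel)"
    unfolding inner_L2_def set_lebesgue_integral_def
    by (intro Bochner_Integration.integral_cong)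
      (simp_all add: indicator_def complex_mult_cnj cmod_power2)
  ultimately show ?thesis
    by (simp only: integral_complex_of_real norm_L2_def set_lebesgue_integral_def real_sqrt_pow2)
qed

lemma norm_L2_nonneg: "0 \<le> norm_L2 f"
  unfolding norm_L2_def set_lebesgue_integral_def
  by (intro real_sqrt_ge_zero integral_nonneg_AE) auto

lemma integral_square_norm_L2:
  assumes "f \<in> sq_integrable"
  shows "(\<integral>z. (cmod (f z))\<^sup>2 \<partial>lborel) = (norm_L2 f)\<^sup>2"
proof -
  have "complex_of_real ((norm_L2 f)\<^sup>2) = (\<integral>z. complex_of_real ((cmod (f z))\<^sup>2) \<partial>lborel)"
    unfolding inner_L2_self[symmetric] inner_L2_lborel[OF assms]
    by (intro Bochner_Integration.integral_cong) (simp_all add: complex_mult_cnj cmod_power2)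
  then show ?thesis
    by (metis integral_complex_of_real of_real_eq_iff)
qed

lemma norm_L2_square:
  assumes "f \<in> sq_integrable"
  shows "(\<integral>\<^sup>+z. ennreal ((cmod (f z))\<^sup>2) \<partial>lborel) = ennreal ((norm_L2 f)\<^sup>2)"
  using assms by (simp add: nn_integral_eq_integral sq_integrable_square integral_square_norm_L2)

lemma cmod_inner_L2_le:
  assumes f: "f \<in> sq_integrable" and g: "g \<in> sq_integrable"
  shows "cmod (inner_L2 f g) \<le> norm_L2 f * norm_L2 g"
proof -
  note [measurable] = sq_integrable_measurable[OF f] sq_integrable_measurable[OF g]
  have "(ennreal (cmod (inner_L2 f g)))\<^sup>2
      \<le> (\<integral>\<^sup>+z. ennreal (cmod (f z)) * ennreal (cmod (g z)) \<partial>lborel)\<^sup>2"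
    using integral_norm_bound_ennreal[OF sq_integrable_product[OF f g]]
    by (intro power_mono) (auto simp: inner_L2_lborel f norm_mult ennreal_mult)
  also have "\<dots> \<le> (\<integral>\<^sup>+z. (ennreal (cmod (f z)))\<^sup>2 \<partial>lborel) * (\<integral>\<^sup>+z. (ennreal (cmod (g z)))\<^sup>2 \<partial>lborel)"
    by (rule Cauchy_Schwarz_nn_integral) auto
  also have "\<dots> = ennreal ((norm_L2 f * norm_L2 g)\<^sup>2)"
    by (simp add: ennreal_power norm_L2_square f g ennreal_mult power_mult_distrib)
  finally have "(cmod (inner_L2 f g))\<^sup>2 \<le> (norm_L2 f * norm_L2 g)\<^sup>2"
    by (simp add: ennreal_power)
  then show ?thesis
    by (rule power2_le_imp_le) (simp add: norm_L2_nonneg)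
qed

section \<open>Cauchy's formula on rectangles\<close>

lemma has_contour_integral_linepath_same_Im_iff:
  assumes "a < b"
  shows "(f has_contour_integral I) (linepath (Complex a c) (Complex b c)) \<longleftrightarrow>
    ((\<lambda>x. f (Complex x c)) has_integral I) {a..b}"
proof -
  have "(f has_contour_integral I) (linepath (Complex a c) (Complex b c)) \<longleftrightarrow>
      ((\<lambda>x. f (linepath (Complex a c) (Complex b c) x) * (Complex b c - Complex a c)) has_integral I) {0..1}"
    by (subst has_contour_integral_linepath) simp_all
  also have "\<dots> \<longleftrightarrow> ((\<lambda>x. f (Complex (a + (b - a) * x) c) * of_real (b - a)) has_integral I) {0..1}"
    by (intro has_integral_cong arg_cong2[of _ _ _ _ "(*)"] arg_cong[of _ _ f])
       (auto simp: linepath_def complex_eq_iff algebra_simps)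
  also have "{0..1} = (\<lambda>x. x / (b - a)) ` {0..b-a}"
    using assms by simp
  also have "((\<lambda>x. f (Complex (a + (b - a) * x) c) * of_real (b - a)) has_integral I) \<dots> \<longleftrightarrow>
      ((\<lambda>x. f (Complex (a + x) c) * of_real (b - a)) has_integral ((b-a) *\<^sub>R I)) {0..b-a}"
    by (subst has_integral_stretch_real_iff) (use assms in simp_all)
  also have "\<dots> \<longleftrightarrow> ((\<lambda>x. of_real (b - a) * f (Complex x c)) has_integral (b-a) *\<^sub>R I) {a..b}"
    by (subst has_integral_shift_real_ivl_iff[where c = "-a"])
       (simp_all add: scaleR_conv_of_real mult_ac)
  also have "\<dots> \<longleftrightarrow> ((\<lambda>x. f (Complex x c)) has_integral I) {a..b}"
    by (subst has_integral_mult_right_iff) (use assms in \<open>auto simp: scaleR_conv_of_real\<close>)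
  finally show ?thesis .
qed

lemma contour_integral_rectpath:
  assumes "a < b" "c < d" and f: "continuous_on (path_image (rectpath (Complex a c) (Complex b d))) f"
  shows "contour_integral (rectpath (Complex a c) (Complex b d)) f =
      integral {a..b} (\<lambda>x. f (Complex x c)) + \<i> * integral {c..d} (\<lambda>y. f (Complex b y))
      - integral {a..b} (\<lambda>x. f (Complex x d)) - \<i> * integral {c..d} (\<lambda>y. f (Complex a y))"
proof -
  have horiz: "contour_integral (linepath (Complex a e) (Complex b e)) f
      = integral {a..b} (\<lambda>x. f (Complex x e))"
    if "f contour_integrable_on linepath (Complex a e) (Complex b e)" for e
    using has_contour_integral_integral[OF that]
    unfolding has_contour_integral_linepath_same_Im_iff[OF assms(1)]
    by (simp add: integral_unique)
  have vert: "contour_integral (linepath (Complex e c) (Complex e d)) f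
      = \<i> * integral {c..d} (\<lambda>y. f (Complex e y))" for e
    by (rule contour_integral_linepath_same_Re) (use assms in auto)
  have img: "path_image (rectpath (Complex a c) (Complex b d)) =
      closed_segment (Complex a c) (Complex b c) \<union> (closed_segment (Complex b c) (Complex b d)
      \<union> (closed_segment (Complex b d) (Complex a d) \<union> closed_segment (Complex a d) (Complex a c)))"
    by (simp add: rectpath_def Let_def path_image_join)
  have int: "f contour_integrable_on linepath (Complex a c) (Complex b c)"
    "f contour_integrable_on linepath (Complex b c) (Complex b d)"
    "f contour_integrable_on linepath (Complex b d) (Complex a d)"
    "f contour_integrable_on linepath (Complex a d) (Complex a c)"
    "f contour_integrable_on linepath (Complex a d) (Complex b d)"
    by (intro contour_integrable_continuous_linepath continuous_on_subset[OF f];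
        auto simp: img closed_segment_commute)+
  have rev: "contour_integral (linepath (Complex b d) (Complex a d)) f
        = - contour_integral (linepath (Complex a d) (Complex b d)) f"
      "contour_integral (linepath (Complex a d) (Complex a c)) f
        = - contour_integral (linepath (Complex a c) (Complex a d)) f"
    by (intro contour_integral_reverse_linepath continuous_on_subset[OF f];
        auto simp: img closed_segment_commute)+
  show ?thesis
    using int
    by (simp add: rectpath_def Let_def valid_path_join rev vert horiz contour_integrable_join)
qed

lemma cmod_integral_le_nn_integral:
  fixes \<phi> :: "real \<Rightarrow> complex"
  assumes "continuous_on {a..b} \<phi>" "\<And>x. x \<in> {a..b} \<Longrightarrow> ennreal (cmod (\<phi> x)) \<le> \<psi> x"
  shows "ennreal (cmod (integral {a..b} \<phi>)) \<le> (\<integral>\<^sup>+x. \<psi> x \<partial>lborel)"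
proof -
  have i: "set_integrable lborel {a..b} \<phi>"
    by (rule borel_integrable_atLeastAtMost'[OF assms(1)])
  have "ennreal (cmod (integral {a..b} \<phi>))
      = ennreal (cmod (\<integral>x. indicator {a..b} x *\<^sub>R \<phi> x \<partial>lborel))"
    using set_borel_integral_eq_integral(2)[OF i] by (simp add: set_lebesgue_integral_def)
  also have "\<dots> \<le> (\<integral>\<^sup>+x. ennreal (cmod (indicator {a..b} x *\<^sub>R \<phi> x)) \<partial>lborel)"
    using i by (intro integral_norm_bound_ennreal) (simp add: set_integrable_def)
  also have "\<dots> \<le> (\<integral>\<^sup>+x. \<psi> x \<partial>lborel)"
    using assms(2) by (intro nn_integral_mono) (auto simp: indicator_def)
  finally show ?thesis .
qed

lemma rectangle_in_upper_hp:
  assumes "0 < c" "a \<le> b" "c \<le> d"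
  shows "path_image (rectpath (Complex a c) (Complex b d)) \<subseteq> upper_hp"
  using assms by (auto simp: path_image_rectpath upper_hp_def)

text \<open>
  A mean value inequality with a constant that is not sharp. Cauchy's formula on the boundary of
  a square of half-side \<open>s\<close> about \<open>z0\<close> bounds \<open>F z0\<close> by integrals of \<open>cmod F\<close> along the four sides.
  Averaging over \<open>s\<close> between \<open>Im z0 / 3\<close> and \<open>2 Im z0 / 3\<close> sweeps each side through the half-plane
  and turns each of the four line integrals into an area integral. Squares avoid the change to
  polar coordinates that circles would need.
\<close>

lemma holomorphic_mean_bound:
  assumes F: "F holomorphic_on upper_hp" and z0: "z0 \<in> upper_hp"
  shows "ennreal (cmod (F z0) * (Im z0)\<^sup>2)
    \<le> 6 * (\<integral>\<^sup>+z. indicator upper_hp z * ennreal (cmod (F z)) \<partial>lborel)" (is "_ \<le> 6 * ?I")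
proof -
  \<comment> \<open>Squares of half-side up to \<open>2 \<rho>\<close> about \<open>z0\<close> stay inside the half-plane.\<close>
  define \<rho> where "\<rho> = Im z0 / 3"
  have rho: "\<rho> > 0" using z0 by (simp add: \<rho>_def upper_hp_def)
  define \<Phi> where "\<Phi> z = indicator upper_hp z * ennreal (cmod (F z))" for z
  \<comment> \<open>Integrals along whole horizontal and vertical lines bound those along the sides.\<close>
  define g where "g y = (\<integral>\<^sup>+x. \<Phi> (Complex x y) \<partial>lborel)" for y
  define h where "h x = (\<integral>\<^sup>+y. \<Phi> (Complex x y) \<partial>lborel)" for x
  define x0 y0 where "x0 = Re z0" and "y0 = Im z0"
  have [measurable]: "\<Phi> \<in> borel_measurable borel"
  proof -
    have "(\<lambda>z. indicator upper_hp z *\<^sub>R F z) \<in> borel_measurable borel"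
      by (intro borel_measurable_continuous_on_indicator holomorphic_on_imp_continuous_on F)
        measurable
    then have "(\<lambda>z. ennreal (cmod (indicator upper_hp z *\<^sub>R F z))) \<in> borel_measurable borel"
      by measurable
    also have "(\<lambda>z. ennreal (cmod (indicator upper_hp z *\<^sub>R F z))) = \<Phi>"
      by (auto simp: \<Phi>_def indicator_def)
    finally show ?thesis .
  qed
  have [measurable]: "(\<lambda>p. \<Phi> (Complex (fst p) (snd p))) \<in> borel_measurable (lborel \<Otimes>\<^sub>M lborel)"
    using measurable_compose[OF measurable_Complex_pair \<open>\<Phi> \<in> borel_measurable borel\<close>]
    by (simp add: case_prod_unfold)
  have [measurable]: "(\<lambda>p. \<Phi> (Complex (snd p) (fst p))) \<in> borel_measurable (lborel \<Otimes>\<^sub>M lborel)"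
    using measurable_compose[OF measurable_pair_swap'
        \<open>(\<lambda>p. \<Phi> (Complex (fst p) (snd p))) \<in> borel_measurable (lborel \<Otimes>\<^sub>M lborel)\<close>]
    by (simp add: case_prod_unfold)
  have gm [measurable]: "g \<in> borel_measurable borel" and hm [measurable]: "h \<in> borel_measurable borel"
    unfolding g_def h_def
    using lborel.borel_measurable_nn_integral_fst[of "\<lambda>p. \<Phi> (Complex (snd p) (fst p))" lborel]
      lborel.borel_measurable_nn_integral_fst[of "\<lambda>p. \<Phi> (Complex (fst p) (snd p))" lborel]
    by simp_all
  have gI: "(\<integral>\<^sup>+y. g y \<partial>lborel) = ?I" and hI: "(\<integral>\<^sup>+x. h x \<partial>lborel) = ?I"
    unfolding g_def h_def by (simp_all add: nn_integral_complex[symmetric]) (simp_all add: \<Phi>_def)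
  have key: "ennreal (2 * pi * \<rho> * cmod (F z0)) \<le> g (y0 - s) + h (x0 + s) + g (y0 + s) + h (x0 - s)"
    if s: "s \<in> {\<rho>..2*\<rho>}" for s
  proof -
    let ?R = "rectpath (Complex (x0 - s) (y0 - s)) (Complex (x0 + s) (y0 + s))"
    let ?f = "\<lambda>w. F w / (w - z0)"
    have s': "0 < s" "\<rho> \<le> s" "s < y0" using s rho by (auto simp: \<rho>_def y0_def)
    have sub: "path_image ?R \<subseteq> upper_hp"
      by (rule rectangle_in_upper_hp) (use s' in auto)
    have avoid: "z0 \<notin> path_image ?R"
      using s' by (auto simp: path_image_rectpath x0_def y0_def)
    have con: "continuous_on (path_image ?R) ?f"
      using avoid by (intro continuous_intros holomorphic_on_imp_continuous_on
          holomorphic_on_subset[OF F sub]) auto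
    have "(?f has_contour_integral (2 * pi * \<i> * winding_number ?R z0 * F z0)) ?R"
      using z0 avoid sub open_upper_hp
      by (intro Cauchy_integral_formula_convex_simple[OF convex_upper_hp F])
        (auto simp: interior_open)
    moreover have "winding_number ?R z0 = 1"
      by (rule winding_number_rectpath) (use s' in \<open>auto simp: in_box_complex_iff x0_def y0_def\<close>)
    ultimately have "2 * pi * \<i> * F z0 = contour_integral ?R ?f"
      by (simp add: contour_integral_unique)
    also have "\<dots> = integral {x0 - s..x0 + s} (\<lambda>x. ?f (Complex x (y0 - s)))
        + \<i> * integral {y0 - s..y0 + s} (\<lambda>y. ?f (Complex (x0 + s) y))
        - integral {x0 - s..x0 + s} (\<lambda>x. ?f (Complex x (y0 + s)))
        - \<i> * integral {y0 - s..y0 + s} (\<lambda>y. ?f (Complex (x0 - s) y))"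
      (is "_ = ?A + \<i> * ?B - ?C - \<i> * ?D")
      by (rule contour_integral_rectpath) (use s' con in auto)
    finally have "2 * pi * cmod (F z0) = cmod (?A + \<i> * ?B - ?C - \<i> * ?D)"
      by (metis (no_types, lifting) norm_mult norm_ii mult.right_neutral norm_of_real abs_of_nonneg
          pi_ge_zero norm_numeral of_real_mult of_real_numeral)
    also have "\<dots> \<le> cmod ?A + cmod ?B + cmod ?C + cmod ?D"
      by (intro norm_triangle_le_diff norm_triangle_le add_mono) (auto simp: norm_mult)
    finally have "\<rho> * (2 * pi * cmod (F z0)) \<le> \<rho> * (cmod ?A + cmod ?B + cmod ?C + cmod ?D)"
      by (rule mult_left_mono) (use rho in simp)
    then have 1: "2 * pi * \<rho> * cmod (F z0) \<le> \<rho> * cmod ?A + \<rho> * cmod ?B + \<rho> * cmod ?C + \<rho> * cmod ?D"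
      by (simp only: distrib_left mult_ac)
    have conH: "continuous_on {x0 - s..x0 + s} (\<lambda>x. \<rho> * ?f (Complex x e))"
      if "e \<in> {y0 - s, y0 + s}" for e
      using that s'
      by (intro continuous_on_mult continuous_on_const continuous_on_compose2[OF con])
        (auto simp: Complex_eq path_image_rectpath intro!: continuous_intros)
    have conV: "continuous_on {y0 - s..y0 + s} (\<lambda>y. \<rho> * ?f (Complex e y))"
      if "e \<in> {x0 - s, x0 + s}" for e
      using that s'
      by (intro continuous_on_mult continuous_on_const continuous_on_compose2[OF con])
        (auto simp: Complex_eq path_image_rectpath intro!: continuous_intros)
    have pt: "ennreal (cmod (\<rho> * ?f w)) \<le> \<Phi> w" if "w \<in> path_image ?R" for w
    proof -
      have "\<rho> \<le> cmod (w - z0)"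
        using that s' abs_Re_le_cmod[of "w - z0"] abs_Im_le_cmod[of "w - z0"]
        by (auto simp: path_image_rectpath x0_def y0_def)
      then have "cmod (\<rho> * ?f w) \<le> cmod (F w)"
        using rho mult_right_mono[of \<rho> "cmod (w - z0)" "cmod (F w)"]
        by (auto simp: norm_mult norm_divide divide_simps mult.commute)
      then show ?thesis
        using that sub by (auto simp: \<Phi>_def indicator_def intro!: ennreal_leI)
    qed
    have bH: "ennreal (\<rho> * cmod (integral {x0 - s..x0 + s} (\<lambda>x. ?f (Complex x e)))) \<le> g e"
      if "e \<in> {y0 - s, y0 + s}" for e
    proof -
      have "ennreal (cmod (integral {x0 - s..x0 + s} (\<lambda>x. \<rho> * ?f (Complex x e)))) \<le> g e"
        unfolding g_def
        by (rule cmod_integral_le_nn_integral[OF conH[OF that]], rule pt)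
          (use that s' in \<open>auto simp: path_image_rectpath\<close>)
      then show ?thesis
        using rho by (simp only: integral_mult_right norm_mult norm_of_real abs_of_pos)
    qed
    have bV: "ennreal (\<rho> * cmod (integral {y0 - s..y0 + s} (\<lambda>y. ?f (Complex e y)))) \<le> h e"
      if "e \<in> {x0 - s, x0 + s}" for e
    proof -
      have "ennreal (cmod (integral {y0 - s..y0 + s} (\<lambda>y. \<rho> * ?f (Complex e y)))) \<le> h e"
        unfolding h_def
        by (rule cmod_integral_le_nn_integral[OF conV[OF that]], rule pt)
          (use that s' in \<open>auto simp: path_image_rectpath\<close>)
      then show ?thesis
        using rho by (simp only: integral_mult_right norm_mult norm_of_real abs_of_pos)
    qed
    have "ennreal (2 * pi * \<rho> * cmod (F z0))
        \<le> ennreal (\<rho> * cmod ?A) + ennreal (\<rho> * cmod ?B) + ennreal (\<rho> * cmod ?C) + ennreal (\<rho> * cmod ?D)"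
      using 1 rho by (simp add: ennreal_plus[symmetric] del: ennreal_plus)
    also have "\<dots> \<le> g (y0 - s) + h (x0 + s) + g (y0 + s) + h (x0 - s)"
      by (intro add_mono bH bV) auto
    finally show ?thesis .
  qed
  have "ennreal (2 * pi * \<rho> * cmod (F z0)) * ennreal \<rho>
      = (\<integral>\<^sup>+s. ennreal (2 * pi * \<rho> * cmod (F z0)) * indicator {\<rho>..2*\<rho>} s \<partial>lborel)"
    using rho by (simp add: nn_integral_cmult_indicator)
  also have "\<dots> \<le> (\<integral>\<^sup>+s. g (y0 + (-1) * s) + h (x0 + 1 * s) + g (y0 + 1 * s) + h (x0 + (-1) * s) \<partial>lborel)"
    using key by (intro nn_integral_mono) (auto simp: indicator_def)
  also have "\<dots> = (\<integral>\<^sup>+s. g (y0 + (-1) * s) \<partial>lborel) + (\<integral>\<^sup>+s. h (x0 + 1 * s) \<partial>lborel)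
      + (\<integral>\<^sup>+s. g (y0 + 1 * s) \<partial>lborel) + (\<integral>\<^sup>+s. h (x0 + (-1) * s) \<partial>lborel)"
    by (subst nn_integral_add; measurable)+
  also have "\<dots> = ?I + ?I + ?I + ?I"
    using nn_integral_real_affine[OF gm, of "-1" y0] nn_integral_real_affine[OF gm, of 1 y0]
      nn_integral_real_affine[OF hm, of "-1" x0] nn_integral_real_affine[OF hm, of 1 x0]
    by (simp add: gI hI)
  also have "\<dots> = 4 * ?I"
    by (simp only: numeral_Bit0 numeral_One distrib_right mult_1_left add.assoc)
  finally have "ennreal (2 * pi * \<rho>\<^sup>2 * cmod (F z0)) \<le> 4 * ?I"
    using rho by (simp add: ennreal_mult[symmetric] power2_eq_square mult_ac)
  moreover have "ennreal (2 * 3 * \<rho>\<^sup>2 * cmod (F z0)) \<le> ennreal (2 * pi * \<rho>\<^sup>2 * cmod (F z0))"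
    using pi_gt3 by (intro ennreal_leI mult_right_mono) auto
  ultimately have "ennreal (2 * 3 * \<rho>\<^sup>2 * cmod (F z0)) \<le> 4 * ?I"
    by (rule order.trans[rotated])
  then have "ennreal (3/2) * ennreal (2 * 3 * \<rho>\<^sup>2 * cmod (F z0)) \<le> ennreal (3/2) * (4 * ?I)"
    by (rule mult_left_mono) simp
  also have "ennreal (3/2) * (4 * ?I) = 6 * ?I"
  proof -
    have "ennreal (3/2) * ennreal 4 = ennreal 6"
      by (subst ennreal_mult[symmetric]) auto
    then have "ennreal (3/2) * 4 = 6" by simp
    then show ?thesis by (simp add: mult.assoc[symmetric])
  qed
  finally show ?thesis
    by (simp add: ennreal_mult'[symmetric] \<rho>_def power_divide mult.commute)
qed

text \<open>
  The mean value inequality is applied to the holomorphic function \<open>f\<^sup>2\<close>, whose absolute value has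
  the integral \<open>\<parallel>f\<parallel>\<^sup>2\<close>.
\<close>

lemma bergman_pointwise_bound:
  assumes f: "f \<in> bergman_space" and z: "z \<in> upper_hp"
  shows "cmod (f z) \<le> 3 * norm_L2 f / Im z"
proof -
  have y: "Im z > 0" using z by (simp add: upper_hp_def)
  have "ennreal (cmod ((f z)\<^sup>2) * (Im z)\<^sup>2)
      \<le> 6 * (\<integral>\<^sup>+z. indicator upper_hp z * ennreal (cmod ((f z)\<^sup>2)) \<partial>lborel)"
    using f by (intro holomorphic_mean_bound z) (auto simp: bergman_space_def intro!: holomorphic_intros)
  also have "(\<integral>\<^sup>+z. indicator upper_hp z * ennreal (cmod ((f z)\<^sup>2)) \<partial>lborel)
      \<le> (\<integral>\<^sup>+z. ennreal ((cmod (f z))\<^sup>2) \<partial>lborel)"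
    by (intro nn_integral_mono) (auto simp: indicator_def norm_power)
  also have "\<dots> = ennreal ((norm_L2 f)\<^sup>2)"
    by (rule norm_L2_square[OF bergman_sq_integrable[OF f]])
  finally have "ennreal ((cmod (f z) * Im z)\<^sup>2) \<le> ennreal (6 * (norm_L2 f)\<^sup>2)"
    by (simp add: norm_power power_mult_distrib ennreal_mult mult_left_mono)
  then have "(cmod (f z) * Im z)\<^sup>2 \<le> 6 * (norm_L2 f)\<^sup>2"
    by simp
  also have "\<dots> \<le> (3 * norm_L2 f)\<^sup>2"
    by (simp add: power_mult_distrib)
  finally have "cmod (f z) * Im z \<le> 3 * norm_L2 f"
    by (rule power2_le_imp_le) (simp add: norm_L2_nonneg)
  then show ?thesis using y by (simp add: field_simps)
qed

text \<open>
  Elements of the Bergman space are functions rather than classes modulo null sets. Definiteness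
  of the inner product holds because point evaluations are continuous.
\<close>

lemma bergman_eqI_norm_zero:
  assumes "f \<in> bergman_space" "inner_L2 f f = 0"
  shows "f = (\<lambda>z. 0)"
proof
  fix z
  have "norm_L2 f = 0"
    using assms(2) by (simp add: inner_L2_self)
  then show "f z = 0"
    using bergman_pointwise_bound[OF assms(1), of z] assms(1)
    by (cases "z \<in> upper_hp") (auto simp: bergman_space_def)
qed

section \<open>The reproducing kernel of the Bergman space\<close>

lemma cauchy_density:
  assumes c: "c > 0"
  shows "integrable lborel (\<lambda>x::real. 1 / ((x - u)\<^sup>2 + c\<^sup>2))"
    and "(\<integral>x. 1 / ((x - u)\<^sup>2 + c\<^sup>2) \<partial>lborel) = pi / c"
    and "(\<integral>\<^sup>+x. ennreal (1 / ((x - u)\<^sup>2 + c\<^sup>2)) \<partial>lborel) = ennreal (pi / c)"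
proof -
  define F where "F x = arctan ((x - u) / c) / c" for x
  have pos: "(x - u)\<^sup>2 + c\<^sup>2 > 0" for x
    using c by (intro add_nonneg_pos) auto
  have der: "DERIV F x :> 1 / ((x - u)\<^sup>2 + c\<^sup>2)" for x
  proof -
    have "DERIV F x :> (1 / c / (1 + ((x - u) / c)\<^sup>2)) / c"
      unfolding F_def by (rule derivative_eq_intros refl | use c in \<open>simp add: divide_simps\<close>)+
    also have "(1 / c / (1 + ((x - u) / c)\<^sup>2)) / c = 1 / ((x - u)\<^sup>2 + c\<^sup>2)"
      using c pos[of x] by (simp add: power_divide divide_simps) (simp add: power2_eq_square algebra_simps)
    finally show ?thesis .
  qed
  have top: "(F \<longlongrightarrow> pi / 2 / c) at_top"
  proof -
    have "filterlim (\<lambda>x. (x - u) / c) at_top at_top"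
      unfolding filterlim_at_top eventually_at_top_linorder
    proof (intro allI exI impI)
      fix Z x :: real assume "Z * c + u \<le> x"
      then show "Z \<le> (x - u) / c" using c by (simp add: field_simps)
    qed
    then show ?thesis unfolding F_def
      by (intro tendsto_divide tendsto_const filterlim_compose[OF tendsto_arctan_at_top]) (use c in auto)
  qed
  have bot: "(F \<longlongrightarrow> - (pi / 2) / c) at_bot"
  proof -
    have "filterlim (\<lambda>x. (x - u) / c) at_bot at_bot"
      unfolding filterlim_at_bot eventually_at_bot_linorder
    proof (intro allI exI impI)
      fix Z x :: real assume "x \<le> Z * c + u"
      then show "(x - u) / c \<le> Z" using c by (simp add: field_simps)
    qed
    then show ?thesis unfolding F_def
      by (intro tendsto_divide tendsto_const filterlim_compose[OF tendsto_arctan_at_bot]) (use c in auto)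
  qed
  have cont: "isCont (\<lambda>x. 1 / ((x - u)\<^sup>2 + c\<^sup>2)) x" for x
    using pos[of x] by (intro continuous_intros) auto
  have *: "set_integrable lborel (einterval (-\<infinity>) \<infinity>) (\<lambda>x. 1 / ((x - u)\<^sup>2 + c\<^sup>2))"
    "(LBINT x=-\<infinity>..\<infinity>. 1 / ((x - u)\<^sup>2 + c\<^sup>2)) = pi / 2 / c - (- (pi / 2) / c)"
    by (rule interval_integral_FTC_nonneg[where F = F];
        use der cont pos top bot in \<open>auto simp: ereal_tendsto_simps intro!: AE_I2 less_imp_le\<close>)+
  show i: "integrable lborel (\<lambda>x::real. 1 / ((x - u)\<^sup>2 + c\<^sup>2))"
    using *(1) by (simp add: set_integrable_def)
  show v: "(\<integral>x. 1 / ((x - u)\<^sup>2 + c\<^sup>2) \<partial>lborel) = pi / c"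
    using *(2) by (simp add: interval_lebesgue_integral_def set_lebesgue_integral_def)
  show "(\<integral>\<^sup>+x. ennreal (1 / ((x - u)\<^sup>2 + c\<^sup>2)) \<partial>lborel) = ennreal (pi / c)"
    using nn_integral_eq_integral[OF i] pos by (simp add: v less_imp_le)
qed

definition bergman_kernel :: "complex \<Rightarrow> complex \<Rightarrow> complex" where
  "bergman_kernel w z = (if z \<in> upper_hp then - 1 / (of_real pi * (z - cnj w)\<^sup>2) else 0)"

lemma upper_hp_diff_cnj_nonzero:
  assumes "z \<in> upper_hp" "w \<in> upper_hp"
  shows "z - cnj w \<noteq> 0"
proof
  assume "z - cnj w = 0"
  then have "Im z = - Im w" by (simp add: complex_eq_iff)
  then show False using assms by (simp add: upper_hp_def)
qed

lemma bergman_kernel_cnj: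
  assumes "z \<in> upper_hp" "w \<in> upper_hp"
  shows "cnj (bergman_kernel w z) = bergman_kernel z w"
proof -
  have "(cnj z - w)\<^sup>2 = (w - cnj z)\<^sup>2" by (rule power2_commute)
  then show ?thesis using assms by (simp add: bergman_kernel_def)
qed

lemma cmod_Complex_diff_square:
  "(cmod (Complex x y - a))\<^sup>2 = (x - Re a)\<^sup>2 + (y - Im a)\<^sup>2"
  by (simp add: cmod_power2)

lemma bergman_kernel_measurable2 [measurable]:
  "(\<lambda>p. bergman_kernel (snd p) (fst p)) \<in> borel_measurable (borel \<Otimes>\<^sub>M borel)"
proof -
  have "(\<lambda>p. - 1 / (of_real pi * (fst p - cnj (snd p))\<^sup>2) :: complex) \<in> borel_measurable (borel \<Otimes>\<^sub>M borel)"
    by measurable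
  moreover have "Measurable.pred (borel \<Otimes>\<^sub>M borel) (\<lambda>p::complex \<times> complex. fst p \<in> upper_hp)"
    by measurable
  ultimately show ?thesis unfolding bergman_kernel_def by (intro measurable_If) auto
qed

lemma bergman_kernel_measurable [measurable]:
  "bergman_kernel w \<in> borel_measurable borel"
  using measurable_compose[OF _ bergman_kernel_measurable2, of "\<lambda>z. (z, w)" borel] by simp

text \<open>
  The squared modulus of the kernel is dominated by \<open>1 / ((y\<^sup>2 + v\<^sup>2) ((x - u)\<^sup>2 + v\<^sup>2))\<close> for \<open>w = u + i v\<close>, a
  product of two functions of one variable with finite integrals.
\<close>

lemma bergman_kernel_in_bergman_space:
  assumes w: "w \<in> upper_hp"
  shows "bergman_kernel w \<in> bergman_space"
proof -
  define v where "v = Im w"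
  have v: "v > 0" using w by (simp add: upper_hp_def v_def)
  have "(\<lambda>z. - 1 / (of_real pi * (z - cnj w)\<^sup>2)) holomorphic_on upper_hp"
    using upper_hp_diff_cnj_nonzero[OF _ w] by (intro holomorphic_intros) auto
  then have hol: "bergman_kernel w holomorphic_on upper_hp"
    by (rule holomorphic_transform) (simp add: bergman_kernel_def)
  have le: "(cmod (bergman_kernel w (Complex x y)))\<^sup>2
      \<le> 1 / (y\<^sup>2 + v\<^sup>2) * (1 / ((x - Re w)\<^sup>2 + v\<^sup>2))" for x y
  proof (cases "y > 0")
    case True
    have sq: "(cmod (Complex x y - cnj w))\<^sup>2 = (x - Re w)\<^sup>2 + (y + v)\<^sup>2"
      by (simp add: cmod_Complex_diff_square v_def)
    have p: "0 < y\<^sup>2 + v\<^sup>2" "0 < (x - Re w)\<^sup>2 + v\<^sup>2"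
      using v by (auto intro!: add_nonneg_pos)
    have yv: "y\<^sup>2 + v\<^sup>2 \<le> (y + v)\<^sup>2" "v\<^sup>2 \<le> (y + v)\<^sup>2"
      using True v by (auto simp: power2_sum intro!: power_mono)
    have "(y\<^sup>2 + v\<^sup>2) * ((x - Re w)\<^sup>2 + v\<^sup>2) \<le> 1 * (((x - Re w)\<^sup>2 + (y + v)\<^sup>2) * ((x - Re w)\<^sup>2 + (y + v)\<^sup>2))"
      using yv p unfolding mult_1_left
      by (intro mult_mono) (auto intro: order.trans[OF yv(1)])
    also have "\<dots> \<le> pi\<^sup>2 * (((x - Re w)\<^sup>2 + (y + v)\<^sup>2) * ((x - Re w)\<^sup>2 + (y + v)\<^sup>2))"
      using pi_ge_two by (intro mult_right_mono one_le_power) auto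
    finally have *: "(y\<^sup>2 + v\<^sup>2) * ((x - Re w)\<^sup>2 + v\<^sup>2)
        \<le> pi\<^sup>2 * (((x - Re w)\<^sup>2 + (y + v)\<^sup>2) * ((x - Re w)\<^sup>2 + (y + v)\<^sup>2))" .
    have "(cmod (bergman_kernel w (Complex x y)))\<^sup>2
        = 1 / (pi\<^sup>2 * (((x - Re w)\<^sup>2 + (y + v)\<^sup>2) * ((x - Re w)\<^sup>2 + (y + v)\<^sup>2)))"
      using True unfolding sq[symmetric]
      by (simp add: bergman_kernel_def upper_hp_def norm_divide norm_mult norm_power
          power_mult_distrib power_divide power2_eq_square mult_ac)
    also have "\<dots> \<le> 1 / ((y\<^sup>2 + v\<^sup>2) * ((x - Re w)\<^sup>2 + v\<^sup>2))"
      by (rule divide_left_mono[OF *]) (use p * in \<open>auto intro!: mult_pos_pos order.strict_trans2[OF _ *]\<close>)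
    finally show ?thesis by simp
  next
    case False
    then show ?thesis by (simp add: bergman_kernel_def upper_hp_def)
  qed
  have "(\<integral>\<^sup>+z. ennreal ((cmod (bergman_kernel w z))\<^sup>2) \<partial>lborel)
      = (\<integral>\<^sup>+y. \<integral>\<^sup>+x. ennreal ((cmod (bergman_kernel w (Complex x y)))\<^sup>2) \<partial>lborel \<partial>lborel)"
    by (rule nn_integral_complex) measurable
  also have "\<dots> \<le> (\<integral>\<^sup>+y. \<integral>\<^sup>+x. ennreal (1 / (y\<^sup>2 + v\<^sup>2)) * ennreal (1 / ((x - Re w)\<^sup>2 + v\<^sup>2)) \<partial>lborel \<partial>lborel)"
    using le by (intro nn_integral_mono) (simp add: ennreal_mult[symmetric])
  also have "\<dots> = (\<integral>\<^sup>+y. ennreal (1 / ((y - 0)\<^sup>2 + v\<^sup>2)) * ennreal (pi / v) \<partial>lborel)"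
    by (simp add: nn_integral_cmult cauchy_density[OF v])
  also have "\<dots> = ennreal (pi / v) * ennreal (pi / v)"
    by (subst nn_integral_multc) (simp_all only: cauchy_density[OF v], measurable)
  also have "\<dots> < \<infinity>"
    by (simp add: ennreal_mult_less_top)
  finally show ?thesis
    using hol by (simp add: bergman_space_iff sq_integrable_def) (simp add: bergman_kernel_def)
qed

text \<open>
  Cauchy's formula for the derivative, with the contour pushed to infinity. On the three far sides
  of the rectangle \<open>[-R, R] \<times> [y, y + R]\<close> the integrand is of size \<open>B / R\<^sup>2\<close>, and the sides have total
  length \<open>4 R\<close>, so only the bottom line remains in the limit.
\<close>

lemma cauchy_line_integral:
  assumes F: "F holomorphic_on upper_hp" and y: "0 < y" and a: "y < Im a"
    and B: "\<And>z. y \<le> Im z \<Longrightarrow> cmod (F z) \<le> B"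
  shows "(\<integral>x. F (Complex x y) / (Complex x y - a)\<^sup>2 \<partial>lborel) = 2 * of_real pi * \<i> * deriv F a"
proof -
  define f where "f z = F z / (z - a)\<^sup>2" for z
  have B0: "B \<ge> 0" using B[of a] a norm_ge_zero[of "F a"] by linarith
  have aU: "a \<in> upper_hp" using y a by (simp add: upper_hp_def)
  have c: "Im a - y > 0" using a by simp
  have off_line: "Complex x y \<noteq> a" for x using a by auto
  have cont_line: "continuous_on S (\<lambda>x. f (Complex x y))" for S
  proof -
    have "continuous_on (upper_hp - {a}) f"
      unfolding f_def
      by (intro continuous_intros holomorphic_on_imp_continuous_on holomorphic_on_subset[OF F]) auto
    moreover have "continuous_on S (\<lambda>x. Complex x y)"
      by (auto simp: Complex_eq intro!: continuous_intros)
    ultimately show ?thesis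
      by (rule continuous_on_compose2) (use y off_line in \<open>auto simp: upper_hp_def\<close>)
  qed
  have bnd: "cmod (f (Complex x y)) \<le> B * (1 / ((x - Re a)\<^sup>2 + (Im a - y)\<^sup>2))" for x
  proof -
    have "cmod (f (Complex x y)) = cmod (F (Complex x y)) / ((x - Re a)\<^sup>2 + (Im a - y)\<^sup>2)"
      by (simp add: f_def norm_divide norm_power cmod_Complex_diff_square power2_commute[of y])
    also have "\<dots> \<le> B / ((x - Re a)\<^sup>2 + (Im a - y)\<^sup>2)"
      using B by (intro divide_right_mono) auto
    finally show ?thesis by simp
  qed
  have int: "integrable lborel (\<lambda>x. f (Complex x y))"
  proof (rule Bochner_Integration.integrable_bound)
    show "integrable lborel (\<lambda>x. B * (1 / ((x - Re a)\<^sup>2 + (Im a - y)\<^sup>2)))"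
      by (intro integrable_mult_right cauchy_density c)
    show "(\<lambda>x. f (Complex x y)) \<in> borel_measurable lborel"
      using borel_measurable_continuous_onI[OF cont_line] by simp
    show "AE x in lborel. norm (f (Complex x y)) \<le> norm (B * (1 / ((x - Re a)\<^sup>2 + (Im a - y)\<^sup>2)))"
      using bnd B0 by (auto intro!: AE_I2 order.trans[OF bnd])
  qed
  \<comment> \<open>For \<open>R > R0\<close> the pole \<open>a\<close> lies inside the rectangle; \<open>R > 2 R0\<close> gives \<open>R - cmod a \<ge> R / 2\<close>.\<close>
  define R0 where "R0 = cmod a + 1 + Im a"
  have R0: "R0 \<ge> 1" using a y by (simp add: R0_def)
  have rect: "cmod (integral {-R..R} (\<lambda>x. f (Complex x y)) - 2 * of_real pi * \<i> * deriv F a)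
      \<le> 4 * R * (B / (R - cmod a)\<^sup>2)" if R: "R > R0" for R
  proof -
    let ?R = "rectpath (Complex (-R) y) (Complex R (y + R))"
    have Rp: "R > 0" "R > cmod a" "R > Im a" using R R0 norm_ge_zero[of a] a y unfolding R0_def by linarith+
    have RR: "\<bar>Re a\<bar> < R" using abs_Re_le_cmod[of a] Rp by linarith
    have sub: "path_image ?R \<subseteq> upper_hp"
      by (rule rectangle_in_upper_hp) (use Rp y in auto)
    have avoid: "a \<notin> path_image ?R"
      using Rp RR a y by (auto simp: path_image_rectpath)
    have con: "continuous_on (path_image ?R) f"
      unfolding f_def using avoid by (intro continuous_intros holomorphic_on_imp_continuous_on
          holomorphic_on_subset[OF F sub]) auto
    have wn: "winding_number ?R a = 1"
      by (rule winding_number_rectpath) (use Rp RR a y in \<open>auto simp: in_box_complex_iff\<close>)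
    have "contour_integral ?R f = 2 * pi * \<i> * (\<Sum>p\<in>{a}. winding_number ?R p * residue f p)"
    proof (rule Residue_theorem[of upper_hp])
      show "f holomorphic_on upper_hp - {a}"
        unfolding f_def by (intro holomorphic_intros holomorphic_on_subset[OF F]) auto
      show "\<forall>z. z \<notin> upper_hp \<longrightarrow> winding_number ?R z = 0"
      proof (intro allI impI)
        fix z assume "z \<notin> upper_hp"
        then show "winding_number ?R z = 0"
          using Rp y by (intro winding_number_rectpath_outside) (auto simp: upper_hp_def in_cbox_complex_iff)
      qed
    qed (use sub avoid open_upper_hp convex_upper_hp in \<open>auto simp: convex_connected\<close>)
    moreover have "residue f a = deriv F a"
      using residue_holomorphic_over_power[OF open_upper_hp aU F, of 1]
      by (simp add: f_def[abs_def] power2_eq_square)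
    ultimately have res: "contour_integral ?R f = 2 * of_real pi * \<i> * deriv F a"
      by (simp add: wn)
    have pt: "cmod (f w) \<le> B / (R - cmod a)\<^sup>2"
      if w: "w \<in> path_image ?R" "Im w \<noteq> y \<or> \<bar>Re w\<bar> = R" for w
    proof -
      have "R \<le> cmod w"
        using w Rp y abs_Re_le_cmod[of w] abs_Im_le_cmod[of w] by (auto simp: path_image_rectpath)
      then have "R - cmod a \<le> cmod (w - a)"
        using norm_triangle_ineq2[of w a] by linarith
      then have "(R - cmod a)\<^sup>2 \<le> (cmod (w - a))\<^sup>2"
        using Rp by (intro power_mono) auto
      moreover have "y \<le> Im w"
        using w Rp by (auto simp: path_image_rectpath)
      ultimately show ?thesis
        using Rp B[of w] B0 unfolding f_def norm_divide norm_power
        by (intro frac_le) auto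
    qed
    have K: "0 \<le> B / (R - cmod a)\<^sup>2" using B0 by simp
    have conH: "continuous_on {-R..R} (\<lambda>x. f (Complex x (y + R)))"
      and conV: "continuous_on {y..y + R} (\<lambda>t. f (Complex R t))"
         "continuous_on {y..y + R} (\<lambda>t. f (Complex (-R) t))"
      using Rp by (intro continuous_on_compose2[OF con];
          auto simp: Complex_eq path_image_rectpath intro!: continuous_intros)+
    have bH: "cmod (integral {-R..R} (\<lambda>x. f (Complex x (y + R)))) \<le> B / (R - cmod a)\<^sup>2 * (R - (-R))"
      using Rp by (intro integral_bound conH pt) (auto simp: path_image_rectpath)
    have bV: "cmod (integral {y..y + R} (\<lambda>t. f (Complex R t))) \<le> B / (R - cmod a)\<^sup>2 * (y + R - y)"
        "cmod (integral {y..y + R} (\<lambda>t. f (Complex (-R) t))) \<le> B / (R - cmod a)\<^sup>2 * (y + R - y)"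
      using Rp by (intro integral_bound conV pt; auto simp: path_image_rectpath)+
    have "2 * of_real pi * \<i> * deriv F a
        = integral {-R..R} (\<lambda>x. f (Complex x y)) + \<i> * integral {y..y+R} (\<lambda>t. f (Complex R t))
          - integral {-R..R} (\<lambda>x. f (Complex x (y + R))) - \<i> * integral {y..y+R} (\<lambda>t. f (Complex (-R) t))"
      unfolding res[symmetric] by (rule contour_integral_rectpath) (use Rp con in auto)
    then have "integral {-R..R} (\<lambda>x. f (Complex x y)) - 2 * of_real pi * \<i> * deriv F a
        = integral {-R..R} (\<lambda>x. f (Complex x (y + R))) + \<i> * integral {y..y+R} (\<lambda>t. f (Complex (-R) t))
          - \<i> * integral {y..y+R} (\<lambda>t. f (Complex R t))"
      by simp
    also have "cmod \<dots> \<le> cmod (integral {-R..R} (\<lambda>x. f (Complex x (y + R))))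
        + cmod (integral {y..y+R} (\<lambda>t. f (Complex (-R) t))) + cmod (integral {y..y+R} (\<lambda>t. f (Complex R t)))"
      by (intro norm_triangle_le_diff norm_triangle_le add_mono) (auto simp: norm_mult)
    also have "\<dots> \<le> 4 * R * (B / (R - cmod a)\<^sup>2)"
    proof -
      have "4 * R * q = q * (R - (-R)) + q * (y + R - y) + q * (y + R - y)" for q :: real
        by (simp add: algebra_simps)
      then show ?thesis using bH bV by (metis add_mono)
    qed
    finally show ?thesis .
  qed
  have set_int: "integral {-R..R} (\<lambda>x. f (Complex x y)) = (\<integral>x. indicator {-R..R} x *\<^sub>R f (Complex x y) \<partial>lborel)" for R
    using set_borel_integral_eq_integral(2)[OF borel_integrable_atLeastAtMost'[OF cont_line, of "-R" R]]
    by (simp add: set_lebesgue_integral_def)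
  have lim1: "((\<lambda>R. integral {-R..R} (\<lambda>x. f (Complex x y))) \<longlongrightarrow> (\<integral>x. f (Complex x y) \<partial>lborel)) at_top"
    unfolding set_int
  proof (rule integral_dominated_convergence_at_top[where w = "\<lambda>x. norm (f (Complex x y))"])
    show "AE x in lborel. ((\<lambda>R. indicator {-R..R} x *\<^sub>R f (Complex x y)) \<longlongrightarrow> f (Complex x y)) at_top"
    proof (rule AE_I2)
      fix x :: real
      have "eventually (\<lambda>R. indicator {-R..R} x *\<^sub>R f (Complex x y) = f (Complex x y)) at_top"
        using eventually_ge_at_top[of "\<bar>x\<bar>"] by eventually_elim (auto simp: indicator_def)
      then show "((\<lambda>R. indicator {-R..R} x *\<^sub>R f (Complex x y)) \<longlongrightarrow> f (Complex x y)) at_top"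
        by (rule tendsto_eventually)
    qed
  qed (use int in \<open>auto simp: indicator_def intro!: always_eventually AE_I2\<close>)
  have lim2: "((\<lambda>R. integral {-R..R} (\<lambda>x. f (Complex x y))) \<longlongrightarrow> 2 * of_real pi * \<i> * deriv F a) at_top"
  proof (rule LIM_zero_cancel, rule Lim_null_comparison)
    show "eventually (\<lambda>R. cmod (integral {-R..R} (\<lambda>x. f (Complex x y)) - 2 * of_real pi * \<i> * deriv F a)
        \<le> 16 * B / R) at_top"
      using eventually_gt_at_top[of "2 * R0"]
    proof eventually_elim
      case (elim R)
      have Ra: "R / 2 \<le> R - cmod a" "R > R0" "R > 0"
      proof -
        have "2 * (cmod a + 1 + Im a) < R" "0 < Im a" "0 \<le> cmod a"
          using elim a y by (simp_all add: R0_def)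
        then show "R / 2 \<le> R - cmod a" "R > R0" "R > 0"
          unfolding R0_def by argo+
      qed
      from Ra have "(R / 2)\<^sup>2 \<le> (R - cmod a)\<^sup>2"
        by (intro power_mono) auto
      then have "B / (R - cmod a)\<^sup>2 \<le> B / (R / 2)\<^sup>2"
        using Ra B0 by (intro divide_left_mono) (auto intro!: mult_pos_pos)
      then have "4 * R * (B / (R - cmod a)\<^sup>2) \<le> 4 * R * (B / (R / 2)\<^sup>2)"
        using Ra by (intro mult_left_mono) auto
      also have "\<dots> = 16 * B / R"
        using Ra by (simp add: power2_eq_square field_simps)
      finally show ?case using rect[OF Ra(2)] by linarith
    qed
    show "((\<lambda>R. 16 * B / R) \<longlongrightarrow> 0) at_top"
      by (rule tendsto_divide_0[OF tendsto_const filterlim_mono[OF filterlim_ident at_top_le_at_infinity order_refl]])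
  qed
  show ?thesis
    using tendsto_unique[OF _ lim1 lim2] by (simp add: f_def)
qed

text \<open>
  On the line \<open>Im z = y\<close> one has \<open>cnj z = z - 2 i y\<close>, so the conjugate kernel is there the
  holomorphic function \<open>-1 / (\<pi> (z - (w + 2 i y))\<^sup>2)\<close>. Cauchy's formula evaluates the integral along
  the line to \<open>-2 i f'(w + 2 i y)\<close>, the derivative of \<open>y \<mapsto> - f(w + 2 i y)\<close>. Integrating over \<open>y > 0\<close>
  leaves the boundary value \<open>f w\<close>, because \<open>f\<close> tends to zero along vertical rays.
\<close>

theorem bergman_reproducing:
  assumes f: "f \<in> bergman_space" and w: "w \<in> upper_hp"
  shows "inner_L2 f (bergman_kernel w) = f w"
proof -
  have hol: "f holomorphic_on upper_hp" using f by (simp add: bergman_space_def)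
  have k: "bergman_kernel w \<in> bergman_space" by (rule bergman_kernel_in_bergman_space[OF w])
  have v: "Im w > 0" using w by (simp add: upper_hp_def)
  define p where "p y = w + 2 * of_real y * \<i>" for y :: real
  have pU: "p y \<in> upper_hp" if "y \<ge> 0" for y
    using that v by (simp add: p_def upper_hp_def)
  have int: "integrable lborel (\<lambda>z. f z * cnj (bergman_kernel w z))"
    by (intro sq_integrable_product bergman_sq_integrable f k)
  have line: "(\<integral>x. f (Complex x y) * cnj (bergman_kernel w (Complex x y)) \<partial>lborel)
      = indicator {0<..} y *\<^sub>R (- 2 * \<i> * deriv f (p y))" for y
  proof (cases "y > 0")
    case True
    have "f (Complex x y) * cnj (bergman_kernel w (Complex x y))
        = (- 1 / of_real pi) * (f (Complex x y) / (Complex x y - p y)\<^sup>2)" for x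
    proof -
      have "cnj (Complex x y - cnj w) = Complex x y - p y"
        by (simp add: complex_eq_iff p_def)
      then have "cnj ((Complex x y - cnj w)\<^sup>2) = (Complex x y - p y)\<^sup>2"
        by (simp only: complex_cnj_power)
      then show ?thesis
        using True by (simp add: bergman_kernel_def upper_hp_def)
    qed
    moreover have "(\<integral>x. f (Complex x y) / (Complex x y - p y)\<^sup>2 \<partial>lborel) = 2 * of_real pi * \<i> * deriv f (p y)"
    proof (rule cauchy_line_integral[OF hol True])
      show "y < Im (p y)" using True v by (simp add: p_def)
      fix z assume z: "y \<le> Im z"
      then have "cmod (f z) \<le> 3 * norm_L2 f / Im z"
        using True by (intro bergman_pointwise_bound[OF f]) (simp add: upper_hp_def)
      also have "\<dots> \<le> 3 * norm_L2 f / y"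
        using z True norm_L2_nonneg[of f] by (intro divide_left_mono) auto
      finally show "cmod (f z) \<le> 3 * norm_L2 f / y" .
    qed
    ultimately show ?thesis using True by (simp only: Bochner_Integration.integral_mult_right_zero) simp
  next
    case False
    then show ?thesis by (simp add: bergman_kernel_def upper_hp_def)
  qed
  have "inner_L2 f (bergman_kernel w) = (\<integral>z. f z * cnj (bergman_kernel w z) \<partial>lborel)"
    by (rule inner_L2_lborel[OF bergman_sq_integrable[OF f]])
  also have "\<dots> = (\<integral>y. indicator {0<..} y *\<^sub>R (- 2 * \<i> * deriv f (p y)) \<partial>lborel)"
    using integral_complex(2)[OF int] by (simp add: line)
  also have "\<dots> = (LBINT y=0..\<infinity>. - 2 * \<i> * deriv f (p y))"
    by (simp add: interval_lebesgue_integral_def set_lebesgue_integral_def zero_ereal_def)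
  also have "\<dots> = 0 - (- f w)"
  proof (rule interval_integral_FTC_integrable[where F = "\<lambda>y. - f (p y)"])
    show "((\<lambda>y. - f (p y)) has_vector_derivative - 2 * \<i> * deriv f (p y)) (at y)"
      if "0 < ereal y" for y
    proof -
      have fd: "(f has_field_derivative deriv f (p y)) (at (p y))"
        using that hol open_upper_hp pU[of y] by (intro holomorphic_derivI) (auto simp: zero_ereal_def)
      have "(p has_vector_derivative 2 * \<i>) (at y)"
        unfolding p_def by (auto intro!: derivative_eq_intros simp: has_vector_derivative_def scaleR_conv_of_real)
      from field_vector_diff_chain_at[OF this fd]
      show ?thesis by (auto simp: o_def mult.commute intro!: has_vector_derivative_minus[THEN has_vector_derivative_eq_rhs])
    qed
    have cd: "continuous_on upper_hp (deriv f)"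
      using hol open_upper_hp by (intro holomorphic_on_imp_continuous_on holomorphic_deriv)
    have cp: "continuous_on {0..} p"
      unfolding p_def by (intro continuous_intros)
    have "continuous_on {0<..} (\<lambda>y. - 2 * \<i> * deriv f (p y))"
      by (intro continuous_intros continuous_on_compose2[OF cd] continuous_on_subset[OF cp]) (auto intro: pU)
    then show "isCont (\<lambda>y. - 2 * \<i> * deriv f (p y)) y" if "0 < ereal y" for y
      using that by (auto simp: continuous_on_eq_continuous_at zero_ereal_def)
    show "set_integrable lborel (einterval 0 \<infinity>) (\<lambda>y. - 2 * \<i> * deriv f (p y))"
      using integral_complex(1)[OF int] by (simp add: line set_integrable_def zero_ereal_def)
    have "continuous_on {0..} (\<lambda>y. - f (p y))"
      by (intro continuous_intros continuous_on_compose2[OF holomorphic_on_imp_continuous_on[OF hol]] cp)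
        (auto intro: pU)
    then have "((\<lambda>y. - f (p y)) \<longlongrightarrow> - f (p 0)) (at 0 within {0..})"
      by (simp add: continuous_on_def)
    then have "((\<lambda>y. - f (p y)) \<longlongrightarrow> - f w) (at_right 0)"
      by (rule tendsto_mono[rotated, THEN tendsto_eq_rhs]) (auto simp: p_def intro: at_le)
    then show "(((\<lambda>y. - f (p y)) \<circ> real_of_ereal) \<longlongrightarrow> - f w) (at_right 0)"
      by (simp only: zero_ereal_def ereal_tendsto_simps)
    have "((\<lambda>y. - f (p y)) \<longlongrightarrow> 0) at_top"
    proof (rule Lim_null_comparison)
      show "eventually (\<lambda>y. cmod (- f (p y)) \<le> 3 * norm_L2 f / y) at_top"
        using eventually_gt_at_top[of 0]
      proof eventually_elim
        case (elim y)
        have "cmod (f (p y)) \<le> 3 * norm_L2 f / Im (p y)"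
          using elim by (intro bergman_pointwise_bound[OF f] pU) auto
        also have "\<dots> \<le> 3 * norm_L2 f / y"
          using elim v norm_L2_nonneg[of f] by (intro divide_left_mono) (auto simp: p_def)
        finally show ?case by simp
      qed
      show "((\<lambda>y. 3 * norm_L2 f / y) \<longlongrightarrow> 0) at_top"
        by (rule tendsto_divide_0[OF tendsto_const filterlim_mono[OF filterlim_ident at_top_le_at_infinity order_refl]])
    qed
    then show "(((\<lambda>y. - f (p y)) \<circ> real_of_ereal) \<longlongrightarrow> 0) (at_left \<infinity>)"
      by (simp only: ereal_tendsto_simps)
  qed simp
  finally show ?thesis by simp
qed

section \<open>Vertical shifts\<close>

definition vshift :: "real \<Rightarrow> (complex \<Rightarrow> complex) \<Rightarrow> (complex \<Rightarrow> complex)" where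
  "vshift s f z = (if z \<in> upper_hp then f (z + of_real s * \<i>) else 0)"

lemma upper_hp_shift: "z \<in> upper_hp \<Longrightarrow> 0 \<le> s \<Longrightarrow> z + of_real s * \<i> \<in> upper_hp"
  by (simp add: upper_hp_def)

lemma vshift_measurable:
  assumes [measurable]: "f \<in> borel_measurable borel"
  shows "vshift s f \<in> borel_measurable borel"
proof -
  have "Measurable.pred borel (\<lambda>z. z \<in> upper_hp)" by measurable
  then show ?thesis unfolding vshift_def[abs_def] by measurable
qed

text \<open>
  Translation invariance of area: the shifted function sees only the part of \<open>f\<close> above the line
  \<open>Im z = s\<close>.
\<close>

lemma vshift_sq_integrable:
  assumes f: "f \<in> sq_integrable"
  shows "vshift s f \<in> sq_integrable"
proof -
  note [measurable] = sq_integrable_measurable[OF f]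
  have "(\<integral>\<^sup>+z. ennreal ((cmod (vshift s f z))\<^sup>2) \<partial>lborel)
      \<le> (\<integral>\<^sup>+z. ennreal ((cmod (f (z + of_real s * \<i>)))\<^sup>2) \<partial>lborel)"
    by (intro nn_integral_mono) (auto simp: vshift_def)
  also have "\<dots> = (\<integral>\<^sup>+z. ennreal ((cmod (f z))\<^sup>2) \<partial>lborel)"
    by (rule nn_integral_translate) measurable
  finally show ?thesis
    using f by (auto simp: sq_integrable_def vshift_measurable) (auto simp: vshift_def)
qed

lemma norm_vshift_le:
  assumes f: "f \<in> sq_integrable"
  shows "norm_L2 (vshift s f) \<le> norm_L2 f"
proof -
  note [measurable] = sq_integrable_measurable[OF f]
  have "(\<integral>\<^sup>+z. ennreal ((cmod (vshift s f z))\<^sup>2) \<partial>lborel)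
      \<le> (\<integral>\<^sup>+z. ennreal ((cmod (f (z + of_real s * \<i>)))\<^sup>2) \<partial>lborel)"
    by (intro nn_integral_mono) (auto simp: vshift_def)
  also have "\<dots> = (\<integral>\<^sup>+z. ennreal ((cmod (f z))\<^sup>2) \<partial>lborel)"
    by (rule nn_integral_translate) measurable
  finally have "(norm_L2 (vshift s f))\<^sup>2 \<le> (norm_L2 f)\<^sup>2"
    by (simp add: norm_L2_square f vshift_sq_integrable)
  then show ?thesis
    by (rule power2_le_imp_le) (rule norm_L2_nonneg)
qed

lemma vshift_bergman:
  assumes f: "f \<in> bergman_space" and s: "0 \<le> s"
  shows "vshift s f \<in> bergman_space"
proof -
  have "(f \<circ> (\<lambda>z. z + of_real s * \<i>)) holomorphic_on upper_hp"
    using f s by (intro holomorphic_on_compose_gen[of _ _ _ upper_hp] holomorphic_intros)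
      (auto simp: bergman_space_def upper_hp_shift)
  then have "vshift s f holomorphic_on upper_hp"
    by (rule holomorphic_transform) (simp add: vshift_def)
  then show ?thesis
    using vshift_sq_integrable[OF bergman_sq_integrable[OF f]] by (simp add: bergman_space_iff)
qed

lemma vshift_vshift:
  assumes "0 \<le> s"
  shows "vshift s (vshift t f) = vshift (s + t) f"
proof
  fix z
  show "vshift s (vshift t f) z = vshift (s + t) f z"
    using assms upper_hp_shift[of z s] by (simp add: vshift_def distrib_right add.assoc)
qed

lemma vshift_0: "f \<in> bergman_space \<Longrightarrow> vshift 0 f = f"
  by (auto simp: vshift_def fun_eq_iff bergman_space_def)

lemma vshift_add: "vshift s (\<lambda>z. f z + g z) = (\<lambda>z. vshift s f z + vshift s g z)"
  and vshift_scale: "vshift s (\<lambda>z. c * f z) = (\<lambda>z. c * vshift s f z)"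
  by (auto simp: vshift_def fun_eq_iff)

text \<open>
  With \<open>v = Im w\<close>, the inner integral over \<open>Re w\<close> contributes
  \<open>\<pi> / (y + v)\<close>, and \<open>2 arctan \<surd>(v / y)\<close> is a primitive of
  \<open>\<surd>(y / v) / (y + v)\<close>. That the result does not depend on \<open>y\<close> is what Schur's test needs.
\<close>

lemma nn_integral_schur_weight:
  assumes y: "y > 0"
  shows "(\<integral>\<^sup>+w. ennreal (indicator upper_hp w * (sqrt (y / Im w) / ((Re w - x)\<^sup>2 + (y + Im w)\<^sup>2))) \<partial>lborel)
    = ennreal (pi * pi)"
proof -
  have "(\<integral>\<^sup>+w. ennreal (indicator upper_hp w * (sqrt (y / Im w) / ((Re w - x)\<^sup>2 + (y + Im w)\<^sup>2))) \<partial>lborel)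
      = (\<integral>\<^sup>+v. \<integral>\<^sup>+u. ennreal (indicator upper_hp (Complex u v) * (sqrt (y / v) / ((u - x)\<^sup>2 + (y + v)\<^sup>2))) \<partial>lborel \<partial>lborel)"
    by (subst nn_integral_complex) auto
  also have "\<dots> = (\<integral>\<^sup>+v. ennreal pi * ennreal (indicator {0<..} v *\<^sub>R (sqrt (y / v) / (y + v))) \<partial>lborel)"
  proof (intro nn_integral_cong)
    fix v :: real
    show "(\<integral>\<^sup>+u. ennreal (indicator upper_hp (Complex u v) * (sqrt (y / v) / ((u - x)\<^sup>2 + (y + v)\<^sup>2))) \<partial>lborel)
        = ennreal pi * ennreal (indicator {0<..} v *\<^sub>R (sqrt (y / v) / (y + v)))"
    proof (cases "v > 0")
      case True
      have "(\<integral>\<^sup>+u. ennreal (indicator upper_hp (Complex u v) * (sqrt (y / v) / ((u - x)\<^sup>2 + (y + v)\<^sup>2))) \<partial>lborel)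
          = (\<integral>\<^sup>+u. ennreal (sqrt (y / v)) * ennreal (1 / ((u - x)\<^sup>2 + (y + v)\<^sup>2)) \<partial>lborel)"
        using True y by (intro nn_integral_cong) (simp add: upper_hp_def ennreal_mult[symmetric])
      also have "\<dots> = ennreal (sqrt (y / v)) * ennreal (pi / (y + v))"
        using True y by (simp add: nn_integral_cmult cauchy_density(3))
      also have "\<dots> = ennreal pi * ennreal (indicator {0<..} v *\<^sub>R (sqrt (y / v) / (y + v)))"
        using True y by (simp add: ennreal_mult[symmetric] mult.commute)
      finally show ?thesis .
    qed (simp add: upper_hp_def)
  qed
  also have "\<dots> = ennreal pi * (\<integral>\<^sup>+v. ennreal (indicator {0<..} v *\<^sub>R (sqrt (y / v) / (y + v))) \<partial>lborel)"
    by (rule nn_integral_cmult) measurable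
  also have "(\<integral>\<^sup>+v. ennreal (indicator {0<..} v *\<^sub>R (sqrt (y / v) / (y + v))) \<partial>lborel) = ennreal pi"
  proof -
    define F where "F v = 2 * arctan (sqrt (v / y))" for v
    have der: "DERIV F v :> sqrt (y / v) / (y + v)" if "v > 0" for v
    proof -
      define r where "r = sqrt (v / y)"
      have r: "r > 0" "r\<^sup>2 = v / y" using that y by (auto simp: r_def)
      have "DERIV F v :> 2 * (1 / y * (inverse r / 2) / (1 + r\<^sup>2))"
        unfolding F_def r_def by (rule derivative_eq_intros refl | use that y in \<open>simp add: divide_simps\<close>)+
      also have "2 * (1 / y * (inverse r / 2) / (1 + r\<^sup>2)) = inverse r / (y * (1 + r\<^sup>2))"
        by simp
      also have "y * (1 + r\<^sup>2) = y + v"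
        using r(2) y by (simp add: field_simps)
      also have "inverse r = sqrt (y / v)"
        using that y by (simp add: r_def real_sqrt_inverse[symmetric])
      finally show ?thesis .
    qed
    have cont: "isCont (\<lambda>v. sqrt (y / v) / (y + v)) v" if "v > 0" for v
      using that y by (intro continuous_intros) auto
    have z: "(F \<longlongrightarrow> 0) (at_right 0)"
    proof -
      have "isCont F 0" unfolding F_def using y by (intro continuous_intros) auto
      then show ?thesis by (auto simp: isCont_def F_def intro: filterlim_mono at_le)
    qed
    have t: "(F \<longlongrightarrow> 2 * (pi / 2)) at_top"
    proof -
      have "filterlim (\<lambda>v. v / y) at_top at_top"
        unfolding filterlim_at_top eventually_at_top_linorder
      proof (intro allI exI impI)
        fix Z x :: real assume "Z * y \<le> x"
        then show "Z \<le> x / y" using y by (simp add: field_simps)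
      qed
      then show ?thesis unfolding F_def
        by (intro tendsto_mult tendsto_const filterlim_compose[OF tendsto_arctan_at_top]
            filterlim_compose[OF sqrt_at_top])
    qed
    have *: "set_integrable lborel (einterval 0 \<infinity>) (\<lambda>v. sqrt (y / v) / (y + v))"
      "(LBINT v=0..\<infinity>. sqrt (y / v) / (y + v)) = pi - 0"
      by (rule interval_integral_FTC_nonneg[where F = F];
          use der cont y z t in \<open>auto simp: ereal_tendsto_simps zero_ereal_def intro!: AE_I2\<close>)+
    have i: "integrable lborel (\<lambda>v. indicator {0<..} v *\<^sub>R (sqrt (y / v) / (y + v)))"
      using *(1) by (simp add: set_integrable_def zero_ereal_def)
    have "(\<integral>v. indicator {0<..} v *\<^sub>R (sqrt (y / v) / (y + v)) \<partial>lborel) = pi"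
      using *(2) by (simp add: interval_lebesgue_integral_def set_lebesgue_integral_def zero_ereal_def)
    then show ?thesis
      using nn_integral_eq_integral[OF i] y by (auto simp: indicator_def)
  qed
  finally show ?thesis by (simp add: ennreal_mult[symmetric])
qed

text \<open>
  Schur's test. The integral of the bound on \<open>cmod (K z w)\<close> over one variable diverges
  logarithmically, but weighted with \<open>\<surd>(Im z / Im w)\<close> its integral over \<open>w\<close> is \<open>\<pi>\<^sup>2\<close> for
  every \<open>z\<close>, and symmetrically for \<open>z\<close>. The inequality \<open>a b \<le> t a\<^sup>2 + b\<^sup>2 / t\<close> with
  \<open>t = \<surd>(Im z / Im w)\<close> therefore bounds the double integral by \<open>\<pi>\<^sup>2 (\<parallel>f\<parallel>\<^sup>2 + \<parallel>h\<parallel>\<^sup>2)\<close>.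
\<close>

lemma schur_integrable:
  assumes f: "f \<in> sq_integrable" and h: "h \<in> sq_integrable"
    and Km [measurable]: "case_prod K \<in> borel_measurable (lborel \<Otimes>\<^sub>M lborel)"
    and K: "\<And>z w. z \<in> upper_hp \<Longrightarrow> w \<in> upper_hp \<Longrightarrow>
      cmod (K z w) \<le> 1 / ((Re z - Re w)\<^sup>2 + (Im z + Im w)\<^sup>2)"
  shows "integrable (lborel \<Otimes>\<^sub>M lborel) (\<lambda>(z, w). f z * K z w * cnj (h w))"
proof (rule integrableI_bounded)
  note [measurable] = sq_integrable_measurable[OF f] sq_integrable_measurable[OF h]
  define \<theta> where "\<theta> z w = 1 / ((Re z - Re w)\<^sup>2 + (Im z + Im w)\<^sup>2)" for z w
  have t0: "\<theta> z w \<ge> 0" for z w by (simp add: \<theta>_def)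
  define A where "A z w = ennreal ((cmod (f z))\<^sup>2) *
    ennreal (indicator upper_hp w * (sqrt (Im z / Im w) / ((Re w - Re z)\<^sup>2 + (Im z + Im w)\<^sup>2)))" for z w
  define B where "B z w = ennreal ((cmod (h w))\<^sup>2) *
    ennreal (indicator upper_hp z * (sqrt (Im w / Im z) / ((Re z - Re w)\<^sup>2 + (Im w + Im z)\<^sup>2)))" for z w
  have [measurable]: "case_prod A \<in> borel_measurable (lborel \<Otimes>\<^sub>M lborel)"
    "case_prod B \<in> borel_measurable (lborel \<Otimes>\<^sub>M lborel)"
    unfolding A_def B_def case_prod_unfold by measurable
  show "(\<lambda>(z, w). f z * K z w * cnj (h w)) \<in> borel_measurable (lborel \<Otimes>\<^sub>M lborel)"
    using Km unfolding case_prod_unfold by measurable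
  have le: "ennreal (cmod (f z * K z w * cnj (h w))) \<le> A z w + B z w" for z w
  proof (cases "z \<in> upper_hp \<and> w \<in> upper_hp")
    case True
    then have p: "Im z > 0" "Im w > 0" by (auto simp: upper_hp_def)
    define t where "t = sqrt (Im z / Im w)"
    have t: "t > 0" "sqrt (Im w / Im z) = inverse t"
      using p by (auto simp: t_def real_sqrt_inverse[symmetric])
    define a b where "a = cmod (f z)" and "b = cmod (h w)"
    have "2 * (t * a) * b \<le> (t * a)\<^sup>2 + b\<^sup>2"
      by (rule sum_squares_bound)
    then have "2 * (a * b) \<le> a\<^sup>2 * t + b\<^sup>2 * inverse t"
      using t by (simp add: field_simps power2_eq_square)
    moreover have "0 \<le> a * b" by (simp add: a_def b_def)
    ultimately have "a * b \<le> a\<^sup>2 * t + b\<^sup>2 * inverse t" by linarith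
    then have "a * b * \<theta> z w \<le> (a\<^sup>2 * t + b\<^sup>2 * inverse t) * \<theta> z w"
      by (rule mult_right_mono) (rule t0)
    moreover have "cmod (f z * K z w * cnj (h w)) \<le> a * b * \<theta> z w"
      using mult_left_mono[OF K[of z w], of "a * b"] True
      by (simp add: norm_mult a_def b_def \<theta>_def mult_ac)
    ultimately have "cmod (f z * K z w * cnj (h w)) \<le> a\<^sup>2 * (t * \<theta> z w) + b\<^sup>2 * (inverse t * \<theta> z w)"
      by (simp add: algebra_simps)
    then have "ennreal (cmod (f z * K z w * cnj (h w)))
        \<le> ennreal (a\<^sup>2 * (t * \<theta> z w)) + ennreal (b\<^sup>2 * (inverse t * \<theta> z w))"
      using t t0[of z w] by (simp add: ennreal_plus[symmetric] ennreal_leI del: ennreal_plus)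
    also have "ennreal (a\<^sup>2 * (t * \<theta> z w)) = A z w"
      using True t t0[of z w]
      by (simp add: A_def a_def t_def[symmetric] \<theta>_def ennreal_mult[symmetric] power2_commute[of "Re w"])
    also have "ennreal (b\<^sup>2 * (inverse t * \<theta> z w)) = B z w"
      using True t t0[of z w]
      by (simp add: B_def b_def t(2) \<theta>_def ennreal_mult[symmetric] add.commute[of "Im w"])
    finally show ?thesis .
  next
    case False
    then show ?thesis using f h by (auto simp: sq_integrable_off)
  qed
  have "(\<integral>\<^sup>+p. ennreal (cmod (case p of (z, w) \<Rightarrow> f z * K z w * cnj (h w))) \<partial>(lborel \<Otimes>\<^sub>M lborel))
      \<le> (\<integral>\<^sup>+p. case_prod A p + case_prod B p \<partial>(lborel \<Otimes>\<^sub>M lborel))"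
    by (intro nn_integral_mono) (auto intro: le)
  also have "\<dots> = (\<integral>\<^sup>+p. case_prod A p \<partial>(lborel \<Otimes>\<^sub>M lborel)) + (\<integral>\<^sup>+p. case_prod B p \<partial>(lborel \<Otimes>\<^sub>M lborel))"
    by (rule nn_integral_add) measurable
  also have "(\<integral>\<^sup>+p. case_prod A p \<partial>(lborel \<Otimes>\<^sub>M lborel)) = (\<integral>\<^sup>+z. \<integral>\<^sup>+w. A z w \<partial>lborel \<partial>lborel)"
    by (subst lborel.nn_integral_fst[symmetric]) auto
  also have "(\<integral>\<^sup>+p. case_prod B p \<partial>(lborel \<Otimes>\<^sub>M lborel)) = (\<integral>\<^sup>+w. \<integral>\<^sup>+z. B z w \<partial>lborel \<partial>lborel)"
    by (subst lborel_pair.nn_integral_snd[symmetric]) auto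
  also have "(\<integral>\<^sup>+z. \<integral>\<^sup>+w. A z w \<partial>lborel \<partial>lborel) = (\<integral>\<^sup>+z. ennreal ((cmod (f z))\<^sup>2) * ennreal (pi * pi) \<partial>lborel)"
  proof (intro nn_integral_cong)
    fix z
    show "(\<integral>\<^sup>+w. A z w \<partial>lborel) = ennreal ((cmod (f z))\<^sup>2) * ennreal (pi * pi)"
    proof (cases "z \<in> upper_hp")
      case True
      then have "0 < Im z" by (simp add: upper_hp_def)
      have "(\<integral>\<^sup>+w. A z w \<partial>lborel) = ennreal ((cmod (f z))\<^sup>2) * (\<integral>\<^sup>+w. ennreal (indicator upper_hp w * (sqrt (Im z / Im w) / ((Re w - Re z)\<^sup>2 + (Im z + Im w)\<^sup>2))) \<partial>lborel)"
        unfolding A_def by (rule nn_integral_cmult) measurable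
      also have "\<dots> = ennreal ((cmod (f z))\<^sup>2) * ennreal (pi * pi)"
        by (simp only: nn_integral_schur_weight[OF \<open>0 < Im z\<close>])
      finally show ?thesis .
    qed (use f in \<open>simp add: A_def sq_integrable_off\<close>)
  qed
  also have "\<dots> = ennreal ((norm_L2 f)\<^sup>2) * ennreal (pi * pi)"
    by (subst nn_integral_multc) (auto simp: norm_L2_square f)
  also have "(\<integral>\<^sup>+w. \<integral>\<^sup>+z. B z w \<partial>lborel \<partial>lborel) = (\<integral>\<^sup>+w. ennreal ((cmod (h w))\<^sup>2) * ennreal (pi * pi) \<partial>lborel)"
  proof (intro nn_integral_cong)
    fix w
    show "(\<integral>\<^sup>+z. B z w \<partial>lborel) = ennreal ((cmod (h w))\<^sup>2) * ennreal (pi * pi)"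
    proof (cases "w \<in> upper_hp")
      case True
      then have "0 < Im w" by (simp add: upper_hp_def)
      have "(\<integral>\<^sup>+z. B z w \<partial>lborel) = ennreal ((cmod (h w))\<^sup>2) * (\<integral>\<^sup>+z. ennreal (indicator upper_hp z * (sqrt (Im w / Im z) / ((Re z - Re w)\<^sup>2 + (Im w + Im z)\<^sup>2))) \<partial>lborel)"
        unfolding B_def by (rule nn_integral_cmult) measurable
      also have "\<dots> = ennreal ((cmod (h w))\<^sup>2) * ennreal (pi * pi)"
        by (simp only: nn_integral_schur_weight[OF \<open>0 < Im w\<close>])
      finally show ?thesis .
    qed (use h in \<open>simp add: B_def sq_integrable_off\<close>)
  qed
  also have "\<dots> = ennreal ((norm_L2 h)\<^sup>2) * ennreal (pi * pi)"
    by (subst nn_integral_multc) (auto simp: norm_L2_square h)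
  also have "ennreal ((norm_L2 f)\<^sup>2) * ennreal (pi * pi) + ennreal ((norm_L2 h)\<^sup>2) * ennreal (pi * pi) < \<infinity>"
    by (simp add: ennreal_mult_less_top)
  finally show "(\<integral>\<^sup>+p. ennreal (cmod (case p of (z, w) \<Rightarrow> f z * K z w * cnj (h w))) \<partial>(lborel \<Otimes>\<^sub>M lborel)) < \<infinity>" .
qed

text \<open>
  Both sides are the double integral of \<open>f z * cnj (k z w) * cnj (h w)\<close> with
  \<open>k z w = -1 / (\<pi> (z - cnj w + i c)\<^sup>2)\<close>. Integrating over \<open>z\<close> first reproduces \<open>f(w + i c)\<close>,
  integrating over \<open>w\<close> first reproduces \<open>h(z + i c)\<close>. Schur's test justifies the exchange.
\<close>

theorem vshift_selfadjoint:
  assumes f: "f \<in> bergman_space" and h: "h \<in> bergman_space" and c: "0 \<le> c"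
  shows "inner_L2 (vshift c f) h = inner_L2 f (vshift c h)"
proof -
  note sf = bergman_sq_integrable[OF f] and sh = bergman_sq_integrable[OF h]
  define K where "K z w = (if z \<in> upper_hp \<and> w \<in> upper_hp
    then cnj (bergman_kernel (w + of_real c * \<i>) z) else 0)" for z w
  have Kw: "f z * K z w = f z * cnj (bergman_kernel (w + of_real c * \<i>) z)" if "w \<in> upper_hp" for z w
    using that sf by (auto simp: K_def sq_integrable_off)
  have Kz: "K z w * cnj (h w) = cnj (h w * cnj (bergman_kernel (z + of_real c * \<i>) w))"
    if "z \<in> upper_hp" for z w
  proof (cases "w \<in> upper_hp")
    case True
    have "cnj (bergman_kernel (w + of_real c * \<i>) z) = bergman_kernel z (w + of_real c * \<i>)"
      using that True c by (intro bergman_kernel_cnj upper_hp_shift)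
    also have "\<dots> = bergman_kernel (z + of_real c * \<i>) w"
      using True c upper_hp_shift[OF True c] by (simp add: bergman_kernel_def algebra_simps)
    finally show ?thesis using that True by (simp add: K_def)
  qed (use sh in \<open>simp add: sq_integrable_off\<close>)
  have Km: "case_prod K \<in> borel_measurable (lborel \<Otimes>\<^sub>M lborel)"
  proof -
    have "Measurable.pred (borel \<Otimes>\<^sub>M borel) (\<lambda>p::complex \<times> complex. fst p \<in> upper_hp \<and> snd p \<in> upper_hp)"
      by measurable
    moreover have "(\<lambda>p. (fst p, snd p + of_real c * \<i>)) \<in> borel \<Otimes>\<^sub>M borel \<rightarrow>\<^sub>M borel \<Otimes>\<^sub>M borel"
      by measurable
    from measurable_compose[OF this bergman_kernel_measurable2]
    have "(\<lambda>p. bergman_kernel (snd p + of_real c * \<i>) (fst p)) \<in> borel_measurable (borel \<Otimes>\<^sub>M borel)"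
      by simp
    ultimately have "(\<lambda>p. K (fst p) (snd p)) \<in> borel_measurable (borel \<Otimes>\<^sub>M borel)"
      unfolding K_def by (intro measurable_If borel_measurable_cnj) auto
    then show ?thesis
      by (simp add: case_prod_unfold cong: measurable_cong_sets)
  qed
  have Kle: "cmod (K z w) \<le> 1 / ((Re z - Re w)\<^sup>2 + (Im z + Im w)\<^sup>2)"
    if "z \<in> upper_hp" "w \<in> upper_hp" for z w
  proof -
    have p: "Im z > 0" "Im w > 0" using that by (auto simp: upper_hp_def)
    have "(Im z + Im w)\<^sup>2 \<le> (Im z + Im w + c)\<^sup>2"
      using p c by (intro power_mono) auto
    then have le: "(Re z - Re w)\<^sup>2 + (Im z + Im w)\<^sup>2 \<le> pi * ((Re z - Re w)\<^sup>2 + (Im z + Im w + c)\<^sup>2)"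
      using mult_right_mono[of 1 pi "(Re z - Re w)\<^sup>2 + (Im z + Im w + c)\<^sup>2"] pi_ge_two by simp
    have pos: "0 < (Re z - Re w)\<^sup>2 + (Im z + Im w)\<^sup>2"
      using p by (intro add_nonneg_pos) auto
    have "cmod (K z w) = 1 / (pi * ((Re z - Re w)\<^sup>2 + (Im z + Im w + c)\<^sup>2))"
    proof -
      have "z - cnj (w + of_real c * \<i>) = Complex (Re z - Re w) (Im z + Im w + c)"
        by (simp add: complex_eq_iff)
      then have "bergman_kernel (w + of_real c * \<i>) z
          = - 1 / (of_real pi * (Complex (Re z - Re w) (Im z + Im w + c))\<^sup>2)"
        using that(1) by (simp only: bergman_kernel_def if_True)
      then show ?thesis
        using that by (simp add: K_def norm_divide norm_mult norm_power cmod_power2)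
    qed
    also have "\<dots> \<le> 1 / ((Re z - Re w)\<^sup>2 + (Im z + Im w)\<^sup>2)"
      using le pos by (intro frac_le) auto
    finally show ?thesis .
  qed
  have int: "integrable (lborel \<Otimes>\<^sub>M lborel) (\<lambda>(z, w). f z * K z w * cnj (h w))"
    by (rule schur_integrable[OF sf sh Km Kle])
  have "inner_L2 (vshift c f) h = (\<integral>w. vshift c f w * cnj (h w) \<partial>lborel)"
    by (rule inner_L2_lborel[OF vshift_sq_integrable[OF sf]])
  also have "\<dots> = (\<integral>w. (\<integral>z. f z * K z w * cnj (h w) \<partial>lborel) \<partial>lborel)"
  proof (intro Bochner_Integration.integral_cong refl)
    fix w
    show "vshift c f w * cnj (h w) = (\<integral>z. f z * K z w * cnj (h w) \<partial>lborel)"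
    proof (cases "w \<in> upper_hp")
      case True
      have "vshift c f w = inner_L2 f (bergman_kernel (w + of_real c * \<i>))"
        using True c by (simp add: vshift_def bergman_reproducing[OF f] upper_hp_shift)
      then show ?thesis
        using True by (simp add: inner_L2_lborel[OF sf] Kw)
    qed (use sh in \<open>simp add: sq_integrable_off\<close>)
  qed
  also have "\<dots> = (\<integral>z. (\<integral>w. f z * K z w * cnj (h w) \<partial>lborel) \<partial>lborel)"
    by (rule lborel_pair.Fubini_integral[OF int])
  also have "\<dots> = (\<integral>z. f z * cnj (vshift c h z) \<partial>lborel)"
  proof (intro Bochner_Integration.integral_cong refl)
    fix z
    show "(\<integral>w. f z * K z w * cnj (h w) \<partial>lborel) = f z * cnj (vshift c h z)"
    proof (cases "z \<in> upper_hp")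
      case True
      have "vshift c h z = inner_L2 h (bergman_kernel (z + of_real c * \<i>))"
        using True c by (simp add: vshift_def bergman_reproducing[OF h] upper_hp_shift)
      then show ?thesis
        using True by (simp only: inner_L2_lborel[OF sh] Kz mult.assoc Bochner_Integration.integral_cnj
            Bochner_Integration.integral_mult_right_zero)
    qed (use sf in \<open>simp add: sq_integrable_off\<close>)
  qed
  also have "\<dots> = inner_L2 f (vshift c h)"
    by (rule inner_L2_lborel[OF sf, symmetric])
  finally show ?thesis .
qed

text \<open>
  Since \<open>V\<^sub>c\<close> is the square of the self-adjoint contraction \<open>V\<^bsub>c/2\<^esub>\<close>, its quadratic form is
  \<open>\<parallel>V\<^bsub>c/2\<^esub> f\<parallel>\<^sup>2\<close>.
\<close>

lemma inner_vshift_bounds: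
  assumes f: "f \<in> bergman_space" and c: "0 \<le> c"
  shows "inner_L2 (vshift c f) f \<in> \<real>" "0 \<le> Re (inner_L2 (vshift c f) f)"
    "Re (inner_L2 (vshift c f) f) \<le> (norm_L2 f)\<^sup>2"
proof -
  have "vshift c f = vshift (c/2) (vshift (c/2) f)"
    using c by (simp add: vshift_vshift)
  then have "inner_L2 (vshift c f) f = inner_L2 (vshift (c/2) f) (vshift (c/2) f)"
    using c vshift_selfadjoint[OF vshift_bergman[OF f] f, of "c/2" "c/2"] by simp
  then have eq: "inner_L2 (vshift c f) f = of_real ((norm_L2 (vshift (c/2) f))\<^sup>2)"
    by (simp add: inner_L2_self)
  show "inner_L2 (vshift c f) f \<in> \<real>" "0 \<le> Re (inner_L2 (vshift c f) f)"
    unfolding eq by simp_all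
  show "Re (inner_L2 (vshift c f) f) \<le> (norm_L2 f)\<^sup>2"
    unfolding eq using norm_vshift_le[OF bergman_sq_integrable[OF f], of "c/2"]
    by (simp add: norm_L2_nonneg power_mono)
qed

section \<open>Absolutely convergent series of shifts\<close>

text \<open>
  The operator \<open>\<Sum> c\<^sub>m V\<^bsub>2m\<^esub>\<close>, that is the power series with coefficients \<open>c\<close> evaluated at \<open>V\<^sub>2\<close>. Steps
  of length two suffice because \<open>V\<^sub>2\<close> corresponds to \<open>e\<^sup>-\<^sup>2\<^sup>t\<close>.
\<close>

definition shift_series :: "(nat \<Rightarrow> real) \<Rightarrow> (complex \<Rightarrow> complex) \<Rightarrow> (complex \<Rightarrow> complex)" where
  "shift_series c f z = (\<Sum>m. of_real (c m) * vshift (2 * real m) f z)"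

lemma cmod_vshift_le:
  assumes f: "f \<in> bergman_space" and z: "z \<in> upper_hp" and s: "0 \<le> s"
  shows "cmod (vshift s f z) \<le> 3 * norm_L2 f / Im z"
proof -
  have "cmod (vshift s f z) \<le> 3 * norm_L2 (vshift s f) / Im z"
    by (rule bergman_pointwise_bound[OF vshift_bergman[OF f s] z])
  also have "\<dots> \<le> 3 * norm_L2 f / Im z"
    using z norm_vshift_le[OF bergman_sq_integrable[OF f], of s]
    by (intro divide_right_mono) (auto simp: upper_hp_def)
  finally show ?thesis .
qed

lemma summable_shift_series:
  assumes c: "summable (\<lambda>m. \<bar>c m\<bar>)" and f: "f \<in> bergman_space"
  shows "summable (\<lambda>m. cmod (of_real (c m) * vshift (2 * real m) f z))"
proof (cases "z \<in> upper_hp")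
  case True
  show ?thesis
  proof (rule summable_comparison_test')
    show "summable (\<lambda>m. \<bar>c m\<bar> * (3 * norm_L2 f / Im z))"
      by (rule summable_mult2[OF c])
    show "norm (cmod (of_real (c m) * vshift (2 * real m) f z)) \<le> \<bar>c m\<bar> * (3 * norm_L2 f / Im z)" for m
      using mult_left_mono[OF cmod_vshift_le[OF f True, of "2 * real m"], of "\<bar>c m\<bar>"]
      by (simp add: norm_mult)
  qed
qed (simp add: vshift_def)

text \<open>
  On a disc about \<open>z\<close> of radius \<open>Im z / 2\<close> the pointwise bound makes the series converge uniformly.
\<close>

lemma shift_series_holomorphic:
  assumes c: "summable (\<lambda>m. \<bar>c m\<bar>)" and f: "f \<in> bergman_space"
  shows "shift_series c f holomorphic_on upper_hp"
proof (rule holomorphic_uniform_sequence[OF open_upper_hp])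
  show "(\<lambda>z. \<Sum>m<N. of_real (c m) * vshift (2 * real m) f z) holomorphic_on upper_hp" for N
    using vshift_bergman[OF f] by (intro holomorphic_intros) (auto simp: bergman_space_def)
  fix z assume z: "z \<in> upper_hp"
  define d where "d = Im z / 2"
  have d: "d > 0" using z by (simp add: d_def upper_hp_def)
  have im: "d \<le> Im w" if "w \<in> cball z d" for w
    using that abs_Im_le_cmod[of "z - w"] by (simp add: dist_norm d_def)
  have "uniform_limit (cball z d) (\<lambda>N w. \<Sum>m<N. of_real (c m) * vshift (2 * real m) f w)
      (\<lambda>w. \<Sum>m. of_real (c m) * vshift (2 * real m) f w) sequentially"
  proof (rule Weierstrass_m_test)
    show "summable (\<lambda>m. \<bar>c m\<bar> * (3 * norm_L2 f / d))"
      by (rule summable_mult2[OF c])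
    fix m w assume w: "w \<in> cball z d"
    have wU: "w \<in> upper_hp" using im[OF w] d by (simp add: upper_hp_def)
    have "cmod (vshift (2 * real m) f w) \<le> 3 * norm_L2 f / Im w"
      by (rule cmod_vshift_le[OF f wU]) simp
    also have "\<dots> \<le> 3 * norm_L2 f / d"
      using im[OF w] d norm_L2_nonneg[of f] by (intro divide_left_mono) auto
    finally show "norm (of_real (c m) * vshift (2 * real m) f w) \<le> \<bar>c m\<bar> * (3 * norm_L2 f / d)"
      unfolding norm_mult norm_of_real by (intro mult_left_mono) auto
  qed
  moreover have "cball z d \<subseteq> upper_hp"
    using im d by (force simp: upper_hp_def)
  ultimately show "\<exists>d>0. cball z d \<subseteq> upper_hp \<and> uniform_limit (cball z d)
      (\<lambda>N w. \<Sum>m<N. of_real (c m) * vshift (2 * real m) f w) (shift_series c f) sequentially"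
    using d unfolding shift_series_def[abs_def] by blast
qed

text \<open>
  The Cauchy-Schwarz inequality for \<open>\<surd>\<bar>c\<^sub>m\<bar>\<close> and \<open>\<surd>\<bar>c\<^sub>m\<bar> \<bar>a\<^sub>m\<bar>\<close>. In this form the estimate
  can be integrated term by term, and bounds the \<open>L\<^sub>2\<close> norm of a series of shifts.
\<close>

lemma weighted_series_square_le:
  fixes c :: "nat \<Rightarrow> real" and a :: "nat \<Rightarrow> complex"
  assumes c: "summable (\<lambda>m. \<bar>c m\<bar>)" and ca: "summable (\<lambda>m. cmod (of_real (c m) * a m))"
  shows "ennreal ((cmod (\<Sum>m. of_real (c m) * a m))\<^sup>2)
    \<le> ennreal (\<Sum>m. \<bar>c m\<bar>) * (\<Sum>m. ennreal (\<bar>c m\<bar> * (cmod (a m))\<^sup>2))"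
proof -
  have "ennreal (cmod (\<Sum>m. of_real (c m) * a m)) \<le> ennreal (\<Sum>m. cmod (of_real (c m) * a m))"
    by (intro ennreal_leI summable_norm ca)
  also have "\<dots> = (\<Sum>m. ennreal (cmod (of_real (c m) * a m)))"
    by (subst suminf_ennreal2[OF _ ca]) auto
  also have "\<dots> = (\<integral>\<^sup>+m. ennreal (sqrt \<bar>c m\<bar>) * ennreal (sqrt \<bar>c m\<bar> * cmod (a m)) \<partial>count_space UNIV)"
    by (subst nn_integral_count_space_nat)
      (simp add: ennreal_mult[symmetric] norm_mult mult.assoc[symmetric])
  finally have "(ennreal (cmod (\<Sum>m. of_real (c m) * a m)))\<^sup>2
      \<le> (\<integral>\<^sup>+m. ennreal (sqrt \<bar>c m\<bar>) * ennreal (sqrt \<bar>c m\<bar> * cmod (a m)) \<partial>count_space UNIV)\<^sup>2"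
    by (rule power_mono) simp
  also have "\<dots> \<le> (\<integral>\<^sup>+m. (ennreal (sqrt \<bar>c m\<bar>))\<^sup>2 \<partial>count_space UNIV)
      * (\<integral>\<^sup>+m. (ennreal (sqrt \<bar>c m\<bar> * cmod (a m)))\<^sup>2 \<partial>count_space UNIV)"
    by (rule Cauchy_Schwarz_nn_integral) auto
  also have "(\<integral>\<^sup>+m. (ennreal (sqrt \<bar>c m\<bar>))\<^sup>2 \<partial>count_space UNIV) = ennreal (\<Sum>m. \<bar>c m\<bar>)"
    by (subst nn_integral_count_space_nat) (simp add: ennreal_power suminf_ennreal2[OF _ c])
  also have "(\<integral>\<^sup>+m. (ennreal (sqrt \<bar>c m\<bar> * cmod (a m)))\<^sup>2 \<partial>count_space UNIV)
      = (\<Sum>m. ennreal (\<bar>c m\<bar> * (cmod (a m))\<^sup>2))"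
    by (subst nn_integral_count_space_nat) (simp add: ennreal_power power_mult_distrib)
  finally show ?thesis by (simp add: ennreal_power)
qed

lemma shift_series_measurable:
  assumes f: "f \<in> sq_integrable"
  shows "shift_series c f \<in> borel_measurable borel"
proof -
  have [measurable]: "vshift (2 * real m) f \<in> borel_measurable borel" for m
    by (rule vshift_measurable[OF sq_integrable_measurable[OF f]])
  show ?thesis unfolding shift_series_def[abs_def] by measurable
qed

lemma nn_integral_shift_series_le:
  assumes c: "summable (\<lambda>m. \<bar>c m\<bar>)" and f: "f \<in> bergman_space"
  shows "(\<integral>\<^sup>+z. ennreal ((cmod (shift_series c f z))\<^sup>2) \<partial>lborel)
    \<le> ennreal (((\<Sum>m. \<bar>c m\<bar>) * norm_L2 f)\<^sup>2)"
proof -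
  note sf = bergman_sq_integrable[OF f]
  have [measurable]: "vshift (2 * real m) f \<in> borel_measurable borel" for m
    by (rule vshift_measurable[OF sq_integrable_measurable[OF sf]])
  let ?C = "\<Sum>m. \<bar>c m\<bar>"
  have C: "0 \<le> ?C" by (rule suminf_nonneg[OF c]) simp
  have "(\<integral>\<^sup>+z. ennreal ((cmod (shift_series c f z))\<^sup>2) \<partial>lborel)
      \<le> (\<integral>\<^sup>+z. ennreal ?C * (\<Sum>m. ennreal (\<bar>c m\<bar> * (cmod (vshift (2 * real m) f z))\<^sup>2)) \<partial>lborel)"
    unfolding shift_series_def
    by (intro nn_integral_mono weighted_series_square_le c summable_shift_series f)
  also have "\<dots> = ennreal ?C * (\<Sum>m. \<integral>\<^sup>+z. ennreal (\<bar>c m\<bar> * (cmod (vshift (2 * real m) f z))\<^sup>2) \<partial>lborel)"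
    by (simp add: nn_integral_cmult nn_integral_suminf)
  also have "\<dots> \<le> ennreal ?C * (\<Sum>m. ennreal (\<bar>c m\<bar> * (norm_L2 f)\<^sup>2))"
  proof (intro mult_left_mono suminf_le summableI)
    fix m
    have "(\<integral>\<^sup>+z. ennreal (\<bar>c m\<bar> * (cmod (vshift (2 * real m) f z))\<^sup>2) \<partial>lborel)
        = ennreal \<bar>c m\<bar> * ennreal ((norm_L2 (vshift (2 * real m) f))\<^sup>2)"
      by (simp add: ennreal_mult nn_integral_cmult norm_L2_square vshift_sq_integrable sf)
    also have "\<dots> = ennreal (\<bar>c m\<bar> * (norm_L2 (vshift (2 * real m) f))\<^sup>2)"
      by (simp add: ennreal_mult)
    also have "\<dots> \<le> ennreal (\<bar>c m\<bar> * (norm_L2 f)\<^sup>2)"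
      by (intro ennreal_leI mult_left_mono power_mono norm_vshift_le sf norm_L2_nonneg) simp
    finally show "(\<integral>\<^sup>+z. ennreal (\<bar>c m\<bar> * (cmod (vshift (2 * real m) f z))\<^sup>2) \<partial>lborel)
        \<le> ennreal (\<bar>c m\<bar> * (norm_L2 f)\<^sup>2)" .
  qed simp
  also have "(\<Sum>m. ennreal (\<bar>c m\<bar> * (norm_L2 f)\<^sup>2)) = ennreal (?C * (norm_L2 f)\<^sup>2)"
    using summable_mult2[OF c, of "(norm_L2 f)\<^sup>2"]
    by (subst suminf_ennreal2) (auto simp: suminf_mult2[OF c])
  also have "ennreal ?C * ennreal (?C * (norm_L2 f)\<^sup>2) = ennreal ((?C * norm_L2 f)\<^sup>2)"
    using C by (subst ennreal_mult[symmetric]) (auto simp: power2_eq_square mult_ac intro!: mult_nonneg_nonneg norm_L2_nonneg)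
  finally show ?thesis .
qed

lemma shift_series_bergman:
  assumes c: "summable (\<lambda>m. \<bar>c m\<bar>)" and f: "f \<in> bergman_space"
  shows "shift_series c f \<in> bergman_space"
proof -
  have "(\<integral>\<^sup>+z. ennreal ((cmod (shift_series c f z))\<^sup>2) \<partial>lborel) < \<infinity>"
    using nn_integral_shift_series_le[OF c f] by (rule order.strict_trans1) simp
  then show ?thesis
    using shift_series_holomorphic[OF c f] shift_series_measurable[OF bergman_sq_integrable[OF f]]
    by (simp add: bergman_space_iff sq_integrable_def) (simp add: shift_series_def vshift_def)
qed

lemma norm_shift_series_le:
  assumes c: "summable (\<lambda>m. \<bar>c m\<bar>)" and f: "f \<in> bergman_space"
  shows "norm_L2 (shift_series c f) \<le> (\<Sum>m. \<bar>c m\<bar>) * norm_L2 f"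
proof -
  have "(norm_L2 (shift_series c f))\<^sup>2 \<le> ((\<Sum>m. \<bar>c m\<bar>) * norm_L2 f)\<^sup>2"
    using nn_integral_shift_series_le[OF c f]
    by (simp add: norm_L2_square bergman_sq_integrable shift_series_bergman c f)
  then show ?thesis
    by (rule power2_le_imp_le) (intro mult_nonneg_nonneg suminf_nonneg[OF c] norm_L2_nonneg abs_ge_zero)
qed

lemma shift_series_add:
  assumes c: "summable (\<lambda>m. \<bar>c m\<bar>)" and f: "f \<in> bergman_space" and g: "g \<in> bergman_space"
  shows "shift_series c (\<lambda>z. f z + g z) = (\<lambda>z. shift_series c f z + shift_series c g z)"
  unfolding shift_series_def vshift_add distrib_left
  by (rule ext, rule suminf_add[symmetric])
    (rule summable_norm_cancel[OF summable_shift_series[OF c f]]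
      summable_norm_cancel[OF summable_shift_series[OF c g]])+

lemma shift_series_scale:
  assumes c: "summable (\<lambda>m. \<bar>c m\<bar>)" and f: "f \<in> bergman_space"
  shows "shift_series c (\<lambda>z. a * f z) = (\<lambda>z. a * shift_series c f z)"
  unfolding shift_series_def vshift_scale mult.left_commute[of _ a]
  by (rule ext, rule suminf_mult, rule summable_norm_cancel[OF summable_shift_series[OF c f]])

lemma vshift_shift_series:
  assumes "0 \<le> s"
  shows "vshift s (shift_series c f) = shift_series c (vshift s f)"
proof
  fix z
  show "vshift s (shift_series c f) z = shift_series c (vshift s f) z"
  proof (cases "z \<in> upper_hp")
    case True
    then have "z + of_real (2 * real m) * \<i> \<in> upper_hp" for m
      by (rule upper_hp_shift) simp
    moreover have "z + of_real s * \<i> \<in> upper_hp"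
      using True assms by (rule upper_hp_shift)
    ultimately show ?thesis
      using True by (simp only: vshift_def shift_series_def if_True add.assoc add.commute add.left_commute)
  qed (simp add: vshift_def shift_series_def)
qed

lemma inner_shift_series:
  assumes c: "summable (\<lambda>m. \<bar>c m\<bar>)" and f: "f \<in> bergman_space" and h: "h \<in> bergman_space"
  shows "(\<lambda>m. of_real (c m) * inner_L2 (vshift (2 * real m) f) h) sums inner_L2 (shift_series c f) h"
proof -
  note sf = bergman_sq_integrable[OF f] and sh = bergman_sq_integrable[OF h]
  note sv = vshift_sq_integrable[OF sf]
  let ?F = "\<lambda>m z. of_real (c m) * vshift (2 * real m) f z * cnj (h z)"
  have int: "integrable lborel (?F m)" for m
    using sq_integrable_product[OF sv sh] by (simp add: mult.assoc)
  have "(\<lambda>m. \<integral>z. ?F m z \<partial>lborel) sums (\<integral>z. (\<Sum>m. ?F m z) \<partial>lborel)"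
  proof (rule sums_integral[OF int])
    show "AE z in lborel. summable (\<lambda>m. norm (?F m z))"
      using summable_mult2[OF summable_shift_series[OF c f]] by (simp add: norm_mult)
    show "summable (\<lambda>m. \<integral>z. norm (?F m z) \<partial>lborel)"
    proof (rule summable_comparison_test')
      show "summable (\<lambda>m. \<bar>c m\<bar> * (((norm_L2 f)\<^sup>2 + (norm_L2 h)\<^sup>2) / 2))"
        by (rule summable_mult2[OF c])
      fix m :: nat
      have "(\<integral>z. norm (?F m z) \<partial>lborel)
          \<le> (\<integral>z. \<bar>c m\<bar> * (((cmod (vshift (2 * real m) f z))\<^sup>2 + (cmod (h z))\<^sup>2) / 2) \<partial>lborel)"
      proof (rule integral_mono)
        show "integrable lborel (\<lambda>z. norm (?F m z))" by (rule integrable_norm[OF int])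
        show "integrable lborel (\<lambda>z. \<bar>c m\<bar> * (((cmod (vshift (2 * real m) f z))\<^sup>2 + (cmod (h z))\<^sup>2) / 2))"
          using sq_integrable_square[OF sv] sq_integrable_square[OF sh] by simp
        show "norm (?F m z) \<le> \<bar>c m\<bar> * (((cmod (vshift (2 * real m) f z))\<^sup>2 + (cmod (h z))\<^sup>2) / 2)" for z
          using mult_left_mono[OF cmod_mult_le_squares[of "vshift (2 * real m) f z" "h z"], of "\<bar>c m\<bar>"]
          by (simp add: norm_mult mult.assoc)
      qed
      also have "\<dots> = \<bar>c m\<bar> * (((norm_L2 (vshift (2 * real m) f))\<^sup>2 + (norm_L2 h)\<^sup>2) / 2)"
        using sq_integrable_square[OF sv] sq_integrable_square[OF sh]
        by (simp add: integral_square_norm_L2 sv sh)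
      also have "\<dots> \<le> \<bar>c m\<bar> * (((norm_L2 f)\<^sup>2 + (norm_L2 h)\<^sup>2) / 2)"
        by (intro mult_left_mono divide_right_mono add_right_mono power_mono norm_vshift_le sf norm_L2_nonneg) auto
      finally show "norm (\<integral>z. norm (?F m z) \<partial>lborel) \<le> \<bar>c m\<bar> * (((norm_L2 f)\<^sup>2 + (norm_L2 h)\<^sup>2) / 2)"
        by simp
    qed
  qed
  moreover have "(\<integral>z. ?F m z \<partial>lborel) = of_real (c m) * inner_L2 (vshift (2 * real m) f) h" for m
    by (simp add: inner_L2_lborel sv mult.assoc)
  moreover have "(\<Sum>m. ?F m z) = shift_series c f z * cnj (h z)" for z
    unfolding shift_series_def
    by (rule suminf_mult2[symmetric, OF summable_norm_cancel[OF summable_shift_series[OF c f]]])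
  ultimately show ?thesis
    by (simp add: inner_L2_lborel bergman_sq_integrable[OF shift_series_bergman[OF c f]])
qed

lemma shift_series_selfadjoint:
  assumes c: "summable (\<lambda>m. \<bar>c m\<bar>)" and f: "f \<in> bergman_space" and h: "h \<in> bergman_space"
  shows "inner_L2 (shift_series c f) h = inner_L2 f (shift_series c h)"
proof -
  have "(\<lambda>m. cnj (of_real (c m) * inner_L2 (vshift (2 * real m) h) f)) sums cnj (inner_L2 (shift_series c h) f)"
    using inner_shift_series[OF c h f] by (simp only: sums_cnj)
  moreover have "cnj (of_real (c m) * inner_L2 (vshift (2 * real m) h) f)
      = of_real (c m) * inner_L2 (vshift (2 * real m) f) h" for m
  proof -
    have "inner_L2 (vshift (2 * real m) f) h = inner_L2 f (vshift (2 * real m) h)"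
      by (rule vshift_selfadjoint[OF f h]) simp
    also have "\<dots> = cnj (inner_L2 (vshift (2 * real m) h) f)"
      by (rule inner_L2_cnj)
    finally show ?thesis by simp
  qed
  ultimately have "(\<lambda>m. of_real (c m) * inner_L2 (vshift (2 * real m) f) h) sums inner_L2 f (shift_series c h)"
    by (simp only: inner_L2_cnj[of f "shift_series c h"])
  then show ?thesis
    using inner_shift_series[OF c f h] by (rule sums_unique2[rotated])
qed

text \<open>
  The double series is absolutely summable, and its terms are regrouped along \<open>s = m + l\<close>.
\<close>

lemma suminf_convolution:
  fixes c d :: "nat \<Rightarrow> real" and a :: "nat \<Rightarrow> complex"
  assumes c: "summable (\<lambda>m. \<bar>c m\<bar>)" and d: "summable (\<lambda>m. \<bar>d m\<bar>)"
    and a: "\<And>n. cmod (a n) \<le> B"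
  shows "(\<Sum>m. of_real (c m) * (\<Sum>l. of_real (d l) * a (m + l)))
    = (\<Sum>s. of_real (\<Sum>k\<le>s. c k * d (s - k)) * a s)"
proof -
  define F where "F = (\<lambda>m l. of_real (c m) * (of_real (d l) * a (m + l)))"
  have dsum: "(\<lambda>l. \<bar>d l\<bar>) summable_on UNIV" and csum: "(\<lambda>m. \<bar>c m\<bar>) summable_on UNIV"
    using c d by (simp_all add: summable_on_UNIV_nonneg_real_iff)
  have cd: "(\<lambda>p. norm (case p of (m, l) \<Rightarrow> \<bar>c m\<bar> * \<bar>d l\<bar>)) summable_on (UNIV \<times> UNIV)"
    unfolding Infinite_Sum.abs_summable_on_Sigma_iff
  proof (intro conjI ballI)
    show "(\<lambda>l. norm (case (m, l) of (m, l) \<Rightarrow> \<bar>c m\<bar> * \<bar>d l\<bar>)) summable_on UNIV" for m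
      using summable_on_cmult_right[OF dsum, of "\<bar>c m\<bar>"] by (simp add: abs_mult)
    have "(\<Sum>\<^sub>\<infinity>l. norm (case (m, l) of (m, l) \<Rightarrow> \<bar>c m\<bar> * \<bar>d l\<bar>)) = \<bar>c m\<bar> * (\<Sum>\<^sub>\<infinity>l. \<bar>d l\<bar>)" for m
      by (simp add: abs_mult infsum_cmult_right')
    then show "(\<lambda>m. norm (\<Sum>\<^sub>\<infinity>l. norm (case (m, l) of (m, l) \<Rightarrow> \<bar>c m\<bar> * \<bar>d l\<bar>))) summable_on UNIV"
      using summable_on_cmult_left[OF csum, of "\<bar>\<Sum>\<^sub>\<infinity>l. \<bar>d l\<bar>\<bar>"] by (simp add: abs_mult)
  qed
  have "(\<lambda>p. norm (case_prod F p)) summable_on (UNIV \<times> UNIV)"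
  proof (rule Infinite_Sum.abs_summable_on_comparison_test)
    show "(\<lambda>p. norm (B * (case p of (m, l) \<Rightarrow> \<bar>c m\<bar> * \<bar>d l\<bar>))) summable_on (UNIV \<times> UNIV)"
      using summable_on_cmult_right[OF cd, of "\<bar>B\<bar>"] unfolding norm_mult by simp
    fix p :: "nat \<times> nat"
    obtain m l where p: "p = (m, l)" by force
    have "norm (F m l) \<le> \<bar>c m\<bar> * (\<bar>d l\<bar> * B)"
      unfolding F_def norm_mult norm_of_real by (intro mult_left_mono a) auto
    moreover have "0 \<le> B" using a[of 0] norm_ge_zero order.trans by blast
    ultimately show "norm (case_prod F p) \<le> norm (B * (case p of (m, l) \<Rightarrow> \<bar>c m\<bar> * \<bar>d l\<bar>))"
      by (simp add: p abs_mult mult_ac)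
  qed
  then have F: "case_prod F summable_on (UNIV \<times> UNIV)"
    by (rule Infinite_Sum.abs_summable_summable)
  have row: "F m summable_on UNIV" for m
    using summable_on_SigmaD1[of F UNIV "\<lambda>_. UNIV", OF F] by simp
  have inner: "(\<Sum>\<^sub>\<infinity>l. F m l) = of_real (c m) * (\<Sum>l. of_real (d l) * a (m + l))" for m
  proof -
    have "summable (\<lambda>l. of_real (d l) * a (m + l))"
    proof (rule summable_comparison_test')
      show "summable (\<lambda>l. \<bar>d l\<bar> * B)" by (rule summable_mult2[OF d])
      show "norm (of_real (d l) * a (m + l)) \<le> \<bar>d l\<bar> * B" for l
        unfolding norm_mult norm_of_real by (intro mult_left_mono a) auto
    qed
    then have "(\<Sum>l. F m l) = of_real (c m) * (\<Sum>l. of_real (d l) * a (m + l))"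
      unfolding F_def by (rule suminf_mult)
    then show ?thesis
      using has_sum_imp_sums[OF has_sum_infsum[OF row[of m]]] by (simp add: sums_iff)
  qed
  define G where "G = (\<lambda>s k. F k (s - k))"
  have G: "case_prod G summable_on (SIGMA s:UNIV. {..s})"
    and FG: "infsum (case_prod F) (UNIV \<times> UNIV) = infsum (case_prod G) (SIGMA s:UNIV. {..s})"
  proof -
    have *: "case_prod F summable_on (UNIV \<times> UNIV) \<longleftrightarrow> case_prod G summable_on (SIGMA s:UNIV. {..s})"
      by (rule summable_on_reindex_bij_witness[of _ "\<lambda>(s, k). (k, s - k)" "\<lambda>(m, l). (m + l, m)"])
        (auto simp: G_def)
    show "case_prod G summable_on (SIGMA s:UNIV. {..s})" using * F by simp
    show "infsum (case_prod F) (UNIV \<times> UNIV) = infsum (case_prod G) (SIGMA s:UNIV. {..s})"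
      by (rule infsum_reindex_bij_witness[of _ "\<lambda>(s, k). (k, s - k)" "\<lambda>(m, l). (m + l, m)"])
        (auto simp: G_def)
  qed
  have Gs: "(\<Sum>\<^sub>\<infinity>k\<in>{..s}. G s k) = of_real (\<Sum>k\<le>s. c k * d (s - k)) * a s" for s
    by (simp add: G_def F_def sum_distrib_right mult.assoc)
  have "(\<Sum>m. of_real (c m) * (\<Sum>l. of_real (d l) * a (m + l))) = (\<Sum>\<^sub>\<infinity>m. \<Sum>\<^sub>\<infinity>l. F m l)"
    using has_sum_imp_sums[OF has_sum_infsum[OF summable_on_Sigma_banach[OF F]]]
    by (simp add: inner sums_iff)
  also have "\<dots> = (\<Sum>\<^sub>\<infinity>s. \<Sum>\<^sub>\<infinity>k\<in>{..s}. G s k)"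
    by (simp only: infsum_Sigma'_banach[OF F] infsum_Sigma'_banach[OF G] FG)
  also have "\<dots> = (\<Sum>s. of_real (\<Sum>k\<le>s. c k * d (s - k)) * a s)"
    using has_sum_imp_sums[OF has_sum_infsum[OF summable_on_Sigma_banach[OF G]]]
    by (simp only: Gs sums_iff)
  finally show ?thesis .
qed

lemma shift_series_compose:
  assumes c: "summable (\<lambda>m. \<bar>c m\<bar>)" and d: "summable (\<lambda>m. \<bar>d m\<bar>)" and f: "f \<in> bergman_space"
  shows "shift_series c (shift_series d f) = shift_series (\<lambda>s. \<Sum>k\<le>s. c k * d (s - k)) f"
proof
  fix z
  show "shift_series c (shift_series d f) z = shift_series (\<lambda>s. \<Sum>k\<le>s. c k * d (s - k)) f z"
  proof (cases "z \<in> upper_hp")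
    case True
    have "vshift (2 * real m) (shift_series d f) z = (\<Sum>l. of_real (d l) * vshift (2 * real (m + l)) f z)" for m
      unfolding vshift_shift_series[of "2 * real m", OF mult_nonneg_nonneg[OF zero_le_numeral of_nat_0_le_iff]]
      by (simp add: shift_series_def vshift_vshift distrib_left add.commute)
    then have "shift_series c (shift_series d f) z
        = (\<Sum>m. of_real (c m) * (\<Sum>l. of_real (d l) * vshift (2 * real (m + l)) f z))"
      by (simp add: shift_series_def[of c])
    also have "\<dots> = shift_series (\<lambda>s. \<Sum>k\<le>s. c k * d (s - k)) f z"
      unfolding shift_series_def
      by (rule suminf_convolution[OF c d, of "\<lambda>n. vshift (2 * real n) f z"])
        (rule cmod_vshift_le[OF f True], simp)
    finally show ?thesis .
  qed (simp add: shift_series_def vshift_def)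
qed

section \<open>The binomial series of the square root\<close>

definition sqrt_coeff :: "nat \<Rightarrow> real" where
  "sqrt_coeff m = (-1) ^ m * ((1/2) gchoose m)"

lemma sqrt_coeff_0 [simp]: "sqrt_coeff 0 = 1"
  by (simp add: sqrt_coeff_def)

lemma sqrt_coeff_Suc: "sqrt_coeff (Suc m) = sqrt_coeff m * (real m - 1/2) / (real m + 1)"
proof -
  have "(1/2) * ((1/2 :: real) gchoose m) = real m * ((1/2) gchoose m) + real (Suc m) * ((1/2) gchoose Suc m)"
    by (rule gbinomial_mult_1)
  then have "((1/2 :: real) gchoose Suc m) = (1/2 - real m) * ((1/2) gchoose m) / (real m + 1)"
    by (simp add: field_simps)
  then have "sqrt_coeff (Suc m) = - ((-1) ^ m * ((1/2 - real m) * ((1/2) gchoose m) / (real m + 1)))"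
    by (simp only: sqrt_coeff_def power_Suc)
  then show ?thesis by (simp add: sqrt_coeff_def field_simps)
qed

lemma sqrt_coeff_nonpos: "m > 0 \<Longrightarrow> sqrt_coeff m \<le> 0"
proof (induction m rule: nat_induct_non_zero)
  case 1
  then show ?case using sqrt_coeff_Suc[of 0] by simp
next
  case (Suc m)
  then have "0 \<le> real m - 1/2" by linarith
  then show ?case
    using Suc unfolding sqrt_coeff_Suc
    by (intro divide_nonpos_nonneg mult_nonpos_nonneg) auto
qed

text \<open>
  The partial sums are the coefficients of \<open>\<surd>(1 - x) / (1 - x)\<close>. The closed form shows that
  they are nonnegative.
\<close>

lemma sum_sqrt_coeff: "(\<Sum>k\<le>m. sqrt_coeff k) = - 2 * (real m + 1) * sqrt_coeff (Suc m)"
proof (induction m)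
  case 0
  then show ?case using sqrt_coeff_Suc[of 0] by simp
next
  case (Suc m)
  have "- 2 * (real (Suc m) + 1) * sqrt_coeff (Suc (Suc m)) = - 2 * sqrt_coeff (Suc m) * (real (Suc m) - 1/2)"
  proof -
    have "- 2 * q * (x * y / q) = - 2 * x * y" if "q \<noteq> 0" for q x y :: real
      using that by simp
    moreover have "real (Suc m) + 1 \<noteq> 0" by simp
    ultimately show ?thesis unfolding sqrt_coeff_Suc[of "Suc m"] by blast
  qed
  then show ?case using Suc by (simp add: algebra_simps)
qed

lemma sum_sqrt_coeff_nonneg: "0 \<le> (\<Sum>k<m. sqrt_coeff k)"
proof (cases m)
  case (Suc n)
  then have "(\<Sum>k<m. sqrt_coeff k) = - 2 * (real n + 1) * sqrt_coeff (Suc n)"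
    by (simp add: lessThan_Suc_atMost sum_sqrt_coeff)
  then show ?thesis
    using sqrt_coeff_nonpos[of "Suc n"] by (auto intro!: mult_nonpos_nonpos)
qed simp

text \<open>
  Only the term \<open>m = 0\<close> is positive, so the sum of the absolute values is \<open>2\<close> minus a partial sum
  of the coefficients, and hence at most \<open>2\<close>.
\<close>

lemma summable_sqrt_coeff: "summable (\<lambda>m. \<bar>sqrt_coeff m\<bar>)"
proof (rule summableI_nonneg_bounded)
  show "(\<Sum>k<m. \<bar>sqrt_coeff k\<bar>) \<le> 2" for m
  proof -
    have "\<bar>sqrt_coeff k\<bar> = (if k = 0 then 2 else 0) - sqrt_coeff k" for k
      using sqrt_coeff_nonpos[of k] by auto
    then have "(\<Sum>k<m. \<bar>sqrt_coeff k\<bar>) = (\<Sum>k<m. if k = 0 then 2 else 0) - (\<Sum>k<m. sqrt_coeff k)"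
      by (simp add: sum_subtractf)
    also have "\<dots> \<le> 2 - 0"
      by (intro diff_mono sum_sqrt_coeff_nonneg) (simp add: sum.delta)
    finally show ?thesis by simp
  qed
qed simp

text \<open>
  Vandermonde's identity in place of \<open>\<surd>(1 - x) \<surd>(1 - x) = 1 - x\<close>.
\<close>

lemma sqrt_coeff_convolution:
  "(\<Sum>k\<le>s. sqrt_coeff k * sqrt_coeff (s - k)) = (if s = 0 then 1 else if s = 1 then -1 else 0)"
proof -
  have "(\<Sum>k\<le>s. sqrt_coeff k * sqrt_coeff (s - k))
      = (\<Sum>k\<le>s. (-1) ^ s * (((1/2) gchoose k) * ((1/2) gchoose (s - k))))"
  proof (intro sum.cong refl)
    fix k assume "k \<in> {..s}"
    then have "(-1 :: real) ^ s = (-1) ^ k * (-1) ^ (s - k)"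
      by (simp flip: power_add)
    then show "sqrt_coeff k * sqrt_coeff (s - k) = (-1) ^ s * (((1/2) gchoose k) * ((1/2) gchoose (s - k)))"
      by (simp add: sqrt_coeff_def)
  qed
  also have "\<dots> = (-1) ^ s * ((1/2 + 1/2) gchoose s)"
    by (simp only: sum_distrib_left[symmetric] gbinomial_Vandermonde[symmetric] atMost_atLeast0)
  also have "(1/2 + 1/2 :: real) gchoose s = of_nat (1 choose s)"
    by (simp add: binomial_gbinomial)
  finally show ?thesis
    by (cases s) auto
qed

abbreviation root_series :: "(complex \<Rightarrow> complex) \<Rightarrow> (complex \<Rightarrow> complex)" where
  "root_series \<equiv> shift_series sqrt_coeff"

lemma root_series_root_series:
  assumes f: "f \<in> bergman_space"
  shows "root_series (root_series f) = (\<lambda>z. f z - vshift 2 f z)"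
proof
  fix z
  have "root_series (root_series f) z
      = (\<Sum>s. of_real (if s = 0 then 1 else if s = 1 then -1 else 0) * vshift (2 * real s) f z)"
    unfolding shift_series_compose[OF summable_sqrt_coeff summable_sqrt_coeff f] sqrt_coeff_convolution
    by (simp add: shift_series_def)
  also have "\<dots> = (\<Sum>s\<in>{0, 1}. of_real (if s = 0 then 1 else if s = 1 then -1 else 0) * vshift (2 * real s) f z)"
    by (rule suminf_finite) auto
  also have "\<dots> = f z - vshift 2 f z"
    by (simp add: vshift_0[OF f])
  finally show "root_series (root_series f) z = f z - vshift 2 f z" .
qed

text \<open>
  With \<open>x\<^sub>m = \<langle>V\<^bsub>2m\<^esub> f, f\<rangle>\<close> we have \<open>x\<^sub>m \<le> x\<^sub>0\<close>, and \<open>c\<^sub>m \<le> 0\<close> for \<open>m > 0\<close>, so that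
  \<open>\<Sum> c\<^sub>m x\<^sub>m \<ge> x\<^sub>0 \<Sum> c\<^sub>m \<ge> 0\<close> for all partial sums.
\<close>

lemma inner_root_series_nonneg:
  assumes f: "f \<in> bergman_space"
  shows "inner_L2 (root_series f) f \<in> \<real>" "0 \<le> Re (inner_L2 (root_series f) f)"
proof -
  define x where "x m = Re (inner_L2 (vshift (2 * real m) f) f)" for m
  have x: "inner_L2 (vshift (2 * real m) f) f = of_real (x m)" "0 \<le> x m" "x m \<le> x 0" for m
    using inner_vshift_bounds[OF f, of "2 * real m"]
    by (simp_all add: x_def vshift_0[OF f] inner_L2_self)
  have "(\<lambda>m. of_real (sqrt_coeff m * x m)) sums inner_L2 (root_series f) f"
    using inner_shift_series[OF summable_sqrt_coeff f f] by (simp add: x)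
  then have s: "(\<lambda>m. complex_of_real (sqrt_coeff m * x m)) sums inner_L2 (root_series f) f" .
  have "(\<lambda>m. 0) sums Im (inner_L2 (root_series f) f)"
    using sums_Im[OF s] by simp
  then show "inner_L2 (root_series f) f \<in> \<real>"
    by (metis complex_is_Real_iff sums_0 sums_unique2)
  have "(\<lambda>m. sqrt_coeff m * x m) sums Re (inner_L2 (root_series f) f)"
    using sums_Re[OF s] by simp
  then show "0 \<le> Re (inner_L2 (root_series f) f)"
    unfolding sums_def
  proof (rule LIMSEQ_le_const, intro exI allI impI)
    fix N :: nat
    have "0 \<le> (\<Sum>m<N. sqrt_coeff m) * x 0"
      by (intro mult_nonneg_nonneg sum_sqrt_coeff_nonneg x)
    also have "\<dots> \<le> (\<Sum>m<N. sqrt_coeff m * x m)"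
      unfolding sum_distrib_right
    proof (rule sum_mono)
      fix m
      show "sqrt_coeff m * x 0 \<le> sqrt_coeff m * x m"
        using sqrt_coeff_nonpos[of m] x(3)[of m] by (cases "m = 0") (auto intro: mult_left_mono_neg)
    qed
    finally show "0 \<le> (\<Sum>m<N. sqrt_coeff m * x m)" .
  qed
qed

section \<open>Uniqueness of positive square roots\<close>

context
  fixes S :: "(complex \<Rightarrow> complex) \<Rightarrow> complex \<Rightarrow> complex"
  assumes S: "bounded_operator S"
begin

lemma bounded_operator_in: "f \<in> bergman_space \<Longrightarrow> S f \<in> bergman_space"
  using S by (auto simp: bounded_operator_def)

lemma bounded_operator_add:
  "f \<in> bergman_space \<Longrightarrow> g \<in> bergman_space \<Longrightarrow> S (\<lambda>z. f z + g z) = (\<lambda>z. S f z + S g z)"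
  using S by (simp add: bounded_operator_def)

lemma bounded_operator_scale:
  "f \<in> bergman_space \<Longrightarrow> S (\<lambda>z. c * f z) = (\<lambda>z. c * S f z)"
  using S by (simp add: bounded_operator_def)

lemma bounded_operator_diff:
  assumes "f \<in> bergman_space" "g \<in> bergman_space"
  shows "S (\<lambda>z. f z - g z) = (\<lambda>z. S f z - S g z)"
  using bounded_operator_add[OF assms(1) bergman_scale[OF assms(2)], of "-1"]
    bounded_operator_scale[OF assms(2), of "-1"] by simp

lemma bounded_operator_bound:
  "\<exists>C\<ge>0. \<forall>f\<in>bergman_space. norm_L2 (S f) \<le> C * norm_L2 f"
proof -
  from S have "\<exists>C. \<forall>f\<in>bergman_space. norm_L2 (S f) \<le> C * norm_L2 f"
    by (simp add: bounded_operator_def)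
  then obtain C where C: "\<forall>f\<in>bergman_space. norm_L2 (S f) \<le> C * norm_L2 f" ..
  have "norm_L2 (S f) \<le> max 0 C * norm_L2 f" if "f \<in> bergman_space" for f
    using bspec[OF C that] mult_right_mono[of C "max 0 C" "norm_L2 f"] norm_L2_nonneg[of f] by linarith
  then show ?thesis by (intro exI[of _ "max 0 C"]) simp
qed

end

lemma positive_operator_bounded: "positive_operator S \<Longrightarrow> bounded_operator S"
  by (simp add: positive_operator_def)

text \<open>
  Polarisation: the form is real at \<open>f + g\<close> and at \<open>f + i g\<close>.
\<close>

lemma positive_operator_symmetric:
  assumes S: "positive_operator S" and f: "f \<in> bergman_space" and g: "g \<in> bergman_space"
  shows "inner_L2 (S f) g = inner_L2 f (S g)"
proof -
  note b = positive_operator_bounded[OF S]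
  note sq = bergman_sq_integrable
  note Sin = bounded_operator_in[OF b]
  have re: "Im (inner_L2 (S h) h) = 0" if "h \<in> bergman_space" for h
    using S that by (auto simp: positive_operator_def complex_is_Real_iff)
  have form: "Im (inner_L2 (S f) (\<lambda>z. c * g z) + inner_L2 (S (\<lambda>z. c * g z)) f) = 0" for c
  proof -
    have cg: "(\<lambda>z. c * g z) \<in> bergman_space" by (rule bergman_scale[OF g])
    have "inner_L2 (S (\<lambda>z. f z + c * g z)) (\<lambda>z. f z + c * g z)
        = inner_L2 (S f) f + inner_L2 (S f) (\<lambda>z. c * g z)
          + (inner_L2 (S (\<lambda>z. c * g z)) f + inner_L2 (S (\<lambda>z. c * g z)) (\<lambda>z. c * g z))"
      using f cg by (simp add: bounded_operator_add[OF b] inner_L2_add_left inner_L2_add_right sq Sin bergman_add sq_integrable_add)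
    then show ?thesis
      using re[OF f] re[OF cg] re[OF bergman_add[OF f cg]] by simp
  qed
  have "Im (inner_L2 (S f) g) + Im (inner_L2 (S g) f) = 0"
    using form[of 1] by simp
  moreover have "Re (inner_L2 (S g) f) - Re (inner_L2 (S f) g) = 0"
    using form[of \<i>] g by (simp add: bounded_operator_scale[OF b] inner_L2_scale_left inner_L2_scale_right sq Sin)
  ultimately have "inner_L2 (S f) g = cnj (inner_L2 (S g) f)"
    by (simp add: complex_eq_iff)
  then show ?thesis by (simp add: inner_L2_cnj[of f])
qed

lemma norm_L2_square_add:
  assumes "f \<in> sq_integrable" "g \<in> sq_integrable"
  shows "(norm_L2 (\<lambda>z. f z + of_real t * g z))\<^sup>2
    = (norm_L2 f)\<^sup>2 + 2 * t * Re (inner_L2 f g) + t\<^sup>2 * (norm_L2 g)\<^sup>2"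
proof -
  have "complex_of_real ((norm_L2 (\<lambda>z. f z + of_real t * g z))\<^sup>2)
      = inner_L2 f f + of_real t * (inner_L2 f g + cnj (inner_L2 f g)) + (of_real t)\<^sup>2 * inner_L2 g g"
    unfolding inner_L2_self[symmetric] using assms
    by (simp add: inner_L2_add_left inner_L2_add_right sq_integrable_add
        sq_integrable_scale inner_L2_scale_left inner_L2_scale_right inner_L2_cnj[of g f]
        power2_eq_square algebra_simps)
  also have "\<dots> = complex_of_real ((norm_L2 f)\<^sup>2 + 2 * t * Re (inner_L2 f g) + t\<^sup>2 * (norm_L2 g)\<^sup>2)"
    by (simp add: inner_L2_self complex_add_cnj)
  finally show ?thesis by (simp only: of_real_eq_iff)
qed

text \<open>
  The norm of a symmetric operator is the supremum of its quadratic form. Polarisation with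
  \<open>g = t D f\<close> and the parallelogram law give \<open>2 t \<parallel>D f\<parallel>\<^sup>2 \<le> M (\<parallel>f\<parallel>\<^sup>2 + t\<^sup>2 \<parallel>D f\<parallel>\<^sup>2)\<close>, and the best
  choice is \<open>t = \<parallel>f\<parallel> / \<parallel>D f\<parallel>\<close>.
\<close>

lemma symmetric_operator_norm_bound:
  assumes Dl: "\<And>f g t. f \<in> bergman_space \<Longrightarrow> g \<in> bergman_space \<Longrightarrow>
      D (\<lambda>z. f z + of_real t * g z) = (\<lambda>z. D f z + of_real t * D g z)"
    and Din: "\<And>f. f \<in> bergman_space \<Longrightarrow> D f \<in> bergman_space"
    and sym: "\<And>f g. f \<in> bergman_space \<Longrightarrow> g \<in> bergman_space \<Longrightarrow> inner_L2 (D f) g = inner_L2 f (D g)"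
    and M: "\<And>f. f \<in> bergman_space \<Longrightarrow> \<bar>Re (inner_L2 (D f) f)\<bar> \<le> M * (norm_L2 f)\<^sup>2"
    and f: "f \<in> bergman_space" and M0: "0 \<le> M"
  shows "norm_L2 (D f) \<le> M * norm_L2 f"
proof -
  note sq = bergman_sq_integrable
  let ?d = "norm_L2 (D f)" and ?n = "norm_L2 f"
  have Q: "Re (inner_L2 (D (\<lambda>z. f z + of_real t * D f z)) (\<lambda>z. f z + of_real t * D f z))
      = Re (inner_L2 (D f) f) + 2 * t * ?d\<^sup>2 + t\<^sup>2 * Re (inner_L2 (D (D f)) (D f))" for t
  proof -
    have "inner_L2 (D (\<lambda>z. f z + of_real t * D f z)) (\<lambda>z. f z + of_real t * D f z)
        = inner_L2 (D f) f + of_real t * inner_L2 (D f) (D f)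
          + of_real t * inner_L2 (D (D f)) f + (of_real t)\<^sup>2 * inner_L2 (D (D f)) (D f)"
      using f by (simp add: Dl Din sq inner_L2_add_left inner_L2_add_right sq_integrable_add
          sq_integrable_scale inner_L2_scale_left inner_L2_scale_right power2_eq_square algebra_simps)
    also have "inner_L2 (D (D f)) f = inner_L2 (D f) (D f)"
      by (rule sym[OF Din[OF f] f])
    finally show ?thesis by (simp add: inner_L2_self power2_eq_square algebra_simps flip: of_real_power)
  qed
  have main: "2 * t * ?d\<^sup>2 \<le> M * (?n\<^sup>2 + t\<^sup>2 * ?d\<^sup>2)" for t
  proof -
    have g: "(\<lambda>z. f z + of_real s * D f z) \<in> bergman_space" for s
      by (intro bergman_add bergman_scale f Din)
    have "4 * t * ?d\<^sup>2 = Re (inner_L2 (D (\<lambda>z. f z + of_real t * D f z)) (\<lambda>z. f z + of_real t * D f z))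
        - Re (inner_L2 (D (\<lambda>z. f z + of_real (-t) * D f z)) (\<lambda>z. f z + of_real (-t) * D f z))"
      unfolding Q by (simp add: algebra_simps)
    also have "\<dots> \<le> M * (norm_L2 (\<lambda>z. f z + of_real t * D f z))\<^sup>2 + M * (norm_L2 (\<lambda>z. f z + of_real (-t) * D f z))\<^sup>2"
      using M[OF g, of t] M[OF g, of "-t"] by linarith
    also have "\<dots> = 2 * (M * (?n\<^sup>2 + t\<^sup>2 * ?d\<^sup>2))"
      unfolding norm_L2_square_add[OF sq[OF f] sq[OF Din[OF f]]] by (simp add: algebra_simps)
    finally show ?thesis by simp
  qed
  show ?thesis
  proof (cases "?d = 0")
    case True
    then show ?thesis using M0 norm_L2_nonneg[of f] by simp
  next
    case False
    then have d: "?d > 0" using norm_L2_nonneg[of "D f"] by linarith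
    show ?thesis
    proof (cases "?n = 0")
      case True
      \<comment> \<open>Any \<open>t\<close> with \<open>0 < t < 2 / M\<close> would give the contradiction; this one also covers \<open>M = 0\<close>.\<close>
      have "2 * (1 / (M + 1)) * ?d\<^sup>2 \<le> M * (1 / (M + 1))\<^sup>2 * ?d\<^sup>2"
        using main[of "1 / (M + 1)"] True by simp
      then have "2 * (1 / (M + 1)) \<le> M * (1 / (M + 1))\<^sup>2"
        by (rule mult_right_le_imp_le) (use d in simp)
      then have "2 * (M + 1) \<le> M"
        using M0 by (simp add: power2_eq_square divide_simps)
      then show ?thesis using M0 by simp
    next
      case False
      then have n: "?n > 0" using norm_L2_nonneg[of f] by linarith
      have "2 * (?n / ?d) * ?d\<^sup>2 \<le> M * (?n\<^sup>2 + (?n / ?d)\<^sup>2 * ?d\<^sup>2)"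
        by (rule main)
      also have "(?n / ?d)\<^sup>2 * ?d\<^sup>2 = ?n\<^sup>2" using d by (simp add: power_divide)
      also have "2 * (?n / ?d) * ?d\<^sup>2 = 2 * ?n * ?d" using d by (simp add: power2_eq_square)
      finally have "?n * ?d \<le> ?n * (M * ?n)" by (simp add: power2_eq_square algebra_simps)
      then show ?thesis using n by simp
    qed
  qed
qed

text \<open>
  Let \<open>D = S - B\<close>. From \<open>S\<^sup>2 = B\<^sup>2\<close> follows \<open>S D + D B = 0\<close>. Let \<open>M\<close> be the supremum of \<open>\<bar>\<langle>D f, f\<rangle>\<bar>\<close> over the unit ball, which is
  the norm of \<open>D\<close>. If \<open>f\<close> nearly attains \<open>M\<close>, then \<open>D f\<close> is nearly \<open>l f\<close> with \<open>l = M\<close> or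
  \<open>l = - M\<close>, and \<open>0 = \<langle>(S D + D B) f, f\<rangle>\<close> is nearly \<open>l (\<langle>S f, f\<rangle> + \<langle>B f, f\<rangle>)\<close>. Both summands are
  nonnegative and their difference is \<open>\<langle>D f, f\<rangle>\<close>, of modulus nearly \<open>M\<close>. Hence \<open>M\<^sup>2\<close> is arbitrarily
  small, so \<open>M = 0\<close> and \<open>D = 0\<close>.
\<close>

theorem positive_square_root_unique:
  assumes S: "positive_operator S" and B: "positive_operator B"
    and SB: "\<And>f. f \<in> bergman_space \<Longrightarrow> S (S f) = B (B f)"
  shows "S = B"
proof -
  note sq = bergman_sq_integrable
  note bS = positive_operator_bounded[OF S] and bB = positive_operator_bounded[OF B]
  note Sin = bounded_operator_in[OF bS] and Bin = bounded_operator_in[OF bB]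
  define D where "D f = (\<lambda>z. S f z - B f z)" for f
  have Din: "D f \<in> bergman_space" if "f \<in> bergman_space" for f
    unfolding D_def by (intro bergman_diff Sin Bin that)
  have Dl: "D (\<lambda>z. f z + of_real t * g z) = (\<lambda>z. D f z + of_real t * D g z)"
    if "f \<in> bergman_space" "g \<in> bergman_space" for f g t
    using that by (simp add: D_def bounded_operator_add[OF bS] bounded_operator_add[OF bB] bergman_scale
        bounded_operator_scale[OF bS] bounded_operator_scale[OF bB] algebra_simps)
  have sym: "inner_L2 (D f) g = inner_L2 f (D g)" if "f \<in> bergman_space" "g \<in> bergman_space" for f g
    using that unfolding D_def
    by (simp add: inner_L2_diff_left inner_L2_diff_right sq Sin Bin
        positive_operator_symmetric[OF S] positive_operator_symmetric[OF B])
  have Dform: "Re (inner_L2 (D f) f) = Re (inner_L2 (S f) f) - Re (inner_L2 (B f) f)"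
    if "f \<in> bergman_space" for f
    using that unfolding D_def by (simp add: inner_L2_diff_left sq Sin Bin)
  have pos: "0 \<le> Re (inner_L2 (S f) f)" "0 \<le> Re (inner_L2 (B f) f)" if "f \<in> bergman_space" for f
    using that S B by (auto simp: positive_operator_def)
  obtain CS where CS: "CS \<ge> 0" "\<And>f. f \<in> bergman_space \<Longrightarrow> norm_L2 (S f) \<le> CS * norm_L2 f"
    using bounded_operator_bound[OF bS] by blast
  obtain CB where CB: "CB \<ge> 0" "\<And>f. f \<in> bergman_space \<Longrightarrow> norm_L2 (B f) \<le> CB * norm_L2 f"
    using bounded_operator_bound[OF bB] by blast
  define C where "C = CS + CB"
  have C: "C \<ge> 0" "norm_L2 (S f) + norm_L2 (B f) \<le> C" if "f \<in> bergman_space" "norm_L2 f \<le> 1" for f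
  proof -
    have "CS * norm_L2 f \<le> CS * 1" "CB * norm_L2 f \<le> CB * 1"
      by (intro mult_left_mono CS CB that)+
    then show "C \<ge> 0" "norm_L2 (S f) + norm_L2 (B f) \<le> C"
      using CS CS(2)[OF that(1)] CB CB(2)[OF that(1)] by (auto simp: C_def)
  qed
  have upper: "\<bar>Re (inner_L2 (D f) f)\<bar> \<le> C" if f: "f \<in> bergman_space" "norm_L2 f \<le> 1" for f
  proof -
    have "Re (inner_L2 (S f) f) \<le> norm_L2 (S f) * norm_L2 f"
      using cmod_inner_L2_le[OF sq[OF Sin[OF f(1)]] sq[OF f(1)]] complex_Re_le_cmod[of "inner_L2 (S f) f"] by linarith
    moreover have "Re (inner_L2 (B f) f) \<le> norm_L2 (B f) * norm_L2 f"
      using cmod_inner_L2_le[OF sq[OF Bin[OF f(1)]] sq[OF f(1)]] complex_Re_le_cmod[of "inner_L2 (B f) f"] by linarith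
    moreover have "norm_L2 (S f) * norm_L2 f \<le> norm_L2 (S f) * 1" "norm_L2 (B f) * norm_L2 f \<le> norm_L2 (B f) * 1"
      by (intro mult_left_mono f norm_L2_nonneg)+
    ultimately show ?thesis
      using pos[OF f(1)] C[OF f] Dform[OF f(1)] norm_L2_nonneg[of "S f"] norm_L2_nonneg[of "B f"] by linarith
  qed
  define Q where "Q = (\<lambda>f. \<bar>Re (inner_L2 (D f) f)\<bar>) ` {f \<in> bergman_space. norm_L2 f \<le> 1}"
  define M where "M = Sup Q"
  have bdd: "bdd_above Q" using upper by (auto simp: Q_def intro!: bdd_aboveI2)
  have zero_in: "(\<lambda>z. 0) \<in> {f \<in> bergman_space. norm_L2 f \<le> 1}"
    by (simp add: bergman_zero norm_L2_def set_lebesgue_integral_def)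
  then have Qne: "Q \<noteq> {}" by (auto simp: Q_def)
  have le_M: "\<bar>Re (inner_L2 (D f) f)\<bar> \<le> M" if "f \<in> bergman_space" "norm_L2 f \<le> 1" for f
    unfolding M_def by (rule cSup_upper[OF _ bdd]) (use that in \<open>auto simp: Q_def\<close>)
  have M0: "0 \<le> M" using le_M[of "\<lambda>z. 0"] zero_in by fastforce
  have Mq: "\<bar>Re (inner_L2 (D f) f)\<bar> \<le> M * (norm_L2 f)\<^sup>2" if f: "f \<in> bergman_space" for f
  proof (cases "norm_L2 f = 0")
    case True
    then have "cmod (inner_L2 (D f) f) \<le> 0"
      using cmod_inner_L2_le[OF sq[OF Din[OF f]] sq[OF f]] by simp
    then show ?thesis using True by simp
  next
    case False
    then have n: "norm_L2 f > 0" using norm_L2_nonneg[of f] by linarith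
    define t where "t = 1 / norm_L2 f"
    define g where "g = (\<lambda>z. 0 + of_real t * f z)"
    have g: "g \<in> bergman_space" unfolding g_def by (intro bergman_add bergman_zero bergman_scale f)
    have "(norm_L2 g)\<^sup>2 = 1"
      unfolding g_def norm_L2_square_add[OF sq[OF bergman_zero] sq[OF f]]
      using n by (simp add: t_def power_divide norm_L2_def[of "\<lambda>z. 0"] set_lebesgue_integral_def)
    then have "norm_L2 g \<le> 1" using norm_L2_nonneg[of g] by (simp add: power2_eq_1_iff)
    from le_M[OF g this] have "\<bar>Re (inner_L2 (D g) g)\<bar> \<le> M" .
    moreover have "inner_L2 (D g) g = of_real (t * t) * inner_L2 (D f) f"
    proof -
      have "D (\<lambda>z. 0) = (\<lambda>z. 0)"
        using bounded_operator_scale[OF bS bergman_zero, of 0] bounded_operator_scale[OF bB bergman_zero, of 0]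
        by (simp add: D_def)
      then have "D g = (\<lambda>z. of_real t * D f z)"
        unfolding g_def Dl[OF bergman_zero f] by simp
      then show ?thesis
        by (simp add: g_def inner_L2_scale_left inner_L2_scale_right sq Din f)
    qed
    ultimately have "t * t * \<bar>Re (inner_L2 (D f) f)\<bar> \<le> M" by (simp add: abs_mult)
    then show ?thesis using n by (simp add: t_def field_simps power2_eq_square)
  qed
  have Dnorm: "norm_L2 (D f) \<le> M * norm_L2 f" if "f \<in> bergman_space" for f
    by (rule symmetric_operator_norm_bound[OF Dl Din sym Mq that M0])
  have "M = 0"
  proof (rule ccontr)
    assume "M \<noteq> 0"
    then have Mp: "M > 0" using M0 by simp
    \<comment> \<open>Small enough for \<open>\<parallel>E\<parallel> C < M\<^sup>2 / 2\<close>, given the bound \<open>\<parallel>E\<parallel>\<^sup>2 \<le> 2 M e\<close> proved below.\<close>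
    define e where "e = min (M / 2) (M ^ 3 / (16 * (C\<^sup>2 + 1)))"
    have C1: "C\<^sup>2 + 1 > 0" by (intro add_nonneg_pos) auto
    have "e > 0" using Mp C1 by (simp add: e_def)
    moreover have "e \<le> M / 2" "e \<le> M ^ 3 / (16 * (C\<^sup>2 + 1))"
      unfolding e_def by (rule min.cobounded1 min.cobounded2)+
    ultimately have e: "e > 0" "e \<le> M / 2" "e \<le> M ^ 3 / (16 * (C\<^sup>2 + 1))" .
    have "M - e < Sup Q" using e by (simp add: M_def)
    then obtain q where "q \<in> Q" "M - e < q"
      using less_cSup_iff[OF Qne bdd] by blast
    then obtain f where f: "f \<in> bergman_space" "norm_L2 f \<le> 1" and fe: "M - e < \<bar>Re (inner_L2 (D f) f)\<bar>"
      by (auto simp: Q_def)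
    define l where "l = (if Re (inner_L2 (D f) f) \<ge> 0 then M else - M)"
    have l: "l * Re (inner_L2 (D f) f) = M * \<bar>Re (inner_L2 (D f) f)\<bar>" "l\<^sup>2 = M\<^sup>2" "\<bar>l\<bar> = M"
      using Mp by (auto simp: l_def)
    define E where "E = (\<lambda>z. D f z + of_real (- l) * f z)"
    have E: "E \<in> bergman_space" unfolding E_def by (intro bergman_add bergman_scale Din f)
    have n1: "(norm_L2 f)\<^sup>2 \<le> 1" using f norm_L2_nonneg[of f] by (simp add: power_le_one)
    have "(norm_L2 E)\<^sup>2 = (norm_L2 (D f))\<^sup>2 - 2 * (M * \<bar>Re (inner_L2 (D f) f)\<bar>) + M\<^sup>2 * (norm_L2 f)\<^sup>2"
      unfolding E_def norm_L2_square_add[OF sq[OF Din[OF f(1)]] sq[OF f(1)]] using l by simp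
    also have "\<dots> \<le> M\<^sup>2 * 1 - 2 * (M * (M - e)) + M\<^sup>2 * 1"
    proof -
      have "(norm_L2 (D f))\<^sup>2 \<le> (M * norm_L2 f)\<^sup>2"
        by (intro power_mono Dnorm f norm_L2_nonneg)
      then have "(norm_L2 (D f))\<^sup>2 \<le> M\<^sup>2 * 1"
        using mult_left_mono[OF n1, of "M\<^sup>2"] by (simp add: power_mult_distrib)
      moreover have "M\<^sup>2 * (norm_L2 f)\<^sup>2 \<le> M\<^sup>2 * 1" by (intro mult_left_mono n1) simp
      moreover have "M * (M - e) \<le> M * \<bar>Re (inner_L2 (D f) f)\<bar>" using fe Mp by (intro mult_left_mono) auto
      ultimately show ?thesis by linarith
    qed
    also have "\<dots> = 2 * M * e" by (simp add: power2_eq_square algebra_simps)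
    finally have En: "(norm_L2 E)\<^sup>2 \<le> 2 * M * e" .
    have DfE: "D f = (\<lambda>z. of_real l * f z + E z)" by (simp add: E_def)
    have Dadd: "inner_L2 (D f) h = of_real l * inner_L2 f h + inner_L2 E h" if "h \<in> bergman_space" for h
      using that f E by (simp add: DfE inner_L2_add_left inner_L2_scale_left sq sq_integrable_scale)
    have "inner_L2 (S (D f)) f + inner_L2 (D (B f)) f = 0"
    proof -
      have "S (D f) = (\<lambda>z. S (S f) z - S (B f) z)"
        unfolding D_def by (intro bounded_operator_diff[OF bS] Sin Bin f)
      then have "(\<lambda>z. S (D f) z + D (B f) z) = (\<lambda>z. 0)"
        by (simp add: D_def SB[OF f(1)])
      then have "inner_L2 (\<lambda>z. S (D f) z + D (B f) z) f = 0" by simp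
      then show ?thesis
        using f by (simp add: inner_L2_add_left sq Sin Bin Din)
    qed
    moreover have "inner_L2 (S (D f)) f = inner_L2 (D f) (S f)"
      by (rule positive_operator_symmetric[OF S Din[OF f(1)] f(1)])
    moreover have "inner_L2 (D (B f)) f = cnj (inner_L2 (D f) (B f))"
      using sym[OF Bin[OF f(1)] f(1)] inner_L2_cnj[of "B f" "D f"] by simp
    ultimately have z: "inner_L2 (D f) (S f) + cnj (inner_L2 (D f) (B f)) = 0" by simp
    have "Re (inner_L2 (D f) (S f)) + Re (inner_L2 (D f) (B f)) = 0"
      using arg_cong[OF z, of Re] by simp
    then have "l * (Re (inner_L2 (S f) f) + Re (inner_L2 (B f) f)) = - (Re (inner_L2 E (S f)) + Re (inner_L2 E (B f)))"
      unfolding Dadd[OF Sin[OF f(1)]] Dadd[OF Bin[OF f(1)]]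
      by (simp add: inner_L2_cnj[of f "S f"] inner_L2_cnj[of f "B f"] algebra_simps)
    then have "\<bar>l\<bar> * \<bar>Re (inner_L2 (S f) f) + Re (inner_L2 (B f) f)\<bar> = \<bar>Re (inner_L2 E (S f)) + Re (inner_L2 E (B f))\<bar>"
      by (metis abs_minus_cancel abs_mult)
    then have "M * (Re (inner_L2 (S f) f) + Re (inner_L2 (B f) f)) \<le> \<bar>Re (inner_L2 E (S f))\<bar> + \<bar>Re (inner_L2 E (B f))\<bar>"
      using l(3) pos[OF f(1)] by simp
    also have "\<dots> \<le> norm_L2 E * norm_L2 (S f) + norm_L2 E * norm_L2 (B f)"
      by (intro add_mono order.trans[OF abs_Re_le_cmod] cmod_inner_L2_le sq E Sin Bin f)
    also have "\<dots> = norm_L2 E * (norm_L2 (S f) + norm_L2 (B f))" by (simp add: algebra_simps)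
    also have "\<dots> \<le> norm_L2 E * C"
      by (intro mult_left_mono C f norm_L2_nonneg)
    finally have 1: "M * (Re (inner_L2 (S f) f) + Re (inner_L2 (B f) f)) \<le> norm_L2 E * C" .
    have "M / 2 \<le> Re (inner_L2 (S f) f) + Re (inner_L2 (B f) f)"
      using fe e pos[OF f(1)] Dform[OF f(1)] by linarith
    then have "M * (M / 2) \<le> M * (Re (inner_L2 (S f) f) + Re (inner_L2 (B f) f))"
      using Mp by (intro mult_left_mono) auto
    then have "M * (M / 2) \<le> norm_L2 E * C"
      using 1 by (rule order.trans)
    then have "(M * (M / 2))\<^sup>2 \<le> (norm_L2 E * C)\<^sup>2"
      using Mp by (intro power_mono) auto
    also have "\<dots> \<le> (2 * M * e) * C\<^sup>2"
      unfolding power_mult_distrib by (intro mult_right_mono En) simp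
    also have "\<dots> \<le> (2 * M * e) * (C\<^sup>2 + 1)"
      using Mp e by (intro mult_left_mono) auto
    also have "\<dots> \<le> (2 * M * (M ^ 3 / (16 * (C\<^sup>2 + 1)))) * (C\<^sup>2 + 1)"
      using Mp e C1 by (intro mult_right_mono mult_left_mono) auto
    also have "\<dots> = M ^ 4 / 8"
      using C1 by (simp add: divide_simps power_numeral_reduce)
    finally have "M ^ 4 / 4 \<le> M ^ 4 / 8" by (simp add: power_mult_distrib power_divide power_numeral_reduce)
    then show False using Mp by simp
  qed
  have "S f = B f" if f: "f \<in> bergman_space" for f
  proof -
    have "norm_L2 (D f) = 0" using Dnorm[OF f] \<open>M = 0\<close> norm_L2_nonneg[of "D f"] by simp
    then have "D f = (\<lambda>z. 0)"
      by (intro bergman_eqI_norm_zero Din f) (simp add: inner_L2_self)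
    then show ?thesis by (auto simp: D_def fun_eq_iff)
  qed
  moreover have "S \<in> extensional bergman_space" "B \<in> extensional bergman_space"
    using bS bB by (auto simp: bounded_operator_def PiE_def)
  ultimately show ?thesis
    by (rule extensionalityI[rotated 2])
qed

lemma sqrt_operator_eqI:
  assumes "positive_operator S" "\<And>f. f \<in> bergman_space \<Longrightarrow> S (S f) = T f"
  shows "sqrt_operator T = S"
  unfolding sqrt_operator_def
  using assms by (intro the_equality) (auto intro: positive_square_root_unique)

section \<open>Toeplitz operators of horizontal strips and their square roots\<close>

lemma bergman_projection_eqI:
  assumes F: "F \<in> sq_integrable" and g: "g \<in> bergman_space"
    and orth: "\<And>h. h \<in> bergman_space \<Longrightarrow> inner_L2 F h = inner_L2 g h"
  shows "bergman_projection F = g"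
  unfolding bergman_projection_def
proof (rule the_equality)
  note sq = bergman_sq_integrable
  show "g \<in> bergman_space \<and> (\<forall>h\<in>bergman_space. inner_L2 (\<lambda>z. F z - g z) h = 0)"
    using F g orth by (simp add: inner_L2_diff_left sq)
  fix g' assume g': "g' \<in> bergman_space \<and> (\<forall>h\<in>bergman_space. inner_L2 (\<lambda>z. F z - g' z) h = 0)"
  have d: "(\<lambda>z. g z - g' z) \<in> bergman_space" using g g' by (intro bergman_diff) auto
  have "inner_L2 (\<lambda>z. F z - g' z) (\<lambda>z. g z - g' z) = 0" using g' d by blast
  then have "inner_L2 (\<lambda>z. g z - g' z) (\<lambda>z. g z - g' z) = 0"
    using F g g' d orth[OF d] by (simp add: inner_L2_diff_left sq)
  then have "(\<lambda>z. g z - g' z) = (\<lambda>z. 0)"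
    by (rule bergman_eqI_norm_zero[OF d])
  then show "g' = g" by (auto simp: fun_eq_iff)
qed

text \<open>
  The strips are closed below whereas the shifted half-plane is open. The difference is a line.
\<close>

lemma AE_Im_neq: "AE z in lborel. Im z \<noteq> s"
proof -
  have [measurable]: "{z. Im z = s} \<in> sets borel"
    by (intro borel_closed closed_Collect_eq continuous_intros)
  have "emeasure lborel {z. Im z = s} = (\<integral>\<^sup>+z. indicator {z. Im z = s} z \<partial>lborel)"
    by simp
  also have "\<dots> = (\<integral>\<^sup>+x. \<integral>\<^sup>+y. indicator {z. Im z = s} (Complex x y) \<partial>lborel \<partial>lborel)"
    by (rule nn_integral_complex) measurable
  also have "\<dots> = (\<integral>\<^sup>+x. \<integral>\<^sup>+y. indicator {s} y \<partial>lborel \<partial>(lborel :: real measure))"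
    by (intro nn_integral_cong) (auto simp: indicator_def)
  also have "\<dots> = 0" by simp
  finally show ?thesis
    by (subst AE_iff_measurable[of "{z. Im z = s}"]) auto
qed

text \<open>
  The Toeplitz form of the half-plane \<open>Im z \<ge> s\<close>. Translating the integral down by \<open>s\<close> turns it into
  \<open>\<langle>V\<^sub>s f, V\<^sub>s h\<rangle>\<close>, and self-adjointness moves both shifts to the left.
\<close>

lemma inner_upper_part:
  assumes f: "f \<in> bergman_space" and h: "h \<in> bergman_space" and s: "0 \<le> s"
  shows "inner_L2 (\<lambda>z. indicator {s..} (Im z) * f z) h = inner_L2 (vshift (2 * s) f) h"
    and "(\<lambda>z. indicator {s..} (Im z) * f z) \<in> sq_integrable"
proof -
  note sf = bergman_sq_integrable[OF f] and sh = bergman_sq_integrable[OF h]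
  note [measurable] = sq_integrable_measurable[OF sf] sq_integrable_measurable[OF sh]
  have [measurable]: "(\<lambda>z. indicator {s..} (Im z) :: complex) \<in> borel_measurable borel"
    "(\<lambda>z. indicator {s<..} (Im z) :: complex) \<in> borel_measurable borel"
    by measurable
  show sq: "(\<lambda>z. indicator {s..} (Im z) * f z) \<in> sq_integrable"
    by (rule sq_integrable_mult_bounded[OF sf, where B = 1]) (auto simp: indicator_def)
  have "inner_L2 (vshift (2 * s) f) h = inner_L2 (vshift s (vshift s f)) h"
    using s by (simp add: vshift_vshift)
  also have "\<dots> = inner_L2 (vshift s f) (vshift s h)"
    by (rule vshift_selfadjoint[OF vshift_bergman[OF f s] h s])
  also have "\<dots> = (\<integral>z. vshift s f z * cnj (vshift s h z) \<partial>lborel)"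
    by (rule inner_L2_lborel[OF vshift_sq_integrable[OF sf]])
  also have "\<dots> = (\<integral>z. indicator {s<..} (Im (z + of_real s * \<i>)) * f (z + of_real s * \<i>)
      * cnj (h (z + of_real s * \<i>)) \<partial>lborel)"
    by (intro Bochner_Integration.integral_cong) (auto simp: vshift_def upper_hp_def indicator_def)
  also have "\<dots> = (\<integral>z. indicator {s<..} (Im z) * f z * cnj (h z) \<partial>lborel)"
    by (rule integral_translate) measurable
  also have "\<dots> = (\<integral>z. indicator {s..} (Im z) * f z * cnj (h z) \<partial>lborel)"
    using AE_Im_neq[of s]
    by (intro integral_cong_AE) (measurable, auto simp: indicator_def elim!: eventually_mono)
  also have "\<dots> = inner_L2 (\<lambda>z. indicator {s..} (Im z) * f z) h"
    by (rule inner_L2_lborel[OF sq, symmetric])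
  finally show "inner_L2 (\<lambda>z. indicator {s..} (Im z) * f z) h = inner_L2 (vshift (2 * s) f) h" ..
qed

lemma toeplitz_top_strip:
  assumes n: "n \<ge> 1" and f: "f \<in> bergman_space"
  shows "toeplitz (strip_symbol n n) f = vshift (2 * (real n - 1)) f"
proof -
  have s: "0 \<le> real n - 1" using n by simp
  have "bergman_projection (\<lambda>z. strip_symbol n n z * f z) = vshift (2 * (real n - 1)) f"
    using inner_upper_part[OF f _ s] bergman_zero f s
    by (intro bergman_projection_eqI vshift_bergman) (auto simp: strip_symbol_def)
  then show ?thesis using f by (simp add: toeplitz_def)
qed

lemma toeplitz_strip:
  assumes k: "1 \<le> k" "k < n" and f: "f \<in> bergman_space"
  shows "toeplitz (strip_symbol n k) f = (\<lambda>z. vshift (2 * (real k - 1)) f z - vshift (2 * real k) f z)"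
proof -
  have s: "0 \<le> real k - 1" "0 \<le> real k" using k by auto
  have eq: "(\<lambda>z. strip_symbol n k z * f z)
      = (\<lambda>z. indicator {real k - 1..} (Im z) * f z - indicator {real k..} (Im z) * f z)"
    using k by (auto simp: strip_symbol_def indicator_def)
  have "bergman_projection (\<lambda>z. strip_symbol n k z * f z)
      = (\<lambda>z. vshift (2 * (real k - 1)) f z - vshift (2 * real k) f z)"
    unfolding eq
  proof (rule bergman_projection_eqI)
    show "(\<lambda>z. indicator {real k - 1..} (Im z) * f z - indicator {real k..} (Im z) * f z) \<in> sq_integrable"
      by (intro sq_integrable_diff inner_upper_part(2)[OF f bergman_zero] s)
    show "(\<lambda>z. vshift (2 * (real k - 1)) f z - vshift (2 * real k) f z) \<in> bergman_space"
      using s by (intro bergman_diff vshift_bergman f) auto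
    fix h assume h: "h \<in> bergman_space"
    show "inner_L2 (\<lambda>z. indicator {real k - 1..} (Im z) * f z - indicator {real k..} (Im z) * f z) h
        = inner_L2 (\<lambda>z. vshift (2 * (real k - 1)) f z - vshift (2 * real k) f z) h"
      using inner_upper_part[OF f h s(1)] inner_upper_part[OF f h s(2)]
      by (simp add: inner_L2_diff_left bergman_sq_integrable h vshift_sq_integrable f)
  qed
  then show ?thesis using f by (simp add: toeplitz_def)
qed

text \<open>
  The operators \<open>V\<^bsub>k-1\<^esub> R\<close> for \<open>k < n\<close> and \<open>V\<^bsub>n-1\<^esub>\<close> for \<open>k = n\<close>, that is
  multiplication by \<open>e\<^bsup>-(k-1)t\<^esup> \<surd>(1 - e\<^sup>-\<^sup>2\<^sup>t)\<close> and by \<open>e\<^bsup>-(n-1)t\<^esup>\<close> in the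
  Fourier-Laplace picture.
\<close>

definition strip_root :: "nat \<Rightarrow> nat \<Rightarrow> (complex \<Rightarrow> complex) \<Rightarrow> (complex \<Rightarrow> complex)" where
  "strip_root n k f = vshift (real k - 1) (if k < n then root_series f else f)"

lemma root_series_bergman: "f \<in> bergman_space \<Longrightarrow> root_series f \<in> bergman_space"
  by (rule shift_series_bergman[OF summable_sqrt_coeff])

lemma strip_root_bergman:
  "1 \<le> k \<Longrightarrow> f \<in> bergman_space \<Longrightarrow> strip_root n k f \<in> bergman_space"
  by (auto simp: strip_root_def intro!: vshift_bergman root_series_bergman)

lemma strip_root_add:
  "f \<in> bergman_space \<Longrightarrow> g \<in> bergman_space \<Longrightarrow>
    strip_root n k (\<lambda>z. f z + g z) = (\<lambda>z. strip_root n k f z + strip_root n k g z)"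
  by (simp add: strip_root_def shift_series_add[OF summable_sqrt_coeff] vshift_add)

lemma strip_root_scale:
  "f \<in> bergman_space \<Longrightarrow> strip_root n k (\<lambda>z. c * f z) = (\<lambda>z. c * strip_root n k f z)"
  by (simp add: strip_root_def shift_series_scale[OF summable_sqrt_coeff] vshift_scale)

lemma strip_root_zero: "strip_root n k (\<lambda>z. 0) = (\<lambda>z. 0)"
  using strip_root_scale[OF bergman_zero, of n k 0] by simp

lemma strip_root_sum:
  "finite A \<Longrightarrow> (\<And>l. l \<in> A \<Longrightarrow> f l \<in> bergman_space) \<Longrightarrow>
    strip_root n k (\<lambda>z. \<Sum>l\<in>A. f l z) = (\<lambda>z. \<Sum>l\<in>A. strip_root n k (f l) z)"
  by (induction A rule: finite_induct) (simp_all add: strip_root_zero strip_root_add bergman_sum)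

lemma strip_root_selfadjoint:
  assumes k: "1 \<le> k" and f: "f \<in> bergman_space" and h: "h \<in> bergman_space"
  shows "inner_L2 (strip_root n k f) h = inner_L2 f (strip_root n k h)"
proof (cases "k < n")
  case True
  have s: "0 \<le> real k - 1" using k by simp
  have "inner_L2 (strip_root n k f) h = inner_L2 (root_series f) (vshift (real k - 1) h)"
    using True s by (simp add: strip_root_def vshift_selfadjoint root_series_bergman f h)
  also have "\<dots> = inner_L2 f (root_series (vshift (real k - 1) h))"
    by (rule shift_series_selfadjoint[OF summable_sqrt_coeff f vshift_bergman[OF h s]])
  also have "\<dots> = inner_L2 f (strip_root n k h)"
    using True by (simp add: strip_root_def vshift_shift_series[OF s])
  finally show ?thesis .
next
  case False
  then show ?thesis using k by (simp add: strip_root_def vshift_selfadjoint f h)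
qed

text \<open>
  Half of the shift is moved to the other side: with \<open>2 s = k - 1\<close>,
  \<open>\<langle>V\<^bsub>2s\<^esub> R f, f\<rangle> = \<langle>R V\<^sub>s f, V\<^sub>s f\<rangle>\<close>.
\<close>

lemma strip_root_nonneg:
  assumes k: "1 \<le> k" and f: "f \<in> bergman_space"
  shows "inner_L2 (strip_root n k f) f \<in> \<real>" "0 \<le> Re (inner_L2 (strip_root n k f) f)"
proof -
  have s: "0 \<le> (real k - 1) / 2" "0 \<le> real k - 1" using k by auto
  have "inner_L2 (strip_root n k f) f \<in> \<real> \<and> 0 \<le> Re (inner_L2 (strip_root n k f) f)"
  proof (cases "k < n")
    case True
    define g where "g = vshift ((real k - 1) / 2) f"
    have g: "g \<in> bergman_space" unfolding g_def by (rule vshift_bergman[OF f s(1)])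
    have "strip_root n k f = vshift ((real k - 1) / 2) (root_series g)"
      using True s by (simp add: strip_root_def g_def vshift_vshift vshift_shift_series[symmetric])
    then have "inner_L2 (strip_root n k f) f = inner_L2 (root_series g) g"
      using s by (simp add: vshift_selfadjoint root_series_bergman g f flip: g_def)
    then show ?thesis using inner_root_series_nonneg[OF g] by simp
  next
    case False
    then show ?thesis using inner_vshift_bounds[OF f s(2)] by (simp add: strip_root_def)
  qed
  then show "inner_L2 (strip_root n k f) f \<in> \<real>" "0 \<le> Re (inner_L2 (strip_root n k f) f)" by auto
qed

lemma norm_strip_root_le:
  assumes f: "f \<in> bergman_space"
  shows "norm_L2 (strip_root n k f) \<le> max 1 (\<Sum>m. \<bar>sqrt_coeff m\<bar>) * norm_L2 f"
proof -
  have "norm_L2 (strip_root n k f) \<le> norm_L2 (if k < n then root_series f else f)"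
    unfolding strip_root_def
    by (rule norm_vshift_le) (auto intro: bergman_sq_integrable root_series_bergman f)
  also have "\<dots> \<le> max 1 (\<Sum>m. \<bar>sqrt_coeff m\<bar>) * norm_L2 f"
  proof (cases "k < n")
    case True
    then have "norm_L2 (if k < n then root_series f else f) \<le> (\<Sum>m. \<bar>sqrt_coeff m\<bar>) * norm_L2 f"
      using norm_shift_series_le[OF summable_sqrt_coeff f] by simp
    also have "\<dots> \<le> max 1 (\<Sum>m. \<bar>sqrt_coeff m\<bar>) * norm_L2 f"
      by (intro mult_right_mono norm_L2_nonneg) simp
    finally show ?thesis .
  next
    case False
    then show ?thesis using mult_right_mono[OF max.cobounded1 norm_L2_nonneg, of 1 f] by simp
  qed
  finally show ?thesis .
qed

lemma strip_root_positive:
  assumes k: "1 \<le> k"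
  shows "positive_operator (restrict (strip_root n k) bergman_space)"
  unfolding positive_operator_def bounded_operator_def
proof (intro conjI ballI allI)
  show "\<exists>C. \<forall>f\<in>bergman_space. norm_L2 (restrict (strip_root n k) bergman_space f) \<le> C * norm_L2 f"
    using norm_strip_root_le by (intro exI ballI) simp
qed (use strip_root_bergman[OF k] strip_root_nonneg[OF k] in
  \<open>simp_all add: bergman_add bergman_scale strip_root_add strip_root_scale\<close>)

lemma strip_root_square:
  assumes k: "1 \<le> k" "k < n" and f: "f \<in> bergman_space"
  shows "strip_root n k (strip_root n k f) = (\<lambda>z. vshift (2 * (real k - 1)) f z - vshift (2 * real k) f z)"
proof -
  have s: "0 \<le> real k - 1" using k by simp
  have "strip_root n k (strip_root n k f) = vshift (real k - 1) (vshift (real k - 1) (root_series (root_series f)))"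
    using k by (simp add: strip_root_def vshift_shift_series[OF s])
  also have "\<dots> = vshift (2 * (real k - 1)) (\<lambda>z. f z + (-1) * vshift 2 f z)"
    using s by (simp add: root_series_root_series f vshift_vshift)
  also have "\<dots> = (\<lambda>z. vshift (2 * (real k - 1)) f z + (-1) * vshift (2 * (real k - 1) + 2) f z)"
    using s by (simp only: vshift_add vshift_scale vshift_vshift mult_nonneg_nonneg zero_le_numeral)
  finally show ?thesis by (simp add: algebra_simps)
qed

lemma strip_root_top_square:
  assumes n: "1 \<le> n"
  shows "strip_root n n (strip_root n n f) = vshift (2 * (real n - 1)) f"
  using n by (simp add: strip_root_def vshift_vshift)

theorem sqrt_toeplitz_strip:
  assumes k: "1 \<le> k" "k \<le> n"
  shows "sqrt_operator (toeplitz (strip_symbol n k)) = restrict (strip_root n k) bergman_space"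
proof (rule sqrt_operator_eqI)
  show "positive_operator (restrict (strip_root n k) bergman_space)"
    by (rule strip_root_positive[OF k(1)])
  fix f assume f: "f \<in> bergman_space"
  have "strip_root n k (strip_root n k f) = toeplitz (strip_symbol n k) f"
  proof (cases "k = n")
    case True
    then show ?thesis using k f by (simp add: strip_root_top_square toeplitz_top_strip)
  next
    case False
    then show ?thesis using k f by (simp add: strip_root_square toeplitz_strip)
  qed
  then show "restrict (strip_root n k) bergman_space (restrict (strip_root n k) bergman_space f)
      = toeplitz (strip_symbol n k) f"
    using f strip_root_bergman[OF k(1) f] by simp
qed

text \<open>
  The squares \<open>V\<^bsub>2(k-1)\<^esub> - V\<^bsub>2k\<^esub>\<close> telescope, and the last one, \<open>V\<^bsub>2(n-1)\<^esub>\<close>, cancels what remains.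
\<close>

lemma sum_strip_root_squares:
  assumes n: "1 \<le> n" and f: "f \<in> bergman_space"
  shows "(\<lambda>z. \<Sum>k=1..n. strip_root n k (strip_root n k f) z) = f"
proof
  fix z
  obtain m where m: "n = Suc m" using n by (cases n) auto
  define v where "v k = vshift (2 * real k) f z" for k
  have "(\<Sum>k=1..n. strip_root n k (strip_root n k f) z)
      = (\<Sum>k=1..m. strip_root n k (strip_root n k f) z) + strip_root n n (strip_root n n f) z"
    by (simp add: m)
  also have "(\<Sum>k=1..m. strip_root n k (strip_root n k f) z) = (\<Sum>k=1..m. v (k - 1) - v k)"
    by (intro sum.cong refl) (simp add: m strip_root_square f v_def of_nat_diff)
  also have "\<dots> = v 0 - v m"
    by (induction m) simp_all
  also have "strip_root n n (strip_root n n f) z = v m"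
    by (simp only: strip_root_top_square[OF n]) (simp add: m v_def)
  also have "v 0 - v m + v m = f z"
    by (simp add: v_def vshift_0[OF f])
  finally show "(\<Sum>k=1..n. strip_root n k (strip_root n k f) z) = f z" .
qed

section \<open>The matrix kernel\<close>

definition strip_kernel :: "nat \<Rightarrow> matrix_kernel" where
  "strip_kernel n z w j k = strip_root n j (strip_root n k (bergman_kernel w)) z"

text \<open>
  If \<open>S\<close> is the column of the operators \<open>S\<^sub>1, \<dots>, S\<^sub>n\<close>, then \<open>P\<^sub>T = S S\<^sup>*\<close> and this is \<open>S\<^sup>*\<close>. The identity
  \<open>S\<^sup>* S = 1\<close> is \<open>sum_strip_root_squares\<close>.
\<close>

definition fold_roots :: "nat \<Rightarrow> (nat \<Rightarrow> complex \<Rightarrow> complex) \<Rightarrow> (complex \<Rightarrow> complex)" where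
  "fold_roots n \<phi> = (\<lambda>z. \<Sum>k=1..n. strip_root n k (\<phi> k) z)"

lemma bergman_vec_component: "\<phi> \<in> bergman_vec n \<Longrightarrow> k \<in> {1..n} \<Longrightarrow> \<phi> k \<in> bergman_space"
  by (auto simp: bergman_vec_def)

lemma fold_roots_bergman: "\<phi> \<in> bergman_vec n \<Longrightarrow> fold_roots n \<phi> \<in> bergman_space"
  unfolding fold_roots_def
  by (intro bergman_sum strip_root_bergman) (auto intro: bergman_vec_component)

lemma P_T_eq:
  assumes phi: "\<phi> \<in> bergman_vec n"
  shows "P_T n \<phi> = (\<lambda>j\<in>{1..n}. strip_root n j (fold_roots n \<phi>))"
proof
  fix j
  show "P_T n \<phi> j = (\<lambda>j\<in>{1..n}. strip_root n j (fold_roots n \<phi>)) j"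
  proof (cases "j \<in> {1..n}")
    case True
    have "P_T n \<phi> j = (\<lambda>z. \<Sum>k=1..n. strip_root n j (strip_root n k (\<phi> k)) z)"
      using True bergman_vec_component[OF phi]
      by (auto simp: P_T_def sqrt_toeplitz_strip strip_root_bergman intro!: sum.cong)
    also have "\<dots> = strip_root n j (fold_roots n \<phi>)"
      unfolding fold_roots_def
      by (rule strip_root_sum[symmetric]) (auto intro!: strip_root_bergman bergman_vec_component[OF phi])
    finally show ?thesis using True by simp
  next
    case False
    then show ?thesis unfolding P_T_def by (simp only: restrict_apply if_False)
  qed
qed

lemma P_T_bergman_vec: "\<phi> \<in> bergman_vec n \<Longrightarrow> P_T n \<phi> \<in> bergman_vec n"
  by (auto simp: P_T_eq bergman_vec_def[of n] intro!: strip_root_bergman fold_roots_bergman)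

text \<open>
  The columns are the images under \<open>P\<^sub>T\<close> of the vectors with the Bergman kernel in one position and
  zero in the others.
\<close>

lemma strip_kernel_column:
  assumes w: "w \<in> upper_hp" and k: "k \<in> {1..n}"
  shows "kernel_column n (strip_kernel n) w k = (\<lambda>j\<in>{1..n}. strip_root n j (strip_root n k (bergman_kernel w)))"
    and "kernel_column n (strip_kernel n) w k \<in> P_T n ` bergman_vec n"
proof -
  have kb: "bergman_kernel w \<in> bergman_space" by (rule bergman_kernel_in_bergman_space[OF w])
  show eq: "kernel_column n (strip_kernel n) w k = (\<lambda>j\<in>{1..n}. strip_root n j (strip_root n k (bergman_kernel w)))"
    by (auto simp: kernel_column_def strip_kernel_def strip_root_def vshift_def fun_eq_iff)
  define \<phi> where "\<phi> = (\<lambda>j\<in>{1..n}. if j = k then bergman_kernel w else (\<lambda>z. 0))"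
  have phi: "\<phi> \<in> bergman_vec n"
    by (auto simp: \<phi>_def bergman_vec_def kb bergman_zero)
  have "fold_roots n \<phi> = (\<lambda>z. \<Sum>l=1..n. if l = k then strip_root n k (bergman_kernel w) z else 0)"
    unfolding fold_roots_def by (intro ext sum.cong) (auto simp: \<phi>_def strip_root_zero)
  also have "\<dots> = strip_root n k (bergman_kernel w)"
    using k by simp
  finally have "P_T n \<phi> = kernel_column n (strip_kernel n) w k"
    unfolding P_T_eq[OF phi] eq by simp
  then show "kernel_column n (strip_kernel n) w k \<in> P_T n ` bergman_vec n"
    using imageI[OF phi, of "P_T n"] by simp
qed

text \<open>
  For \<open>f = S \<psi>\<close> the pairing with the column \<open>S S\<^sub>k k\<^sub>w\<close> is \<open>\<langle>S\<^sup>* S \<psi>, S\<^sub>k k\<^sub>w\<rangle> = \<langle>S\<^sub>k \<psi>, k\<^sub>w\<rangle>\<close>, the value of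
  \<open>f\<^sub>k\<close> at \<open>w\<close>.
\<close>

lemma strip_kernel_reproducing:
  assumes n: "1 \<le> n"
  shows "is_reproducing_kernel n (P_T n ` bergman_vec n) (strip_kernel n)"
  unfolding is_reproducing_kernel_def
proof (intro ballI conjI)
  fix w k assume w: "w \<in> upper_hp" and k: "k \<in> {1..n}"
  show "kernel_column n (strip_kernel n) w k \<in> P_T n ` bergman_vec n"
    by (rule strip_kernel_column(2)[OF w k])
  fix f assume "f \<in> P_T n ` bergman_vec n"
  then obtain \<phi> where phi: "\<phi> \<in> bergman_vec n" and f: "f = P_T n \<phi>" by blast
  define \<psi> where "\<psi> = fold_roots n \<phi>"
  have psi: "\<psi> \<in> bergman_space" unfolding \<psi>_def by (rule fold_roots_bergman[OF phi])
  have kb: "bergman_kernel w \<in> bergman_space" by (rule bergman_kernel_in_bergman_space[OF w])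
  have fj: "f j = strip_root n j \<psi>" if "j \<in> {1..n}" for j
    using that by (simp add: f P_T_eq[OF phi] \<psi>_def)
  have kk: "strip_root n k (bergman_kernel w) \<in> bergman_space"
    using k by (intro strip_root_bergman kb) auto
  have "inner_vec n f (kernel_column n (strip_kernel n) w k)
      = (\<Sum>j=1..n. inner_L2 (strip_root n j (strip_root n j \<psi>)) (strip_root n k (bergman_kernel w)))"
    unfolding inner_vec_def strip_kernel_column(1)[OF w k]
    by (intro sum.cong refl) (simp add: fj strip_root_selfadjoint strip_root_bergman psi kk)
  also have "\<dots> = inner_L2 (\<lambda>z. \<Sum>j=1..n. strip_root n j (strip_root n j \<psi>) z) (strip_root n k (bergman_kernel w))"
    by (rule inner_L2_sum_left[THEN conjunct1, symmetric])
      (auto intro!: bergman_sq_integrable strip_root_bergman psi kk)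
  also have "\<dots> = inner_L2 \<psi> (strip_root n k (bergman_kernel w))"
    by (simp only: sum_strip_root_squares[OF n psi])
  also have "\<dots> = inner_L2 (strip_root n k \<psi>) (bergman_kernel w)"
    using k by (simp add: strip_root_selfadjoint psi kb)
  also have "\<dots> = f k w"
    using k by (simp add: fj bergman_reproducing strip_root_bergman psi w)
  finally show "f k w = inner_vec n f (kernel_column n (strip_kernel n) w k)" ..
qed

text \<open>
  Two columns \<open>a\<close> and \<open>b\<close> reproducing the same values of all elements of \<open>M\<close> are themselves in \<open>M\<close>,
  so \<open>\<langle>a - b, a - b\<rangle> = 0\<close>.
\<close>

lemma reproducing_kernel_unique:
  assumes M: "M \<subseteq> bergman_vec n"
    and K: "is_reproducing_kernel n M K" and L: "is_reproducing_kernel n M L"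
    and z: "z \<in> upper_hp" and w: "w \<in> upper_hp" and j: "j \<in> {1..n}" and k: "k \<in> {1..n}"
  shows "K z w j k = L z w j k"
proof -
  define a where "a = kernel_column n K w k"
  define b where "b = kernel_column n L w k"
  have a: "a \<in> M" "\<And>f. f \<in> M \<Longrightarrow> f k w = inner_vec n f a"
    and b: "b \<in> M" "\<And>f. f \<in> M \<Longrightarrow> f k w = inner_vec n f b"
    using K L w k by (auto simp: is_reproducing_kernel_def a_def b_def)
  have sq: "a i \<in> sq_integrable" "b i \<in> sq_integrable" "a i \<in> bergman_space" "b i \<in> bergman_space"
    if "i \<in> {1..n}" for i
    using that M a(1) b(1) by (auto intro!: bergman_sq_integrable intro: bergman_vec_component)
  have "(\<Sum>i=1..n. inner_L2 (\<lambda>z. a i z - b i z) (\<lambda>z. a i z - b i z))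
      = (\<Sum>i=1..n. (inner_L2 (a i) (a i) - inner_L2 (a i) (b i)) - (inner_L2 (b i) (a i) - inner_L2 (b i) (b i)))"
    by (intro sum.cong refl)
      (simp add: inner_L2_diff_left inner_L2_diff_right sq sq_integrable_diff algebra_simps)
  also have "\<dots> = (inner_vec n a a - inner_vec n a b) - (inner_vec n b a - inner_vec n b b)"
    by (simp add: inner_vec_def sum_subtractf)
  also have "\<dots> = 0"
    using a(2)[OF a(1)] b(2)[OF a(1)] a(2)[OF b(1)] b(2)[OF b(1)] by simp
  finally have "complex_of_real (\<Sum>i=1..n. (norm_L2 (\<lambda>z. a i z - b i z))\<^sup>2) = 0"
    by (simp add: inner_L2_self)
  then have "(\<Sum>i=1..n. (norm_L2 (\<lambda>z. a i z - b i z))\<^sup>2) = 0"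
    by (simp only: of_real_eq_0_iff)
  then have "(norm_L2 (\<lambda>z. a j z - b j z))\<^sup>2 = 0"
    using j by (subst (asm) sum_nonneg_eq_0_iff) auto
  then have "(\<lambda>z. a j z - b j z) = (\<lambda>z. 0)"
    by (intro bergman_eqI_norm_zero bergman_diff sq j) (simp add: inner_L2_self)
  then have "a j z = b j z" by (auto dest: fun_cong[of _ _ z])
  then show ?thesis using j z by (simp add: a_def b_def kernel_column_def)
qed

lemma K_T_reproducing:
  assumes n: "1 \<le> n"
  shows "is_reproducing_kernel n (P_T n ` bergman_vec n) (K_T n)"
  unfolding K_T_def reproducing_kernel_def
  by (rule someI[of "is_reproducing_kernel n (P_T n ` bergman_vec n)", OF strip_kernel_reproducing[OF n]])

lemma K_T_eq_strip_kernel: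
  assumes n: "1 \<le> n" and "z \<in> upper_hp" "w \<in> upper_hp" "j \<in> {1..n}" "k \<in> {1..n}"
  shows "K_T n z w j k = strip_kernel n z w j k"
  using P_T_bergman_vec
  by (intro reproducing_kernel_unique[OF _ K_T_reproducing[OF n] strip_kernel_reproducing[OF n]] assms) auto

lemma strip_kernel_hermitian:
  assumes z: "z \<in> upper_hp" and w: "w \<in> upper_hp" and j: "1 \<le> j" and k: "1 \<le> k"
  shows "strip_kernel n z w j k = cnj (strip_kernel n w z k j)"
proof -
  have kz: "bergman_kernel z \<in> bergman_space" and kw: "bergman_kernel w \<in> bergman_space"
    by (intro bergman_kernel_in_bergman_space z w)+
  have "strip_kernel n z w j k = inner_L2 (strip_root n j (strip_root n k (bergman_kernel w))) (bergman_kernel z)"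
    using j k by (simp add: strip_kernel_def bergman_reproducing z strip_root_bergman kw)
  also have "\<dots> = inner_L2 (bergman_kernel w) (strip_root n k (strip_root n j (bergman_kernel z)))"
    using j k by (simp add: strip_root_selfadjoint strip_root_bergman kz kw)
  also have "\<dots> = cnj (inner_L2 (strip_root n k (strip_root n j (bergman_kernel z))) (bergman_kernel w))"
    by (rule inner_L2_cnj)
  also have "\<dots> = cnj (strip_kernel n w z k j)"
    using j k by (simp add: strip_kernel_def bergman_reproducing w strip_root_bergman kz)
  finally show ?thesis .
qed

text \<open>
  Hermitian symmetry turns the integral against row \<open>j\<close> of the kernel into the sum of the inner
  products \<open>\<langle>\<phi>\<^sub>k, S\<^sub>k S\<^sub>j k\<^sub>z\<rangle>\<close>, which is \<open>\<langle>S\<^sub>j S\<^sup>* \<phi>, k\<^sub>z\<rangle>\<close>.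
\<close>

lemma K_T_integral_kernel:
  assumes n: "1 \<le> n"
  shows "is_integral_kernel n (P_T n) (K_T n)"
  unfolding is_integral_kernel_def
proof (intro ballI)
  fix \<phi> z j assume phi: "\<phi> \<in> bergman_vec n" and z: "z \<in> upper_hp" and j: "j \<in> {1..n}"
  have kz: "bergman_kernel z \<in> bergman_space" by (rule bergman_kernel_in_bergman_space[OF z])
  have jz: "strip_root n j (bergman_kernel z) \<in> bergman_space"
    using j by (intro strip_root_bergman kz) auto
  define g where "g k = strip_root n k (strip_root n j (bergman_kernel z))" for k
  have g: "g k \<in> bergman_space" if "k \<in> {1..n}" for k
    unfolding g_def using that by (intro strip_root_bergman jz) auto
  note ph = bergman_vec_component[OF phi]
  have pt: "indicator upper_hp w *\<^sub>R (\<Sum>k=1..n. K_T n z w j k * \<phi> k w) = (\<Sum>k=1..n. \<phi> k w * cnj (g k w))" for w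
  proof (cases "w \<in> upper_hp")
    case True
    have "K_T n z w j k = cnj (g k w)" if "k \<in> {1..n}" for k
      using that j K_T_eq_strip_kernel[OF n z True j that] strip_kernel_hermitian[OF z True, of j k n]
      by (simp add: strip_kernel_def g_def)
    then show ?thesis using True by (auto simp: mult.commute intro!: sum.cong)
  next
    case False
    then have "\<phi> k w = 0" if "k \<in> {1..n}" for k
      using ph[OF that] by (simp add: bergman_space_def)
    then show ?thesis using False by simp
  qed
  have int: "integrable lborel (\<lambda>w. \<phi> k w * cnj (g k w))" if "k \<in> {1..n}" for k
    using that by (intro sq_integrable_product bergman_sq_integrable ph g)
  show "set_integrable lborel upper_hp (\<lambda>w. \<Sum>k=1..n. K_T n z w j k * \<phi> k w) \<and>
      P_T n \<phi> j z = set_lebesgue_integral lborel upper_hp (\<lambda>w. \<Sum>k=1..n. K_T n z w j k * \<phi> k w)"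
  proof
    show "set_integrable lborel upper_hp (\<lambda>w. \<Sum>k=1..n. K_T n z w j k * \<phi> k w)"
      unfolding set_integrable_def pt by (intro Bochner_Integration.integrable_sum int)
    have F: "fold_roots n \<phi> \<in> bergman_space" by (rule fold_roots_bergman[OF phi])
    have "P_T n \<phi> j z = strip_root n j (fold_roots n \<phi>) z"
      using j by (simp add: P_T_eq[OF phi])
    also have "\<dots> = inner_L2 (strip_root n j (fold_roots n \<phi>)) (bergman_kernel z)"
      using j by (intro bergman_reproducing[symmetric] strip_root_bergman F z) auto
    also have "\<dots> = inner_L2 (fold_roots n \<phi>) (strip_root n j (bergman_kernel z))"
      using j by (intro strip_root_selfadjoint F kz) auto
    also have "\<dots> = (\<Sum>k=1..n. inner_L2 (strip_root n k (\<phi> k)) (strip_root n j (bergman_kernel z)))"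
      unfolding fold_roots_def
      by (rule inner_L2_sum_left[THEN conjunct1])
        (auto intro!: bergman_sq_integrable strip_root_bergman ph jz)
    also have "\<dots> = (\<Sum>k=1..n. inner_L2 (\<phi> k) (g k))"
      unfolding g_def by (intro sum.cong refl strip_root_selfadjoint ph jz) auto
    also have "\<dots> = (\<Sum>k=1..n. \<integral>w. \<phi> k w * cnj (g k w) \<partial>lborel)"
      by (intro sum.cong refl inner_L2_lborel bergman_sq_integrable ph)
    also have "\<dots> = (\<integral>w. (\<Sum>k=1..n. \<phi> k w * cnj (g k w)) \<partial>lborel)"
      by (intro Bochner_Integration.integral_sum[symmetric] int)
    finally show "P_T n \<phi> j z = set_lebesgue_integral lborel upper_hp (\<lambda>w. \<Sum>k=1..n. K_T n z w j k * \<phi> k w)"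
      unfolding set_lebesgue_integral_def pt .
  qed
qed

section \<open>Explicit entries\<close>

lemma bergman_kernel_shift:
  assumes "z \<in> upper_hp" "0 \<le> m"
  shows "bergman_kernel w (z + of_int m * \<i>) = G m z w"
  using upper_hp_shift[OF assms(1), of "of_int m"] assms(2)
  by (simp add: bergman_kernel_def G_def algebra_simps)

lemma strip_kernel_top:
  assumes n: "1 \<le> n" and z: "z \<in> upper_hp"
  shows "strip_kernel n z w n n = G (2 * (int n - 1)) z w"
proof -
  have "strip_kernel n z w n n = bergman_kernel w (z + of_int (2 * (int n - 1)) * \<i>)"
    using z by (simp add: strip_kernel_def strip_root_top_square[OF n] vshift_def)
  also have "\<dots> = G (2 * (int n - 1)) z w"
    by (rule bergman_kernel_shift[OF z]) (use n in simp)
  finally show ?thesis .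
qed

lemma strip_kernel_inner:
  assumes j: "1 \<le> j" "j < n" and k: "1 \<le> k" "k < n" and z: "z \<in> upper_hp" and w: "w \<in> upper_hp"
  shows "strip_kernel n z w j k = - G (int j + int k) z w + G (int j + int k - 2) z w"
proof -
  have kb: "bergman_kernel w \<in> bergman_space" by (rule bergman_kernel_in_bergman_space[OF w])
  have s: "0 \<le> real j - 1" "0 \<le> real k - 1" "0 \<le> real j + real k - 2" using j k by auto
  have zs: "z + of_real (real j + real k - 2) * \<i> \<in> upper_hp"
    by (rule upper_hp_shift[OF z s(3)])
  have "strip_root n j (strip_root n k (bergman_kernel w))
      = vshift (real j - 1) (vshift (real k - 1) (root_series (root_series (bergman_kernel w))))"
    using j k by (simp add: strip_root_def vshift_shift_series[OF s(2)])
  also have "\<dots> = vshift (real j + real k - 2) (\<lambda>z. bergman_kernel w z - vshift 2 (bergman_kernel w) z)"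
    using j k by (simp add: root_series_root_series kb vshift_vshift)
  finally have "strip_kernel n z w j k = bergman_kernel w (z + of_real (real j + real k - 2) * \<i>)
      - bergman_kernel w (z + of_real (real j + real k - 2) * \<i> + of_real 2 * \<i>)"
    using z zs by (simp add: strip_kernel_def vshift_def)
  also have "z + of_real (real j + real k - 2) * \<i> + of_real 2 * \<i> = z + of_int (int j + int k) * \<i>"
    by (simp add: algebra_simps)
  also have "z + of_real (real j + real k - 2) * \<i> = z + of_int (int j + int k - 2) * \<i>"
    by simp
  also have "bergman_kernel w (z + of_int (int j + int k - 2) * \<i>) = G (int j + int k - 2) z w"
    using j k by (intro bergman_kernel_shift z) auto
  also have "bergman_kernel w (z + of_int (int j + int k) * \<i>) = G (int j + int k) z w"
    by (intro bergman_kernel_shift z) auto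
  finally show ?thesis by simp
qed

text \<open>
  The variable \<open>p\<close> is chosen such that \<open>z + (j + n - 2 + 2 m) i - cnj w = i (p + 2 m)\<close>.
\<close>

lemma strip_kernel_last_column:
  assumes j: "1 \<le> j" "j < n" and z: "z \<in> upper_hp" and w: "w \<in> upper_hp"
    and p: "p = - \<i> * (z - cnj w) + of_nat j + (of_nat n - 2)"
  shows "strip_kernel n z w j n = 1 / of_real pi * (\<Sum>m. of_real (sqrt_coeff m) / (p + 2 * of_nat m)\<^sup>2)"
    and "Re p > 0"
proof -
  have kb: "bergman_kernel w \<in> bergman_space" by (rule bergman_kernel_in_bergman_space[OF w])
  have s: "0 \<le> real j - 1" "0 \<le> real n - 1" "0 \<le> real j + real n - 2" using j by auto
  show Rp: "Re p > 0" using z w j by (simp add: p upper_hp_def)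
  have "strip_root n j (strip_root n n (bergman_kernel w))
      = vshift (real j + real n - 2) (root_series (bergman_kernel w))"
    using j by (simp add: strip_root_def vshift_shift_series[OF s(2), symmetric] vshift_vshift s)
  also have "\<dots> = root_series (vshift (real j + real n - 2) (bergman_kernel w))"
    by (rule vshift_shift_series[OF s(3)])
  finally have "strip_kernel n z w j n
      = (\<Sum>m. of_real (sqrt_coeff m) * vshift (2 * real m + (real j + real n - 2)) (bergman_kernel w) z)"
    by (simp add: strip_kernel_def shift_series_def vshift_vshift)
  also have "\<dots> = (\<Sum>m. 1 / of_real pi * (of_real (sqrt_coeff m) / (p + 2 * of_nat m)\<^sup>2))"
  proof (rule suminf_cong)
    fix m
    have t: "0 \<le> 2 * real m + (real j + real n - 2)" using s by simp
    have "z + of_real (2 * real m + (real j + real n - 2)) * \<i> - cnj w = \<i> * (p + 2 * of_nat m)"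
      by (simp add: p algebra_simps)
    then have "vshift (2 * real m + (real j + real n - 2)) (bergman_kernel w) z
        = - 1 / (of_real pi * (\<i> * (p + 2 * of_nat m))\<^sup>2)"
      using z upper_hp_shift[OF z t] by (simp only: vshift_def bergman_kernel_def if_True)
    also have "\<dots> = 1 / (of_real pi * (p + 2 * of_nat m)\<^sup>2)"
      by (simp add: power_mult_distrib)
    finally show "of_real (sqrt_coeff m) * vshift (2 * real m + (real j + real n - 2)) (bergman_kernel w) z
        = 1 / of_real pi * (of_real (sqrt_coeff m) / (p + 2 * of_nat m)\<^sup>2)"
      by simp
  qed
  also have "\<dots> = 1 / of_real pi * (\<Sum>m. of_real (sqrt_coeff m) / (p + 2 * of_nat m)\<^sup>2)"
  proof (rule suminf_mult)
    show "summable (\<lambda>m. of_real (sqrt_coeff m) / (p + 2 * of_nat m)\<^sup>2)"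
    proof (rule summable_comparison_test')
      show "summable (\<lambda>m. \<bar>sqrt_coeff m\<bar> * (1 / (Re p)\<^sup>2))"
        by (rule summable_mult2[OF summable_sqrt_coeff])
      fix m
      have "Re p \<le> cmod (p + 2 * of_nat m)"
        using complex_Re_le_cmod[of "p + 2 * of_nat m"] by simp
      then have "(Re p)\<^sup>2 \<le> (cmod (p + 2 * of_nat m))\<^sup>2" using Rp by (intro power_mono) auto
      then have "\<bar>sqrt_coeff m\<bar> / (cmod (p + 2 * of_nat m))\<^sup>2 \<le> \<bar>sqrt_coeff m\<bar> / (Re p)\<^sup>2"
        using Rp by (intro frac_le) auto
      then show "norm (of_real (sqrt_coeff m) / (p + 2 * of_nat m)\<^sup>2) \<le> \<bar>sqrt_coeff m\<bar> * (1 / (Re p)\<^sup>2)"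
        by (simp add: norm_divide norm_power)
    qed
  qed
  finally show "strip_kernel n z w j n = 1 / of_real pi * (\<Sum>m. of_real (sqrt_coeff m) / (p + 2 * of_nat m)\<^sup>2)" .
qed

section \<open>Special functions\<close>

lemma laplace_exp:
  fixes a :: complex
  assumes a: "0 < Re a"
  shows "integrable lborel (\<lambda>t. indicator {0<..} t *\<^sub>R exp (- a * of_real t))"
    and "(\<integral>t. indicator {0<..} t *\<^sub>R exp (- a * of_real t) \<partial>lborel) = 1 / a"
    and "(\<integral>t. indicator {0<..} t *\<^sub>R exp (- Re a * t) \<partial>lborel) = 1 / Re a"
    and "integrable lborel (\<lambda>t. indicator {0<..} t *\<^sub>R exp (- Re a * t))"
proof -
  let ?b = "Re a"
  have a0: "a \<noteq> 0" using a by auto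
  have "filterlim (\<lambda>t. - ?b * t) at_bot at_top"
    by (rule filterlim_tendsto_neg_mult_at_bot[OF tendsto_const _ filterlim_ident]) (use a in simp)
  then have lim: "((\<lambda>t. exp (- ?b * t)) \<longlongrightarrow> 0) at_top"
    by (rule filterlim_compose[OF exp_at_bot])
  have der: "DERIV (\<lambda>t. - exp (- ?b * t) / ?b) t :> exp (- ?b * t)" for t
    by (rule derivative_eq_intros refl | use a in simp)+
  have cont: "isCont (\<lambda>t. exp (- ?b * t)) t" for t by (intro continuous_intros)
  have at0: "((\<lambda>t. - exp (- ?b * t) / ?b) \<longlongrightarrow> - (1 / ?b)) (at_right 0)"
    using a by (auto intro!: tendsto_eq_intros)
  have at_inf: "((\<lambda>t. - exp (- ?b * t) / ?b) \<longlongrightarrow> 0) at_top"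
    using tendsto_divide[OF tendsto_minus[OF lim] tendsto_const[of ?b]] a by simp
  have real: "set_integrable lborel (einterval 0 \<infinity>) (\<lambda>t. exp (- ?b * t))"
    "(LBINT t=0..\<infinity>. exp (- ?b * t)) = 0 - (- (1 / ?b))"
    by (rule interval_integral_FTC_nonneg[where F = "\<lambda>t. - exp (- ?b * t) / ?b", OF _ der cont];
        use at0 at_inf in \<open>simp add: ereal_tendsto_simps zero_ereal_def\<close>)+
  show i: "integrable lborel (\<lambda>t. indicator {0<..} t *\<^sub>R exp (- ?b * t))"
    using real(1) by (simp add: set_integrable_def zero_ereal_def)
  show "(\<integral>t. indicator {0<..} t *\<^sub>R exp (- ?b * t) \<partial>lborel) = 1 / ?b"
    using real(2) by (simp add: interval_lebesgue_integral_def set_lebesgue_integral_def zero_ereal_def)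
  show ic: "integrable lborel (\<lambda>t. indicator {0<..} t *\<^sub>R exp (- a * of_real t))"
  proof (rule Bochner_Integration.integrable_bound[OF i])
    show "AE t in lborel. norm (indicator {0<..} t *\<^sub>R exp (- a * of_real t))
        \<le> norm (indicator {0<..} t *\<^sub>R exp (- ?b * t))"
      by (intro AE_I2) (simp add: norm_exp_eq_Re)
  qed measurable
  have "(LBINT t=0..\<infinity>. exp (- a * of_real t)) = 0 - (- (1 / a))"
  proof (rule interval_integral_FTC_integrable[where F = "\<lambda>t. - exp (- a * of_real t) / a"];
      (simp only: zero_ereal_def ereal_tendsto_simps)?)
    show "((\<lambda>t. - exp (- a * of_real t) / a) has_vector_derivative exp (- a * of_real t)) (at t)" for t
      unfolding has_real_derivative_iff_has_vector_derivative[symmetric]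
      by (rule has_vector_derivative_real_field) (rule derivative_eq_intros refl | use a0 in simp)+
    show "isCont (\<lambda>t. exp (- a * of_real t)) t" for t by (intro continuous_intros)
    show "set_integrable lborel (einterval (ereal 0) \<infinity>) (\<lambda>t. exp (- a * of_real t))"
      using ic by (simp add: set_integrable_def)
    show "((\<lambda>t. - exp (- a * of_real t) / a) \<longlongrightarrow> - (1 / a)) (at_right 0)"
      using a0 by (auto intro!: tendsto_eq_intros)
    have "((\<lambda>t. exp (- a * of_real t)) \<longlongrightarrow> 0) at_top"
      by (rule tendsto_norm_zero_cancel) (use lim in \<open>simp add: norm_exp_eq_Re\<close>)
    then show "((\<lambda>t. - exp (- a * of_real t) / a) \<longlongrightarrow> 0) at_top"
      using tendsto_divide[OF tendsto_minus tendsto_const[of a]] a0 by fastforce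
  qed auto
  then show "(\<integral>t. indicator {0<..} t *\<^sub>R exp (- a * of_real t) \<partial>lborel) = 1 / a"
    by (simp add: interval_lebesgue_integral_def set_lebesgue_integral_def zero_ereal_def)
qed

lemma sqrt_coeff_sums:
  assumes "0 \<le> x" "x < 1"
  shows "(\<lambda>m. sqrt_coeff m * x ^ m) sums sqrt (1 - x)"
proof -
  have "(\<lambda>m. ((1/2) gchoose m) * (- x) ^ m) sums (1 + - x) powr (1/2)"
    by (rule gen_binomial_real) (use assms in auto)
  moreover have "((1/2) gchoose m) * (- x) ^ m = sqrt_coeff m * x ^ m" for m
    by (simp add: sqrt_coeff_def power_minus[of x])
  ultimately show ?thesis
    using assms by (simp add: powr_half_sqrt)
qed

text \<open>
  Expand \<open>\<surd>(1 - e\<^sup>-\<^sup>2\<^sup>t)\<close> into its binomial series and integrate term by term.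
\<close>

lemma J_series:
  assumes p: "0 < Re p"
  shows "J p = (\<Sum>m. of_real (sqrt_coeff m) / (p + 2 * of_nat m))"
proof -
  let ?f = "\<lambda>m t. of_real (sqrt_coeff m) * (indicator {0<..} t *\<^sub>R exp (- (p + 2 * of_nat m) * of_real t))"
  have pm: "0 < Re (p + 2 * of_nat m)" for m using p by simp
  have int: "integrable lborel (?f m)" for m
    by (intro integrable_mult_right laplace_exp(1) pm)
  have nrm: "norm (?f m t) = \<bar>sqrt_coeff m\<bar> * (indicator {0<..} t *\<^sub>R exp (- Re (p + 2 * of_nat m) * t))" for m t
    by (simp add: norm_mult norm_exp_eq_Re)
  have pt: "(\<lambda>m. ?f m t) sums (indicator {0<..} t *\<^sub>R (exp (- p * of_real t) * of_real (sqrt (1 - exp (- 2 * t)))))" for t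
  proof (cases "t > 0")
    case True
    have "(\<lambda>m. sqrt_coeff m * exp (- 2 * t) ^ m) sums sqrt (1 - exp (- 2 * t))"
      by (rule sqrt_coeff_sums) (use True in auto)
    then have "(\<lambda>m. exp (- p * of_real t) * of_real (sqrt_coeff m * exp (- 2 * t) ^ m))
        sums (exp (- p * of_real t) * of_real (sqrt (1 - exp (- 2 * t))))"
      by (intro sums_mult sums_of_real)
    moreover have "exp (- p * of_real t) * of_real (sqrt_coeff m * exp (- 2 * t) ^ m) = ?f m t" for m
    proof -
      have "complex_of_real (exp (- 2 * t) ^ m) = exp (- (2 * of_nat m) * of_real t)"
        by (simp add: exp_of_nat_mult[symmetric] exp_of_real[symmetric] mult_ac)
      then show ?thesis using True by (simp add: exp_add[symmetric] algebra_simps)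
    qed
    ultimately have "(\<lambda>m. ?f m t) sums (exp (- p * of_real t) * of_real (sqrt (1 - exp (- 2 * t))))"
      by (simp only:)
    then show ?thesis using True by (simp only: indicator_simps greaterThan_iff scaleR_one)
  qed simp
  have "(\<lambda>m. \<integral>t. ?f m t \<partial>lborel) sums (\<integral>t. (\<Sum>m. ?f m t) \<partial>lborel)"
  proof (rule sums_integral[OF int])
    have "summable (\<lambda>m. norm (?f m t))" for t
    proof (rule summable_comparison_test')
      fix m
      have "norm (?f m t) \<le> \<bar>sqrt_coeff m\<bar> * 1"
        unfolding nrm using p by (intro mult_left_mono) (auto simp: indicator_def intro!: mult_nonpos_nonneg)
      then show "norm (norm (?f m t)) \<le> \<bar>sqrt_coeff m\<bar> * 1"
        by (simp only: real_norm_def abs_norm_cancel)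
    qed (use summable_sqrt_coeff in simp)
    then show "AE t in lborel. summable (\<lambda>m. norm (?f m t))" by simp
    show "summable (\<lambda>m. \<integral>t. norm (?f m t) \<partial>lborel)"
    proof (rule summable_comparison_test')
      show "summable (\<lambda>m. \<bar>sqrt_coeff m\<bar> * (1 / Re p))" by (rule summable_mult2[OF summable_sqrt_coeff])
      fix m
      have "(\<integral>t. norm (?f m t) \<partial>lborel) = \<bar>sqrt_coeff m\<bar> * (1 / Re (p + 2 * of_nat m))"
        unfolding nrm by (simp only: Bochner_Integration.integral_mult_right_zero laplace_exp(3)[OF pm])
      also have "\<dots> \<le> \<bar>sqrt_coeff m\<bar> * (1 / Re p)"
        using p by (intro mult_left_mono divide_left_mono) auto
      finally show "norm (\<integral>t. norm (?f m t) \<partial>lborel) \<le> \<bar>sqrt_coeff m\<bar> * (1 / Re p)"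
        by simp
    qed
  qed
  moreover have "(\<integral>t. ?f m t \<partial>lborel) = of_real (sqrt_coeff m) / (p + 2 * of_nat m)" for m
    by (simp only: Bochner_Integration.integral_mult_right_zero laplace_exp(2)[OF pm]) simp
  moreover have "(\<integral>t. (\<Sum>m. ?f m t) \<partial>lborel) = J p"
    unfolding J_def set_lebesgue_integral_def using pt by (simp only: sums_iff)
  ultimately show ?thesis by (simp only: sums_iff)
qed

lemma Beta_one_right:
  fixes q :: real
  assumes q: "0 < q"
  shows "Beta q 1 = 1 / q"
proof -
  have "q \<notin> \<int>\<^sub>\<le>\<^sub>0" using q by (auto elim!: nonpos_Ints_cases)
  moreover have "Gamma q \<noteq> 0" using Gamma_real_pos[OF q] by simp
  ultimately show ?thesis by (simp add: Beta_def Gamma_plus1)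
qed

text \<open>
  The same expansion, now of the factor \<open>(1 - t)\<^sup>1\<^sup>/\<^sup>2\<close> in Euler's integral. Comparing it with the
  series of \<open>J\<close> replaces the substitution \<open>s = e\<^sup>-\<^sup>2\<^sup>t\<close>.
\<close>

lemma Beta_three_halves_series:
  fixes q :: real
  assumes q: "0 < q"
  shows "Beta q (3/2) = (\<Sum>m. sqrt_coeff m / (q + real m))"
proof -
  \<comment> \<open>The factor \<open>(1 - t) powr 0\<close>, equal to 1 for \<open>t < 1\<close> and to 0 for \<open>t = 1\<close>, makes \<open>?g m\<close> a Beta integrand.\<close>
  let ?g = "\<lambda>m t. indicator {0..1} t *\<^sub>R (t powr (q + real m - 1) * (1 - t) powr (1 - 1))"
  let ?f = "\<lambda>m t. sqrt_coeff m * ?g m t"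
  have qm: "0 < q + real m" for m using q by simp
  have gi: "integrable lborel (?g m)" for m
    using integrable_Beta[OF qm, of 1 m] by (simp add: set_integrable_def)
  have gv: "(\<integral>t. ?g m t \<partial>lborel) = 1 / (q + real m)" for m
  proof -
    have "(\<integral>t. ?g m t \<partial>lborel) = integral {0..1} (\<lambda>t. t powr (q + real m - 1) * (1 - t) powr (1 - 1))"
      using set_borel_integral_eq_integral(2)[OF integrable_Beta[OF qm, of 1 m]]
      by (simp only: set_lebesgue_integral_def zero_less_one simp_thms)
    also have "\<dots> = Beta (q + real m) 1"
      using has_integral_Beta_real[OF qm, of 1 m] by (simp only: zero_less_one integral_unique)
    finally show ?thesis by (simp only: Beta_one_right[OF qm])
  qed
  have int: "integrable lborel (?f m)" for m by (intro integrable_mult_right gi)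
  have nrm: "norm (?f m t) = \<bar>sqrt_coeff m\<bar> * ?g m t" for m t
    by (simp add: abs_mult indicator_def)
  have pt: "(\<lambda>m. ?f m t) sums (indicator {0..1} t *\<^sub>R (t powr (q - 1) * (1 - t) powr (3/2 - 1)))" for t
  proof (cases "0 < t \<and> t < 1")
    case True
    have "(\<lambda>m. t powr (q - 1) * (sqrt_coeff m * t ^ m)) sums (t powr (q - 1) * sqrt (1 - t))"
      by (intro sums_mult sqrt_coeff_sums) (use True in auto)
    moreover have "t powr (q - 1) * (sqrt_coeff m * t ^ m) = ?f m t" for m
    proof -
      have "t powr (q + real m - 1) = t powr (q - 1) * t ^ m"
        using True by (simp add: powr_realpow[symmetric] powr_add[symmetric] algebra_simps)
      then show ?thesis using True by simp
    qed
    ultimately show ?thesis using True by (simp add: powr_half_sqrt)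
  next
    case False
    then show ?thesis by (auto simp: indicator_def)
  qed
  have "(\<lambda>m. \<integral>t. ?f m t \<partial>lborel) sums (\<integral>t. (\<Sum>m. ?f m t) \<partial>lborel)"
  proof (rule sums_integral[OF int])
    have "summable (\<lambda>m. norm (?f m t))" for t
    proof (cases "0 < t \<and> t < 1")
      case True
      show ?thesis
      proof (rule summable_comparison_test')
        show "summable (\<lambda>m. \<bar>sqrt_coeff m\<bar> * t powr (q - 1))"
          by (rule summable_mult2[OF summable_sqrt_coeff])
        fix m
        have "t powr (q + real m - 1) \<le> t powr (q - 1)"
          using True by (intro powr_mono') auto
        then show "norm (norm (?f m t)) \<le> \<bar>sqrt_coeff m\<bar> * t powr (q - 1)"
          unfolding nrm using True by (simp add: mult_left_mono abs_mult)
      qed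
    next
      case False
      then have "norm (?f m t) = 0" for m by (auto simp: indicator_def)
      then show ?thesis by (simp only: summable_zero)
    qed
    then show "AE t in lborel. summable (\<lambda>m. norm (?f m t))" by blast
    show "summable (\<lambda>m. \<integral>t. norm (?f m t) \<partial>lborel)"
    proof (rule summable_comparison_test')
      show "summable (\<lambda>m. \<bar>sqrt_coeff m\<bar> * (1 / q))" by (rule summable_mult2[OF summable_sqrt_coeff])
      fix m
      have "(\<integral>t. norm (?f m t) \<partial>lborel) = \<bar>sqrt_coeff m\<bar> * (1 / (q + real m))"
        unfolding nrm by (simp only: Bochner_Integration.integral_mult_right_zero gv)
      also have "\<dots> \<le> \<bar>sqrt_coeff m\<bar> * (1 / q)"
        using q by (intro mult_left_mono divide_left_mono) auto
      finally show "norm (\<integral>t. norm (?f m t) \<partial>lborel) \<le> \<bar>sqrt_coeff m\<bar> * (1 / q)"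
        by simp
    qed
  qed
  moreover have "(\<integral>t. ?f m t \<partial>lborel) = sqrt_coeff m / (q + real m)" for m
    by (simp only: Bochner_Integration.integral_mult_right_zero gv) simp
  moreover have "(\<integral>t. (\<Sum>m. ?f m t) \<partial>lborel) = Beta q (3/2)"
  proof -
    have h: "0 < (3/2 :: real)" by simp
    have "(\<integral>t. (\<Sum>m. ?f m t) \<partial>lborel)
        = (\<integral>t. indicator {0..1} t *\<^sub>R (t powr (q - 1) * (1 - t) powr (3/2 - 1)) \<partial>lborel)"
      using pt by (simp only: sums_iff)
    also have "\<dots> = integral {0..1} (\<lambda>t. t powr (q - 1) * (1 - t) powr (3/2 - 1))"
      using set_borel_integral_eq_integral(2)[OF integrable_Beta[OF q h]]
      by (simp only: set_lebesgue_integral_def)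
    also have "\<dots> = Beta q (3/2)"
      by (rule integral_unique[OF has_integral_Beta_real[OF q h]])
    finally show ?thesis .
  qed
  ultimately show ?thesis by (simp only: sums_iff)
qed

lemma sqrt_coeff_series_derivative:
  assumes p: "0 < Re p"
  shows "((\<lambda>p. \<Sum>m. of_real (sqrt_coeff m) / (p + 2 * of_nat m)) has_field_derivative
      - (\<Sum>m. of_real (sqrt_coeff m) / (p + 2 * of_nat m)\<^sup>2)) (at p)"
proof -
  \<comment> \<open>A half-plane around \<open>p\<close> that keeps its distance from the poles.\<close>
  define d where "d = Re p / 2"
  have d: "d > 0" using p by (simp add: d_def)
  define S where "S = {z. Re z > d}"
  have S: "open S" "convex S" unfolding S_def by (rule open_halfspace_Re_gt convex_halfspace_Re_gt)+
  have dz: "d \<le> cmod (z + 2 * of_nat m)" if "z \<in> S" for z m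
    using that complex_Re_le_cmod[of "z + 2 * of_nat m"] by (simp add: S_def)
  have nz: "z + 2 * of_nat m \<noteq> 0" if "z \<in> S" for z and m :: nat
    using dz[OF that, of m] d by auto
  have pS: "p \<in> S" "p \<in> interior S" using p S by (auto simp: S_def d_def interior_open)
  have "((\<lambda>p. \<Sum>m. of_real (sqrt_coeff m) / (p + 2 * of_nat m)) has_field_derivative
      (\<Sum>m. - (of_real (sqrt_coeff m) / (p + 2 * of_nat m)\<^sup>2))) (at p)"
  proof (rule has_field_derivative_series'[OF S(2) _ _ pS(1) _ pS(2)])
    fix m z assume "z \<in> S"
    from nz[OF this, of m]
    show "((\<lambda>p. of_real (sqrt_coeff m) / (p + 2 * of_nat m)) has_field_derivative
        - (of_real (sqrt_coeff m) / (z + 2 * of_nat m)\<^sup>2)) (at z within S)"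
      by (auto intro!: derivative_eq_intros simp: power2_eq_square)
  next
    show "uniformly_convergent_on S (\<lambda>n z. \<Sum>m<n. - (of_real (sqrt_coeff m) / (z + 2 * of_nat m)\<^sup>2))"
    proof (rule Weierstrass_m_test')
      show "summable (\<lambda>m. \<bar>sqrt_coeff m\<bar> * (1 / d\<^sup>2))"
        by (rule summable_mult2[OF summable_sqrt_coeff])
      fix m z assume z: "z \<in> S"
      have "d\<^sup>2 \<le> (cmod (z + 2 * of_nat m))\<^sup>2" using dz[OF z] d by (intro power_mono) auto
      then have "\<bar>sqrt_coeff m\<bar> / (cmod (z + 2 * of_nat m))\<^sup>2 \<le> \<bar>sqrt_coeff m\<bar> / d\<^sup>2"
        using d by (intro frac_le) auto
      then show "norm (- (of_real (sqrt_coeff m) / (z + 2 * of_nat m)\<^sup>2)) \<le> \<bar>sqrt_coeff m\<bar> * (1 / d\<^sup>2)"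
        by (simp add: norm_divide norm_power)
    qed
    show "summable (\<lambda>m. of_real (sqrt_coeff m) / (p + 2 * of_nat m))"
    proof (rule summable_comparison_test')
      show "summable (\<lambda>m. \<bar>sqrt_coeff m\<bar> * (1 / d))"
        by (rule summable_mult2[OF summable_sqrt_coeff])
      fix m
      have "\<bar>sqrt_coeff m\<bar> / cmod (p + 2 * of_nat m) \<le> \<bar>sqrt_coeff m\<bar> / d"
        using d dz[OF pS(1)] by (intro frac_le) auto
      then show "norm (of_real (sqrt_coeff m) / (p + 2 * of_nat m)) \<le> \<bar>sqrt_coeff m\<bar> * (1 / d)"
        by (simp add: norm_divide)
    qed
  qed
  moreover have "summable (\<lambda>m. of_real (sqrt_coeff m) / (p + 2 * of_nat m)\<^sup>2)"
  proof (rule summable_comparison_test')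
    show "summable (\<lambda>m. \<bar>sqrt_coeff m\<bar> * (1 / d\<^sup>2))"
      by (rule summable_mult2[OF summable_sqrt_coeff])
    fix m
    have "d\<^sup>2 \<le> (cmod (p + 2 * of_nat m))\<^sup>2" using dz[OF pS(1)] d by (intro power_mono) auto
    then have "\<bar>sqrt_coeff m\<bar> / (cmod (p + 2 * of_nat m))\<^sup>2 \<le> \<bar>sqrt_coeff m\<bar> / d\<^sup>2"
      using d by (intro frac_le) auto
    then show "norm (of_real (sqrt_coeff m) / (p + 2 * of_nat m)\<^sup>2) \<le> \<bar>sqrt_coeff m\<bar> * (1 / d\<^sup>2)"
      by (simp add: norm_divide norm_power)
  qed
  ultimately show ?thesis by (simp add: suminf_minus)
qed

lemma Re_pos_nonpos_Ints: "0 < Re z \<Longrightarrow> z \<notin> \<int>\<^sub>\<le>\<^sub>0"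
  by (auto elim!: nonpos_Ints_cases)

text \<open>
  For positive real \<open>p\<close> both sides have the same series. They are holomorphic for \<open>Re p > 0\<close>, so
  the identity theorem extends the equality.
\<close>

lemma J_Beta:
  assumes p: "0 < Re p"
  shows "J p = Beta (3/2) (p / 2) / 2"
proof -
  define S where "S = {z. Re z > 0}"
  define L where "L p = (\<Sum>m. complex_of_real (sqrt_coeff m) / (p + 2 * of_nat m))" for p
  define U where "U = complex_of_real ` {0<..}"
  have S: "open S" "connected S" unfolding S_def
    by (auto intro: open_halfspace_Re_gt convex_connected convex_halfspace_Re_gt)
  have "L p - Beta (3/2) (p / 2) / 2 = 0"
  proof (rule analytic_continuation[OF _ S, of "\<lambda>p. L p - Beta (3/2) (p / 2) / 2" U 1])
    have "L holomorphic_on S"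
      unfolding L_def S_def
      by (rule holomorphic_onI, rule field_differentiable_at_within)
        (use sqrt_coeff_series_derivative in \<open>auto simp: field_differentiable_def\<close>)
    moreover have "3/2 \<notin> (\<int>\<^sub>\<le>\<^sub>0 :: complex set)" by (rule Re_pos_nonpos_Ints) simp
    ultimately show "(\<lambda>p. L p - Beta (3/2) (p / 2) / 2) holomorphic_on S"
      by (intro holomorphic_intros) (auto simp: S_def intro!: Re_pos_nonpos_Ints)
    show "U \<subseteq> S" by (auto simp: U_def S_def)
    show "1 \<in> S" by (simp add: S_def)
    show "p \<in> S" using p by (simp add: S_def)
    show "1 islimpt U"
      unfolding islimpt_approachable
    proof (intro allI impI)
      fix e :: real assume "e > 0"
      moreover from this have "complex_of_real (1 + e / 2) \<in> U"
        unfolding U_def by (intro imageI) simp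
      ultimately show "\<exists>x'\<in>U. x' \<noteq> 1 \<and> dist x' 1 < e"
        by (intro bexI[of _ "complex_of_real (1 + e / 2)"]) (auto simp: dist_norm)
    qed
    fix z assume "z \<in> U"
    then obtain x where x: "x > 0" "z = of_real x" by (auto simp: U_def)
    have summ: "summable (\<lambda>m. sqrt_coeff m / (x / 2 + real m))"
    proof (rule summable_comparison_test')
      show "summable (\<lambda>m. \<bar>sqrt_coeff m\<bar> * (1 / (x / 2)))"
        by (rule summable_mult2[OF summable_sqrt_coeff])
      fix m
      have "\<bar>sqrt_coeff m\<bar> / \<bar>x / 2 + real m\<bar> \<le> \<bar>sqrt_coeff m\<bar> / (x / 2)"
        using x by (intro frac_le) auto
      then show "norm (sqrt_coeff m / (x / 2 + real m)) \<le> \<bar>sqrt_coeff m\<bar> * (1 / (x / 2))" by simp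
    qed
    have "L z = (\<Sum>m. complex_of_real (1/2 * (sqrt_coeff m / (x / 2 + real m))))"
      unfolding L_def x by (intro suminf_cong) (use x in \<open>simp add: field_simps\<close>)
    also have "\<dots> = complex_of_real (\<Sum>m. 1/2 * (sqrt_coeff m / (x / 2 + real m)))"
      by (rule suminf_of_real[symmetric]) (rule summable_mult[OF summ])
    also have "(\<Sum>m. 1/2 * (sqrt_coeff m / (x / 2 + real m))) = 1/2 * Beta (x / 2) (3/2)"
      using x by (simp only: suminf_mult[OF summ] Beta_three_halves_series[of "x / 2"] half_gt_zero)
    also have "complex_of_real (1/2 * Beta (x / 2) (3/2)) = Beta (3/2) (z / 2) / 2"
      using Beta_complex_of_real[of "3/2" "x / 2"] by (simp add: x Beta_commute)
    finally show "L z - Beta (3/2) (z / 2) / 2 = 0" by simp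
  qed
  then show ?thesis using J_series[OF p] by (simp add: L_def)
qed

text \<open>
  The series on the left is \<open>-J'(p)\<close>, and the logarithmic derivative of the Beta function is a
  difference of digamma values.
\<close>

lemma sqrt_coeff_square_series:
  assumes p: "0 < Re p"
  shows "(\<Sum>m. of_real (sqrt_coeff m) / (p + 2 * of_nat m)\<^sup>2)
    = J p * ((Digamma (3/2 + p / 2) - Digamma (p / 2)) / 2)"
proof -
  have "((\<lambda>p. Beta (3/2) (p / 2) / 2) has_field_derivative
      - (\<Sum>m. of_real (sqrt_coeff m) / (p + 2 * of_nat m)\<^sup>2)) (at p)"
  proof (rule has_field_derivative_transform_within_open[OF sqrt_coeff_series_derivative[OF p]])
    show "open {z. Re z > 0}" by (rule open_halfspace_Re_gt)
    show "p \<in> {z. Re z > 0}" using p by simp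
    fix z assume "z \<in> {z. Re z > 0}"
    then show "(\<Sum>m. of_real (sqrt_coeff m) / (z + 2 * of_nat m)) = Beta (3/2) (z / 2) / 2"
      using J_series[of z] J_Beta[of z] by simp
  qed
  moreover have "((\<lambda>p. Beta (3/2) (p / 2) / 2) has_field_derivative
      (Beta (3/2) (p / 2) * (Digamma (p / 2) - Digamma (3/2 + p / 2)) * (1 / 2)) / 2) (at p)"
  proof (intro DERIV_cdivide)
    have "((\<lambda>y. Beta (3/2) y) has_field_derivative
        Beta (3/2) (p / 2) * (Digamma (p / 2) - Digamma (3/2 + p / 2))) (at (p / 2))"
      using p by (intro has_field_derivative_Beta2 Re_pos_nonpos_Ints) auto
    moreover have "((\<lambda>p. p / 2) has_field_derivative 1 / 2) (at p)"
      by (auto intro!: derivative_eq_intros)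
    ultimately show "((\<lambda>p. Beta (3/2) (p / 2)) has_field_derivative
        Beta (3/2) (p / 2) * (Digamma (p / 2) - Digamma (3/2 + p / 2)) * (1 / 2)) (at p)"
      by (rule DERIV_chain2)
  qed
  ultimately have "- (\<Sum>m. of_real (sqrt_coeff m) / (p + 2 * of_nat m)\<^sup>2)
      = (Beta (3/2) (p / 2) * (Digamma (p / 2) - Digamma (3/2 + p / 2)) * (1 / 2)) / 2"
    by (rule DERIV_unique)
  then show ?thesis
    unfolding J_Beta[OF p] by (simp add: algebra_simps minus_equation_iff)
qed

text \<open>
  Since \<open>1 / (1 + e\<^sup>-\<^sup>t) = (1 - e\<^sup>-\<^sup>t) / (1 - e\<^sup>-\<^sup>2\<^sup>t)\<close>, the alternating series is expanded in pairs of
  consecutive terms. This makes the convergence absolute; the norms of the terms are dominated by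
  a telescoping series.
\<close>

lemma nielsen_beta_series:
  assumes p: "0 < Re p"
  shows "(\<lambda>m. 1 / (p + 2 * of_nat m) - 1 / (p + 2 * of_nat m + 1)) sums nielsen_beta p"
proof -
  define a where "a = Re p"
  have a: "a > 0" using p by (simp add: a_def)
  let ?e = "\<lambda>q t. indicator {0<..} t *\<^sub>R exp (- q * complex_of_real t)"
  let ?f = "\<lambda>m t. ?e (p + 2 * of_nat m) t - ?e (p + 2 * of_nat m + 1) t"
  have pm: "0 < Re (p + 2 * of_nat m)" "0 < Re (p + 2 * of_nat m + 1)" for m :: nat using p by auto
  have int: "integrable lborel (?f m)" for m
    by (intro Bochner_Integration.integrable_diff laplace_exp(1) pm)
  have fac: "?f m t = indicator {0<..} t *\<^sub>R (exp (- p * of_real t) * of_real (1 - exp (- t)) * of_real (exp (- 2 * t) ^ m))" for m t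
  proof -
    have "complex_of_real (exp (- 2 * t) ^ m) = exp (- (2 * of_nat m) * of_real t)"
      by (simp add: exp_of_nat_mult[symmetric] exp_of_real[symmetric] mult_ac)
    moreover have "complex_of_real (exp (- t)) = exp (- of_real t)" by (simp add: exp_of_real[symmetric])
    ultimately show ?thesis
      by (cases "t > 0") (simp_all add: exp_add[symmetric] algebra_simps)
  qed
  have nrm: "norm (?f m t) = indicator {0<..} t *\<^sub>R exp (- Re (p + 2 * of_nat m) * t)
      - indicator {0<..} t *\<^sub>R exp (- Re (p + 2 * of_nat m + 1) * t)" for m t
  proof (cases "t > 0")
    case True
    have e: "exp (- 2 * t) ^ m = exp (- 2 * t * real m)" by (simp add: exp_of_nat_mult[symmetric] mult_ac)
    have "norm (?f m t) = exp (- Re p * t) * (1 - exp (- t)) * exp (- 2 * t * real m)"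
      unfolding fac e using True
      by (simp only: indicator_simps greaterThan_iff scaleR_one norm_mult norm_exp_eq_Re norm_of_real) simp
    also have "\<dots> = exp (- Re p * t) * exp (- 2 * t * real m) - exp (- Re p * t) * exp (- t) * exp (- 2 * t * real m)"
      by (simp add: algebra_simps)
    also have "\<dots> = exp (- Re (p + 2 * of_nat m) * t) - exp (- Re (p + 2 * of_nat m + 1) * t)"
      by (simp only: exp_add[symmetric]) (simp add: algebra_simps)
    finally show ?thesis using True by simp
  qed simp
  have pt: "(\<lambda>m. ?f m t) sums (indicator {0<..} t *\<^sub>R (exp (- p * of_real t) / of_real (1 + exp (- t))))" for t
  proof (cases "t > 0")
    case True
    have e: "exp (- 2 * t) = exp (- t) * exp (- t)" by (simp add: exp_add[symmetric])
    have lt: "exp (- t) < 1" "exp (- 2 * t) < 1" using True by auto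
    have "(\<lambda>m. exp (- 2 * t) ^ m) sums (1 / (1 - exp (- 2 * t)))"
      by (rule geometric_sums) (use lt in simp)
    then have "(\<lambda>m. exp (- p * of_real t) * of_real (1 - exp (- t)) * of_real (exp (- 2 * t) ^ m))
        sums (exp (- p * of_real t) * of_real (1 - exp (- t)) * of_real (1 / (1 - exp (- 2 * t))))"
      by (intro sums_mult sums_of_real)
    also have "exp (- p * of_real t) * complex_of_real (1 - exp (- t)) * of_real (1 / (1 - exp (- 2 * t)))
        = exp (- p * of_real t) * of_real ((1 - exp (- t)) * (1 / (1 - exp (- 2 * t))))"
      by (simp only: of_real_mult mult.assoc)
    also have "(1 - exp (- t)) * (1 / (1 - exp (- 2 * t))) = 1 / (1 + exp (- t))"
    proof -
      have "1 - exp (- 2 * t) = (1 - exp (- t)) * (1 + exp (- t))"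
        unfolding e by (simp add: algebra_simps)
      then show ?thesis using lt by simp
    qed
    finally show ?thesis unfolding fac using True by (simp add: divide_inverse)
  qed simp
  have lap: "(\<integral>t. ?f m t \<partial>lborel) = 1 / (p + 2 * of_nat m) - 1 / (p + 2 * of_nat m + 1)" for m
    using laplace_exp(1,2)[OF pm(1)[of m]] laplace_exp(1,2)[OF pm(2)[of m]]
    by (simp only: Bochner_Integration.integral_diff)
  have "(\<lambda>m. \<integral>t. ?f m t \<partial>lborel) sums (\<integral>t. (\<Sum>m. ?f m t) \<partial>lborel)"
  proof (rule sums_integral[OF int])
    have "summable (\<lambda>m. norm (?f m t))" for t
    proof (cases "t > 0")
      case True
      have "summable (\<lambda>m. cmod (exp (- p * of_real t) * of_real (1 - exp (- t))) * (exp (- 2 * t)) ^ m)"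
        using True by (intro summable_mult summable_geometric) auto
      then show ?thesis unfolding fac using True by (simp add: norm_mult norm_power mult.assoc)
    qed simp
    then show "AE t in lborel. summable (\<lambda>m. norm (?f m t))" by blast
    show "summable (\<lambda>m. \<integral>t. norm (?f m t) \<partial>lborel)"
    proof (rule summable_comparison_test')
      have "(\<lambda>m. 1 / (a + 2 * real m)) \<longlonglongrightarrow> 0"
        by (intro tendsto_divide_0[OF tendsto_const] filterlim_at_top_imp_at_infinity
            filterlim_tendsto_add_at_top[OF tendsto_const]
            filterlim_tendsto_pos_mult_at_top[OF tendsto_const] filterlim_real_sequentially) auto
      then show "summable (\<lambda>m. 1 / (a + 2 * real m) - 1 / (a + 2 * real (Suc m)))"
        by (rule telescope_summable')
      fix m
      have "(\<integral>t. norm (?f m t) \<partial>lborel) = 1 / (a + 2 * real m) - 1 / (a + 2 * real m + 1)"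
        unfolding nrm using laplace_exp(3,4)[OF pm(1)[of m]] laplace_exp(3,4)[OF pm(2)[of m]]
        by (simp only: Bochner_Integration.integral_diff) (simp add: a_def)
      moreover have "1 / (a + 2 * real (Suc m)) \<le> 1 / (a + 2 * real m + 1)"
        using a by (intro divide_left_mono) (auto intro!: mult_pos_pos add_pos_nonneg)
      moreover have "1 / (a + 2 * real m + 1) \<le> 1 / (a + 2 * real m)"
        using a by (intro divide_left_mono) (auto intro!: mult_pos_pos add_pos_nonneg)
      ultimately show "norm (\<integral>t. norm (?f m t) \<partial>lborel) \<le> 1 / (a + 2 * real m) - 1 / (a + 2 * real (Suc m))"
        by simp
    qed
  qed
  moreover have "(\<integral>t. (\<Sum>m. ?f m t) \<partial>lborel) = nielsen_beta p"
    unfolding nielsen_beta_def set_lebesgue_integral_def using pt by (simp only: sums_iff)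
  ultimately show ?thesis by (simp only: lap)
qed

text \<open>
  The pairs of consecutive terms are the terms of the digamma series at \<open>(p + 1) / 2\<close> and \<open>p / 2\<close>.
\<close>

lemma nielsen_beta_Digamma:
  assumes p: "0 < Re p"
  shows "nielsen_beta p = (Digamma ((p + 1) / 2) - Digamma (p / 2)) / 2"
proof -
  have p0: "p \<noteq> 0" "p + 1 \<noteq> 0" using p by (auto simp: complex_eq_iff)
  have nz: "p + 2 * of_nat m \<noteq> 0" "p + 2 * of_nat m + 1 \<noteq> 0" for m :: nat
    using p by (auto simp: complex_eq_iff)
  have s: "summable (\<lambda>m. inverse (of_nat (Suc m)) - inverse ((p + 1) / 2 + of_nat m))"
    "summable (\<lambda>m. inverse (of_nat (Suc m)) - inverse (p / 2 + of_nat m))"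
    using p0 by (intro summable_Digamma; simp)+
  have "Digamma ((p + 1) / 2) - Digamma (p / 2)
      = (\<Sum>m. (inverse (of_nat (Suc m)) - inverse ((p + 1) / 2 + of_nat m))
          - (inverse (of_nat (Suc m)) - inverse (p / 2 + of_nat m)))"
    unfolding Digamma_def suminf_diff[OF s, symmetric] by simp
  also have "\<dots> = (\<Sum>m. 2 * (1 / (p + 2 * of_nat m) - 1 / (p + 2 * of_nat m + 1)))"
  proof (rule suminf_cong)
    fix m
    have "inverse (p / 2 + of_nat m) = 2 / (p + 2 * of_nat m)"
      using nz(1)[of m] by (simp add: field_simps)
    moreover have "inverse ((p + 1) / 2 + of_nat m) = 2 / (p + 2 * of_nat m + 1)"
      using nz(2)[of m] by (simp add: field_simps)
    ultimately show "(inverse (of_nat (Suc m)) - inverse ((p + 1) / 2 + of_nat m))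
          - (inverse (of_nat (Suc m)) - inverse (p / 2 + of_nat m))
        = 2 * (1 / (p + 2 * of_nat m) - 1 / (p + 2 * of_nat m + 1))"
      by (simp add: algebra_simps)
  qed
  also have "\<dots> = 2 * nielsen_beta p"
    using sums_mult[OF nielsen_beta_series[OF p], of 2] by (simp only: sums_iff)
  finally show ?thesis by simp
qed

text \<open>
  The digamma value at \<open>p/2 + 3/2\<close> exceeds that at \<open>(p + 1)/2\<close> by \<open>2 / (p + 1)\<close>, which accounts for
  the rational term.
\<close>

lemma J_beta_product:
  assumes p: "0 < Re p"
  shows "(\<Sum>m. of_real (sqrt_coeff m) / (p + 2 * of_nat m)\<^sup>2) = J p * (nielsen_beta p + 1 / (p + 1))"
proof -
  have p1: "p + 1 \<noteq> 0" using p by (auto simp: complex_eq_iff)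
  have eq: "3/2 + p / 2 = (p + 1) / 2 + 1" by (simp add: field_simps)
  have "(p + 1) / 2 \<noteq> 0" using p1 by simp
  then have "Digamma (3/2 + p / 2) = Digamma ((p + 1) / 2) + 1 / ((p + 1) / 2)"
    unfolding eq by (rule Digamma_plus1)
  then have "(Digamma (3/2 + p / 2) - Digamma (p / 2)) / 2 = nielsen_beta p + 1 / (p + 1)"
    unfolding nielsen_beta_Digamma[OF p] by (simp add: diff_divide_distrib add_divide_distrib)
  then show ?thesis by (simp only: sqrt_coeff_square_series[OF p])
qed

text \<open>
  The recurrence of the digamma function at \<open>p/2\<close> produces the term \<open>2/p\<close> that the left-hand side
  compensates for.
\<close>

lemma harmonic_fun_difference:
  assumes p: "0 < Re p"
  shows "harmonic_fun ((p + 1) / 2) - harmonic_fun (p / 2) + 2 / p = 2 * (nielsen_beta p + 1 / (p + 1))"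
proof -
  have p0: "p \<noteq> 0" "p + 1 \<noteq> 0" using p by (auto simp: complex_eq_iff)
  have "Digamma ((p + 1) / 2 + 1) = Digamma ((p + 1) / 2) + 1 / ((p + 1) / 2)"
    "Digamma (p / 2 + 1) = Digamma (p / 2) + 1 / (p / 2)"
    using p0 by (intro Digamma_plus1; simp)+
  then show ?thesis
    unfolding harmonic_fun_def nielsen_beta_Digamma[OF p] by simp
qed

section \<open>The reproducing kernel of the image of the projection\<close>

theorem theorem8:
  fixes n :: nat and z w :: complex
  assumes "n \<ge> 1" and "z \<in> upper_hp" and "w \<in> upper_hp"
  shows "is_reproducing_kernel n (P_T n ` bergman_vec n) (K_T n) \<and>
    is_integral_kernel n (P_T n) (K_T n) \<and>
    K_T n z w n n = G (2 * (int n - 1)) z w \<and>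
    G (2 * (int n - 1)) z w =
      -1 / (of_real pi * (z - cnj w + 2 * (of_nat n - 1) * \<i>)\<^sup>2) \<and>
    (\<forall>j\<in>{1..<n}. \<forall>k\<in>{1..<n}.
      K_T n z w j k = - G (int j + int k) z w + G (int j + int k - 2) z w) \<and>
    (\<forall>j\<in>{1..<n}. \<forall>p. p = - \<i> * (z - cnj w) + of_nat j + (of_nat n - 2) \<longrightarrow>
      K_T n z w j n = 1 / of_real pi * J p * (nielsen_beta p + 1 / (p + 1)) \<and>
      1 / of_real pi * J p * (nielsen_beta p + 1 / (p + 1)) =
        J p / (2 * of_real pi) *
          (harmonic_fun ((p + 1) / 2) - harmonic_fun (p / 2) + 2 / p))"
proof (intro conjI ballI allI impI)
  show "is_reproducing_kernel n (P_T n ` bergman_vec n) (K_T n)"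
    by (rule K_T_reproducing[OF assms(1)])
  show "is_integral_kernel n (P_T n) (K_T n)"
    by (rule K_T_integral_kernel[OF assms(1)])
  show "K_T n z w n n = G (2 * (int n - 1)) z w"
    using assms by (simp add: K_T_eq_strip_kernel strip_kernel_top)
  show "G (2 * (int n - 1)) z w = -1 / (of_real pi * (z - cnj w + 2 * (of_nat n - 1) * \<i>)\<^sup>2)"
    by (simp add: G_def)
next
  fix j k assume "j \<in> {1..<n}" "k \<in> {1..<n}"
  then show "K_T n z w j k = - G (int j + int k) z w + G (int j + int k - 2) z w"
    using assms by (simp add: K_T_eq_strip_kernel strip_kernel_inner)
next
  fix j p assume j: "j \<in> {1..<n}" and p: "p = - \<i> * (z - cnj w) + of_nat j + (of_nat n - 2)"
  have jn: "1 \<le> j" "j < n" using j by auto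
  note last = strip_kernel_last_column[OF jn assms(2,3) p]
  have "K_T n z w j n = strip_kernel n z w j n"
    using assms j by (intro K_T_eq_strip_kernel) auto
  also have "\<dots> = 1 / of_real pi * (J p * (nielsen_beta p + 1 / (p + 1)))"
    by (simp only: last(1) J_beta_product[OF last(2)])
  finally show "K_T n z w j n = 1 / of_real pi * J p * (nielsen_beta p + 1 / (p + 1))"
    by (simp only: mult.assoc)
  show "1 / of_real pi * J p * (nielsen_beta p + 1 / (p + 1)) =
      J p / (2 * of_real pi) * (harmonic_fun ((p + 1) / 2) - harmonic_fun (p / 2) + 2 / p)"
  proof -
    have "1 / of_real pi * J p * q = J p / (2 * of_real pi) * (2 * q)" for q
      by simp
    then show ?thesis
      by (simp only: harmonic_fun_difference[OF last(2)])
  qed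
qed

end
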